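(* For all $s\in\left(\frac12,\infty\right)$ and all $N\geq 1$, $$\mathfrak{F}_N^{(2,0)}(1,s-1)=\frac{\mathfrak{F}_N^{(0)}(s)}{16}\left(\frac{N^4}{(2s+3)(2s-1)}+\frac{4sN^3}{(2s+3)(2s-1)}+\frac{4(2s^3+s^2-1)N^2}{(2s+3)(2s-1)(2s+1)}-\frac{8sN}{(2s+3)(2s-1)(2s+1)}\right).$$
   Context: Let $\mathbb{U}(N)$ be the group of $N\times N$ unitary matrices with Haar probability measure $\mu_{\mathrm{Haar}}$. For $\mathbf{A}\in\mathbb{U}(N)$ with eigenvalues $e^{\mathrm{i}\theta_1},\ldots,e^{\mathrm{i}\theta_N}$, $\theta_j\in[0,2\pi)$, put $$Z_{\mathbf{A}}(\theta)=\exp\left(\mathrm{i}N\frac{\theta+\pi}{2}-\mathrm{i}\sum_{j=1}^N\frac{\theta_j}{2}\right)\prod_{j=1}^N\left(1-e^{\mathrm{i}(\theta_j-\theta)}\right),$$ and let primes denote derivatives in $\theta$. Then $$\mathfrak{F}_N^{(2,0)}(1,s-1)=\int_{\mathbb{U}(N)}\left|Z_{\mathbf{A}}''(0)\right|^2\left|Z_{\mathbf{A}}(0)\right|^{2s-2}d\mu_{\mathrm{Haar}}(\mathbf{A}),\qquad\mathfrak{F}_N^{(0)}(s)=\int_{\mathbb{U}(N)}\left|Z_{\mathbf{A}}(0)\right|^{2s}d\mu_{\mathrm{Haar}}(\mathbf{A}).$$ *)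

theory Defs
  imports
    "HOL-Probability.Probability"
    "HOL-Computational_Algebra.Polynomial"
begin

text \<open>
  Matrices of size \<open>N \<times> N\<close> have type \<open>complex^'n^'n\<close> with \<open>N = CARD('n)\<close>.
\<close>

definition adjoint_matrix :: "complex^'n^'n \<Rightarrow> complex^'n^'n" where
  "adjoint_matrix A = map_matrix cnj (transpose A)"

definition unitary_group :: "(complex^'n^'n) set" where
  "unitary_group = {A. A ** adjoint_matrix A = mat 1 \<and> adjoint_matrix A ** A = mat 1}"

text \<open>
  On the compact group of unitary matrices a left-invariant Borel probability measure exists, is
  unique, and is also right-invariant; regularity is automatic.
\<close>

definition haar_unitary :: "(complex^'n^'n) measure \<Rightarrow> bool" where
  "haar_unitary \<mu> \<longleftrightarrow>
     prob_space \<mu> \<and>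
     sets \<mu> = sets (restrict_space borel unitary_group) \<and>
     (\<forall>U\<in>unitary_group. distr \<mu> \<mu> (\<lambda>A. U ** A) = \<mu>)"

definition charpoly :: "complex^'n^'n \<Rightarrow> complex poly" where
  "charpoly A = det (\<chi> i j. (if i = j then [:0, 1:] else 0) - [:A $ i $ j:])"

text \<open>
  The multiset of the \<open>\<theta>\<^sub>j \<in> [0, 2\<pi>)\<close>: the arguments of the eigenvalues, counted with algebraic
  multiplicity.
\<close>

definition eigenangles :: "complex^'n^'n \<Rightarrow> real multiset" where
  "eigenangles A = image_mset Arg2pi (proots (charpoly A))"

definition Z :: "complex^'n^'n \<Rightarrow> real \<Rightarrow> complex" where
  "Z A \<theta> =
     exp (\<i> * of_nat CARD('n) * (of_real (\<theta> + pi) / 2)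
          - \<i> * (\<Sum>\<phi>\<in>#eigenangles A. of_real \<phi> / 2))
     * (\<Prod>\<phi>\<in>#eigenangles A. 1 - exp (\<i> * of_real (\<phi> - \<theta>)))"

definition Z' :: "complex^'n^'n \<Rightarrow> real \<Rightarrow> complex" where
  "Z' A \<theta> = vector_derivative (Z A) (at \<theta>)"

definition Z'' :: "complex^'n^'n \<Rightarrow> real \<Rightarrow> complex" where
  "Z'' A \<theta> = vector_derivative (Z' A) (at \<theta>)"

text \<open>
  In the next two definitions \<open>0 powr a = 0\<close>, also for \<open>a \<le> 0\<close>. This convention is only used where
  \<open>Z A 0 = 0\<close>, that is, on the Haar null set of matrices having \<open>1\<close> as an eigenvalue.
\<close>

definition integrand_20 :: "real \<Rightarrow> complex^'n^'n \<Rightarrow> real" where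
  "integrand_20 s A = (cmod (Z'' A 0))\<^sup>2 * cmod (Z A 0) powr (2 * s - 2)"

definition integrand_0 :: "real \<Rightarrow> complex^'n^'n \<Rightarrow> real" where
  "integrand_0 s A = cmod (Z A 0) powr (2 * s)"

text \<open>
  \<open>F_20 \<mu> s\<close> is \<open>\<FF>\<^sub>N\<^bsup>(2,0)\<^esup>(1, s - 1)\<close>.
\<close>

definition F_20 :: "(complex^'n^'n) measure \<Rightarrow> real \<Rightarrow> real" where
  "F_20 \<mu> s = (LINT A|\<mu>. integrand_20 s A)"

definition F_0 :: "(complex^'n^'n) measure \<Rightarrow> real \<Rightarrow> real" where
  "F_0 \<mu> s = (LINT A|\<mu>. integrand_0 s A)"

end

theory Submission
  imports Defs "HOL-Computational_Algebra.Fundamental_Theorem_Algebra"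
begin

text \<open>
  Put \<open>C\<^sub>A(u) = det((1 + \<i>u) - (1 - \<i>u)A) = \<Sum>\<^sub>k c\<^sub>k u\<^sup>k\<close> and \<open>D = c\<^sub>0 = det(1 - A)\<close>. If \<open>D\<close> is nonzero, the
  Cayley transform \<open>H = \<i>(1 + A)(1 - A)\<^bsup>-1\<^esup>\<close> is Hermitian and \<open>C\<^sub>A(u) = D det(1 + uH)\<close>, so that
  \<open>c\<^sub>k = D e\<^sub>k\<close> with the elementary symmetric functions \<open>e\<^sub>k\<close> of the eigenvalues of \<open>H\<close>, which are real.
  With \<open>u = tan(\<theta>/2)\<close> one has \<open>Z\<^sub>A(\<theta>) = K cos\<^sup>N(\<theta>/2) C\<^sub>A(tan(\<theta>/2))\<close> for a constant \<open>K\<close> of modulus one,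
  whence \<open>|Z\<^sub>A(0)| = |D|\<close> and \<open>|Z\<^sub>A''(0)| = |2c\<^sub>2 - Nc\<^sub>0|/4\<close>. With \<open>M\<^sub>j\<^sub>k\<close> the Haar average of
  \<open>|D|\<^bsup>2s\<^esup> e\<^sub>j e\<^sub>k\<close>, the claim is about \<open>(4M\<^sub>2\<^sub>2 - 4N M\<^sub>0\<^sub>2 + N\<^sup>2 M\<^sub>0\<^sub>0)/16\<close>, where \<open>M\<^sub>0\<^sub>0\<close> is
  \<open>\<FF>\<^sub>N\<^bsup>(0)\<^esup>(s)\<close>. The proof finds five linear equations between \<open>M\<^sub>0\<^sub>0\<close> and the five unknowns
  \<open>M\<^sub>0\<^sub>2, M\<^sub>1\<^sub>1, M\<^sub>1\<^sub>3, M\<^sub>0\<^sub>4, M\<^sub>2\<^sub>2\<close> and solves them (\<open>moment_system_solution\<close>).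

  The equations come from invariance. For a unit vector \<open>v\<close> the matrix \<open>R\<^sub>v(z) = 1 + (z - 1)vv\<^sup>*\<close> is
  unitary for \<open>|z| = 1\<close>, so the derivative at \<open>t = 0\<close> of \<open>g(R\<^sub>v(e\<^bsup>\<i>t\<^esup>)A)\<close> has average zero
  (\<open>flow_integral_eq_0\<close>). By the matrix determinant lemma \<open>C\<close> is affine in \<open>z\<close> along this flow
  (\<open>cayley_poly_rank_one_update\<close>), with a slope \<open>b\<^sub>v\<close> that is a quadratic form in \<open>v\<close>. The functions \<open>g\<close>
  are \<open>|D|\<^bsup>2s-2\<^esup> cnj(c\<^sub>j) c\<^sub>l\<close>, summed over the standard basis vectors \<open>v\<close>, and \<open>|D|\<^bsup>2s-2\<^esup> cnj(c\<^sub>j) b\<^sub>v\<^sub>,\<^sub>k\<close>,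
  summed over a finite weighted family of vectors that turns \<open>(v\<^sup>*Pv)(v\<^sup>*Qv)\<close> into
  \<open>tr P tr Q + tr(PQ)\<close> (\<open>frame_sum_herm_form_mult\<close>). A resolvent identity writes the traces that
  arise as quadratic expressions in the \<open>c\<^sub>k\<close> (\<open>coeff_trace_poly_Suc\<close>, \<open>frame_coeff_recurrence\<close>), so the
  averages reduce to the \<open>M\<^sub>j\<^sub>k\<close>.

  For \<open>s < 1\<close> the weight \<open>|D|\<^bsup>2s-2\<^esup>\<close> is singular. It is replaced by \<open>(|D|\<^sup>2 + \<epsilon>)\<^bsup>s-1\<^esup>\<close>, and \<open>\<epsilon>\<close> tends to
  zero by dominated convergence (\<open>regularised_limit\<close>). The majorant is integrable because \<open>|D|\<^bsup>-a\<^esup>\<close> has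
  finite average for \<open>a < 1\<close>: in \<open>det(1 - diag(z\<^sub>1,\<dots>,z\<^sub>N)A)\<close>, which is affine in every \<open>z\<^sub>i\<close> and equals
  \<open>1\<close> at \<open>z = 0\<close>, the phases can be averaged one after the other, each at the cost of a constant factor
  (\<open>row_det_moment_step\<close>). The choice of the five equations is dictated by this limit: only products
  \<open>e\<^sub>j e\<^sub>k |D|\<^bsup>2s\<^esup>\<close>, which are \<open>O(|D|\<^bsup>2s-2\<^esup>)\<close>, may survive. Higher moments of \<open>H\<close>, such as that of
  \<open>tr H\<^sup>4\<close>, are infinite for small \<open>s\<close>.
\<close>

section \<open>The Cayley polynomial and rank-one multiplications\<close>

definition cayley_matrix :: "complex^'n^'n \<Rightarrow> complex \<Rightarrow> complex^'n^'n" where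
  "cayley_matrix A u = (\<chi> i j. (1 + \<i> * u) * mat 1 $ i $ j - (1 - \<i> * u) * A $ i $ j)"

text \<open>
  On \<open>det(1 - A) \<noteq> 0\<close> this is \<open>det(1 - A) det(1 + uH)\<close> as a polynomial in \<open>u\<close>, where \<open>H\<close> is the
  Cayley transform of \<open>A\<close>.
\<close>

definition cayley_poly :: "complex^'n^'n \<Rightarrow> complex poly" where
  "cayley_poly A = det (\<chi> i j. [: mat 1 $ i $ j - A $ i $ j, \<i> * (mat 1 $ i $ j + A $ i $ j) :])"

text \<open>
  For a unit vector \<open>v\<close> this multiplies the direction \<open>v\<close> by \<open>z\<close> and fixes its orthogonal complement. It
  takes the place of the one-parameter groups \<open>exp(\<i>tX)\<close>: along it determinants are affine in \<open>z\<close>.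
\<close>

definition rank_one_update :: "complex^'n \<Rightarrow> complex \<Rightarrow> complex^'n^'n" where
  "rank_one_update v z = (\<chi> i j. mat 1 $ i $ j + (z - 1) * v $ i * cnj (v $ j))"

abbreviation unit_vec :: "complex^'n \<Rightarrow> bool" where
  "unit_vec v \<equiv> (\<Sum>i\<in>UNIV. v $ i * cnj (v $ i)) = 1"

text \<open>
  The coefficient of \<open>z\<close> in the affine function \<open>z \<mapsto> cayley_poly (rank_one_update v z ** A)\<close>.
\<close>

definition slope_poly :: "complex^'n \<Rightarrow> complex^'n^'n \<Rightarrow> complex poly" where
  "slope_poly v A = cayley_poly A - cayley_poly (rank_one_update v 0 ** A)"

definition herm_form :: "complex^'n \<Rightarrow> complex^'n^'n \<Rightarrow> complex" where
  "herm_form v B = (\<Sum>i\<in>UNIV. \<Sum>j\<in>UNIV. cnj (v $ i) * B $ i $ j * v $ j)"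

lemma poly_det: "poly (det M) u = det (\<chi> i j. poly (M $ i $ j) u)"
  for u :: "'a::comm_ring_1"
  by (simp add: det_def poly_sum poly_prod)

lemma poly_cayley_poly: "poly (cayley_poly A) u = det (cayley_matrix A u)"
  unfolding cayley_poly_def cayley_matrix_def poly_det
  by (rule arg_cong[where f = det]) (simp add: vec_eq_iff algebra_simps)

lemma mat_1_nth: "mat 1 $ i $ j = (if i = j then 1 else 0)"
  by (simp add: mat_def)

lemma sum_mat_1_left: "(\<Sum>l\<in>UNIV. mat 1 $ i $ l * f l) = (f i :: 'a::comm_ring_1)"
proof -
  have "(\<Sum>l\<in>UNIV. mat 1 $ i $ l * f l) = (\<Sum>l\<in>UNIV. if l = i then f l else 0)"
    by (intro sum.cong) (auto simp: mat_1_nth)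
  then show ?thesis by simp
qed

lemma sum_mat_1_right: "(\<Sum>l\<in>UNIV. f l * mat 1 $ l $ i) = (f i :: 'a::comm_ring_1)"
proof -
  have "(\<Sum>l\<in>UNIV. f l * mat 1 $ l $ i) = (\<Sum>l\<in>UNIV. if l = i then f l else 0)"
    by (intro sum.cong) (auto simp: mat_1_nth)
  then show ?thesis by simp
qed

lemma det_identity_row_update:
  fixes y :: "'a::field^'n"
  shows "det (\<chi> i j. mat 1 $ i $ j + (if i = k then y $ j else 0)) = 1 + y $ k"
proof -
  let ?x = "\<chi> j. mat 1 $ k $ j + y $ j"
  have "transpose (\<chi> i j. mat 1 $ i $ j + (if i = k then y $ j else 0))
      = (\<chi> i j. if j = k then (mat 1 *v ?x) $ i else mat 1 $ i $ j)"
  proof (unfold vec_eq_iff, intro allI)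
    fix i j :: 'n
    show "transpose (\<chi> i j. mat 1 $ i $ j + (if i = k then y $ j else 0)) $ i $ j
      = (\<chi> i j. if j = k then (mat 1 *v ?x) $ i else mat 1 $ i $ j) $ i $ j"
      by (cases "j = k"; cases "i = j"; cases "i = k") (auto simp: transpose_def mat_1_nth)
  qed
  from arg_cong[OF this, of det]
  have "det (\<chi> i j. mat 1 $ i $ j + (if i = k then y $ j else 0))
      = det (\<chi> i j. if j = k then (mat 1 *v ?x) $ i else mat 1 $ i $ j)"
    unfolding det_transpose .
  also have "\<dots> = ?x $ k * det (mat 1 :: 'a^'n^'n)"
    by (rule cramer_lemma)
  finally show ?thesis by (simp add: mat_1_nth)
qed

text \<open>
  The matrix determinant lemma. If \<open>a\<^sub>k \<noteq> 0\<close>, conjugation with the identity matrix whose column \<open>k\<close> is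
  replaced by \<open>a\<close> moves \<open>a\<close> to a standard basis vector; then only row \<open>k\<close> of the identity is changed.
\<close>

lemma det_identity_rank_one_update:
  fixes a w :: "'a::field^'n"
  shows "det (\<chi> i j. mat 1 $ i $ j + a $ i * w $ j) = 1 + (\<Sum>i\<in>UNIV. w $ i * a $ i)"
proof (cases "a = 0")
  case True
  then have "(\<chi> i j. mat 1 $ i $ j + a $ i * w $ j) = mat 1"
    by (simp add: vec_eq_iff)
  then show ?thesis using True by simp
next
  case False
  then obtain k where k: "a $ k \<noteq> 0" by (auto simp: vec_eq_iff)
  define Q :: "'a^'n^'n" where "Q = (\<chi> i j. if j = k then (mat 1 *v a) $ i else mat 1 $ i $ j)"
  define y where "y = w v* Q"
  have Qk: "Q $ i $ k = a $ i" for i by (simp add: Q_def)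
  have detQ: "det Q = a $ k"
    unfolding Q_def using cramer_lemma[where A = "mat 1" and x = a and k = k] by simp
  have "(\<chi> i j. mat 1 $ i $ j + a $ i * w $ j) ** Q
      = Q ** (\<chi> i j. mat 1 $ i $ j + (if i = k then y $ j else 0))"
  proof -
    have L: "((\<chi> i j. mat 1 $ i $ j + a $ i * w $ j) ** Q) $ i $ j = Q $ i $ j + a $ i * y $ j" for i j
    proof -
      have "y $ j = (\<Sum>l\<in>UNIV. w $ l * Q $ l $ j)"
        by (simp add: y_def vector_matrix_mult_def mult.commute)
      then show ?thesis
        unfolding matrix_matrix_mult_def vec_lambda_beta distrib_right sum.distrib sum_mat_1_left
        by (simp only: sum_distrib_left mult.assoc)
    qed
    have "(\<Sum>l\<in>UNIV. Q $ i $ l * (if l = k then y $ j else 0)) = a $ i * y $ j" for i j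
    proof -
      have "(\<Sum>l\<in>UNIV. Q $ i $ l * (if l = k then y $ j else 0)) = (\<Sum>l\<in>UNIV. if l
        = k then Q $ i $ l * y $ j else 0)"
        by (intro sum.cong) auto
      then show ?thesis by (simp add: Qk)
    qed
    then have R: "(Q ** (\<chi> i j. mat 1 $ i $ j + (if i = k then y $ j else 0))) $ i $ j = Q $ i $ j
      + a $ i * y $ j" for i j
      by (simp add: matrix_matrix_mult_def distrib_left sum.distrib sum_mat_1_right)
    show ?thesis unfolding vec_eq_iff using L R by simp
  qed
  from arg_cong[OF this, of det]
  have "det (\<chi> i j. mat 1 $ i $ j + a $ i * w $ j) * a $ k = a $ k * (1 + y $ k)"
    unfolding det_mul detQ det_identity_row_update .
  moreover have "y $ k = (\<Sum>i\<in>UNIV. w $ i * a $ i)"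
    by (simp add: y_def vector_matrix_mult_def Qk mult.commute)
  ultimately show ?thesis using k by simp
qed

text \<open>
  At \<open>u = -\<i>\<close> the coefficient of \<open>A\<close> vanishes and the matrix is twice the identity.
\<close>

lemma cayley_poly_nonzero: "cayley_poly A \<noteq> 0" for A :: "complex^'b^'b"
proof -
  have "cayley_matrix A (-\<i>) $ i $ j = 2 * mat 1 $ i $ j" for i j
    by (simp add: cayley_matrix_def)
  then have "det (cayley_matrix A (-\<i>)) = (\<Prod>i\<in>(UNIV::'b set). 2)"
    by (subst det_diagonal) (simp_all add: mat_1_nth)
  then have "poly (cayley_poly A) (-\<i>) \<noteq> 0" by (simp add: poly_cayley_poly)
  then show ?thesis by auto
qed

lemma poly_eqI_infinite:
  fixes p q :: "complex poly"
  assumes "infinite S" and "\<And>u. u \<in> S \<Longrightarrow> poly p u = poly q u"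
  shows "p = q"
proof (rule ccontr)
  assume "p \<noteq> q"
  then have "finite {x. poly (p - q) x = 0}" by (intro poly_roots_finite) simp
  moreover have "S \<subseteq> {x. poly (p - q) x = 0}" using assms(2) by auto
  ultimately show False using assms(1) finite_subset by blast
qed

lemma poly_eqI_outside_finite:
  fixes p q :: "complex poly"
  assumes "finite S" and "\<And>u. u \<notin> S \<Longrightarrow> poly p u = poly q u"
  shows "p = q"
proof (rule poly_eqI_infinite)
  show "infinite (- S)"
    using assms(1) infinite_UNIV_char_0 by (simp add: Compl_eq_Diff_UNIV)
qed (use assms(2) in simp)

text \<open>
  Polynomial identities in \<open>u\<close> may therefore be checked at points where the resolvent exists.
\<close>

lemma finite_singular_cayley: "finite {u. det (cayley_matrix A u) = 0}"
  using poly_roots_finite[OF cayley_poly_nonzero[of A]] by (simp add: poly_cayley_poly)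

lemma det_cayley_rank_one_update:
  assumes inv: "cayley_matrix A u ** R = mat 1"
  shows "det (cayley_matrix (rank_one_update v z ** A) u)
    = det (cayley_matrix A u) * (1 - (1 - \<i> * u) * (z - 1) * herm_form v (A ** R))"
proof -
  let ?M = "cayley_matrix A u" and ?c = "(1 - \<i> * u) * (z - 1)"
  have RM: "R ** ?M = mat 1"
    using inv by (simp add: matrix_left_right_inverse)
  define w where "w = (\<chi> j. \<Sum>l\<in>UNIV. cnj (v $ l) * (A ** R) $ l $ j)"
  define K where "K = (\<chi> i j. mat 1 $ i $ j + (- ?c * v $ i) * w $ j)"
  have "(rank_one_update v z ** A) $ i $ j = A $ i $ j
    + (z - 1) * v $ i * (\<Sum>l\<in>UNIV. cnj (v $ l) * A $ l $ j)" for i j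
    by (simp add: rank_one_update_def matrix_matrix_mult_def distrib_right sum.distrib sum_mat_1_left
      sum_distrib_left mult.assoc)
  then have 1: "cayley_matrix (rank_one_update v z ** A) u $ i $ j
     = ?M $ i $ j + (- ?c * v $ i) * (\<Sum>l\<in>UNIV. cnj (v $ l) * A $ l $ j)" for i j
    unfolding cayley_matrix_def vec_lambda_beta by (simp only:) (simp add: algebra_simps)
  have wM: "(\<Sum>m\<in>UNIV. w $ m * ?M $ m $ j) = (\<Sum>l\<in>UNIV. cnj (v $ l) * A $ l $ j)" for j
  proof -
    have "(\<Sum>m\<in>UNIV. w $ m * ?M $ m $ j) = (\<Sum>m\<in>UNIV. \<Sum>l\<in>UNIV. cnj (v $ l)
      * ((A ** R) $ l $ m * ?M $ m $ j))"
      by (simp add: w_def sum_distrib_right mult.assoc)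
    also have "\<dots> = (\<Sum>l\<in>UNIV. cnj (v $ l) * ((A ** R ** ?M) $ l $ j))"
      by (subst sum.swap) (simp add: sum_distrib_left matrix_matrix_mult_def[of "A ** R"])
    also have "A ** R ** ?M = A" by (simp add: matrix_mul_assoc[symmetric] RM)
    finally show ?thesis .
  qed
  have 2: "cayley_matrix (rank_one_update v z ** A) u = K ** ?M"
    unfolding vec_eq_iff
  proof (intro allI)
    fix i j
    have "(K ** ?M) $ i $ j = ?M $ i $ j + (- ?c * v $ i) * (\<Sum>m\<in>UNIV. w $ m * ?M $ m $ j)"
      unfolding K_def matrix_matrix_mult_def
      by (simp only: vec_lambda_beta distrib_right sum.distrib sum_mat_1_left sum_distrib_left mult.assoc)
    then show "cayley_matrix (rank_one_update v z ** A) u $ i $ j = (K ** ?M) $ i $ j"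
      using 1 wM by simp
  qed
  have "det K = 1 + (\<Sum>i\<in>UNIV. w $ i * (- ?c * v $ i))"
    unfolding K_def using det_identity_rank_one_update[of "\<chi> i. - ?c * v $ i" w] by simp
  also have "(\<Sum>i\<in>UNIV. w $ i * (- ?c * v $ i)) = - ?c * herm_form v (A ** R)"
  proof -
    have "herm_form v (A ** R) = (\<Sum>i\<in>UNIV. w $ i * v $ i)"
      unfolding herm_form_def w_def by (subst sum.swap) (simp add: sum_distrib_right)
    moreover have "w $ i * (- ?c * v $ i) = - ?c * (w $ i * v $ i)" for i by simp
    ultimately show ?thesis by (simp only: sum_distrib_left)
  qed
  finally show ?thesis using 2 by (simp add: det_mul)
qed

lemma invertible_cayley:
  assumes "det (cayley_matrix A u) \<noteq> 0"
  obtains R where "cayley_matrix A u ** R = mat 1"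
  using assms invertible_det_nz[of "cayley_matrix A u"] unfolding invertible_def by blast

lemma poly_slope_poly:
  assumes "cayley_matrix A u ** R = mat 1"
  shows "poly (slope_poly v A) u
    = - (1 - \<i> * u) * poly (cayley_poly A) u * herm_form v (A ** R)"
  using det_cayley_rank_one_update[OF assms, of v 0]
  by (simp add: slope_poly_def poly_cayley_poly algebra_simps)

lemma cayley_poly_rank_one_update:
  "cayley_poly (rank_one_update v z ** A) = cayley_poly A + smult (z - 1) (slope_poly v A)"
proof (rule poly_eqI_outside_finite[OF finite_singular_cayley])
  fix u assume "u \<notin> {u. det (cayley_matrix A u) = 0}"
  then obtain R where R: "cayley_matrix A u ** R = mat 1" using invertible_cayley by blast
  show "poly (cayley_poly (rank_one_update v z ** A)) u = poly (cayley_poly A + smult (z - 1) (slope_poly v A)) u"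
    unfolding poly_cayley_poly poly_add poly_smult det_cayley_rank_one_update[OF R] poly_slope_poly[OF R]
    by (simp add: algebra_simps)
qed

section \<open>Trace and frame sums of the slopes\<close>

text \<open>
  The product rule, applied row by row.
\<close>

lemma pderiv_det:
  fixes M :: "'a::idom poly^'n^'n"
  shows "pderiv (det M) = (\<Sum>k\<in>UNIV. det (\<chi> i. if i = k then (\<chi> j. pderiv (M $ k $ j)) else M $ i))"
proof -
  let ?P = "{p. p permutes (UNIV::'n set)}"
  have pd: "pderiv (of_int (sign p) * (\<Prod>i\<in>UNIV. M $ i $ p i))
     = (\<Sum>k\<in>UNIV. of_int (sign p) * (\<Prod>i\<in>UNIV. (\<chi> i. if i
       = k then (\<chi> j. pderiv (M $ k $ j)) else M $ i) $ i $ p i))" for p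
  proof -
    have "(\<Prod>i\<in>UNIV. (\<chi> i. if i = k then (\<chi> j. pderiv (M $ k $ j)) else M $ i) $ i $ p i)
       = (\<Prod>i\<in>UNIV - {k}. M $ i $ p i) * pderiv (M $ k $ p k)" for k
      by (subst prod.remove[of UNIV k]) (auto intro!: prod.cong simp: mult.commute)
    then have "pderiv (\<Prod>i\<in>UNIV. M $ i $ p i)
      = (\<Sum>k\<in>UNIV. \<Prod>i\<in>UNIV. (\<chi> i. if i = k then (\<chi> j. pderiv (M $ k $ j)) else M $ i) $ i $ p i)"
      by (simp add: pderiv_prod)
    moreover have "pderiv (of_int (sign p) * q) = of_int (sign p) * pderiv q" for q :: "'a poly"
      by (cases p rule: sign_cases) (simp_all add: pderiv_minus)
    ultimately show ?thesis by (simp add: sum_distrib_left)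
  qed
  have "pderiv (det M) = (\<Sum>p\<in>?P. pderiv (of_int (sign p) * (\<Prod>i\<in>UNIV. M $ i $ p i)))"
    unfolding det_def using higher_pderiv_sum[of 1] by simp
  also have "\<dots> = (\<Sum>p\<in>?P. \<Sum>k\<in>UNIV. of_int (sign p) * (\<Prod>i\<in>UNIV. (\<chi> i. if i
    = k then (\<chi> j. pderiv (M $ k $ j)) else M $ i) $ i $ p i))"
    by (intro sum.cong refl pd)
  finally show ?thesis unfolding det_def by (subst (asm) sum.swap)
qed

definition trace_poly :: "complex^'n^'n \<Rightarrow> complex poly" where
  "trace_poly A = (\<Sum>a\<in>UNIV. slope_poly (axis a 1) A)"

lemma det_row_linear2:
  fixes x y :: "complex^'n"
  shows "det (\<chi> i. if i = k then c *s x + d *s y else M $ i)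
    = c * det (\<chi> i. if i = k then x else M $ i) + d * det (\<chi> i. if i = k then y else M $ i)"
  using det_row_add[of k "\<lambda>i. c *s x" "\<lambda>i. d *s y" "\<lambda>i. M $ i"]
    det_row_mul[of k c "\<lambda>i. x" "\<lambda>i. M $ i"] det_row_mul[of k d "\<lambda>i. y" "\<lambda>i. M $ i"] by simp

lemma rank_one_update_axis:
  "(rank_one_update (axis a 1) z ** A) $ i $ j = (if i = a then z * A $ i $ j else A $ i $ j)"
proof -
  have "rank_one_update (axis a 1) z $ i $ l * A $ l $ j = (if l = i then (if i = a then z else 1) * A $ l $ j else 0)" for l
    by (auto simp: rank_one_update_def axis_def mat_def)
  then have "(\<Sum>l\<in>UNIV. rank_one_update (axis a 1) z $ i $ l * A $ l $ j) = (if i = a then z else 1) * A $ i $ j"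
    by simp
  then show ?thesis by (simp add: matrix_matrix_mult_def)
qed

text \<open>
  The slope at a standard basis vector only involves one row, and so does each term of \<open>C'\<close>. With
  \<open>p = 1 + \<i>u\<close>, \<open>q = 1 - \<i>u\<close> and with \<open>\<alpha>\<^sub>k\<close>, \<open>\<beta>\<^sub>k\<close> the determinants where row \<open>k\<close> is replaced by the row of the
  identity or of \<open>A\<close>, one has \<open>C = p\<alpha>\<^sub>k - q\<beta>\<^sub>k\<close> for each \<open>k\<close>, the slope is \<open>-q\<beta>\<^sub>k\<close>, and \<open>C' = \<i>\<Sum>(\<alpha>\<^sub>k + \<beta>\<^sub>k)\<close>.
  The equation follows from \<open>p + q = 2\<close>.
\<close>

lemma trace_poly_eq:
  fixes A :: "complex^'n^'n"
  shows "trace_poly A = smult (\<i> / 2) ([:1, 0, 1:] * pderiv (cayley_poly A))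
    + smult (of_nat CARD('n) / 2) ([:1, -\<i>:] * cayley_poly A)"
proof (rule poly_eqI_outside_finite[OF finite.emptyI])
  fix u :: complex
  define M where "M = cayley_matrix A u"
  define p where "p = 1 + \<i> * u"
  define q where "q = 1 - \<i> * u"
  define \<alpha> where "\<alpha> k = det (\<chi> i. if i = k then mat 1 $ k else M $ i)" for k
  define \<beta> where "\<beta> k = det (\<chi> i. if i = k then A $ k else M $ i)" for k
  have M: "det M = p * \<alpha> k - q * \<beta> k" for k
  proof -
    have "M = (\<chi> i. if i = k then p *s (mat 1 $ k) + (- q) *s (A $ k) else M $ i)"
      by (simp add: vec_eq_iff M_def cayley_matrix_def p_def q_def) (simp add: algebra_simps)
    then have "det M = det (\<chi> i. if i = k then p *s (mat 1 $ k) + (- q) *s (A $ k) else M $ i)"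
      by (rule arg_cong)
    then show ?thesis unfolding det_row_linear2 \<alpha>_def \<beta>_def by simp
  qed
  have slope: "poly (slope_poly (axis k 1) A) u = - q * \<beta> k" for k
  proof -
    have "cayley_matrix (rank_one_update (axis k 1) 0 ** A) u = (\<chi> i. if i = k then p *s (mat 1 $ k)
      + 0 *s 0 else M $ i)"
      by (auto simp: vec_eq_iff M_def cayley_matrix_def p_def rank_one_update_axis algebra_simps)
    then have "det (cayley_matrix (rank_one_update (axis k 1) 0 ** A) u) = p * \<alpha> k"
      by (simp only: det_row_linear2) (simp add: \<alpha>_def)
    then show ?thesis using M[of k] by (simp add: slope_poly_def poly_cayley_poly M_def)
  qed
  have deriv: "poly (pderiv (cayley_poly A)) u = \<i> * (\<Sum>k\<in>UNIV. \<alpha> k + \<beta> k)"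
  proof -
    have "(\<chi> i j. poly ((\<chi> i. if i = k then \<chi> j. pderiv ((\<chi> i j. [:mat 1 $ i $ j
      - A $ i $ j, \<i> * (mat 1 $ i $ j + A $ i $ j):]) $ k $ j)
        else (\<chi> i j. [:mat 1 $ i $ j - A $ i $ j, \<i> * (mat 1 $ i $ j + A $ i $ j):]) $ i) $ i $ j) u)
      = (\<chi> i. if i = k then \<i> *s (mat 1 $ k) + \<i> *s (A $ k) else M $ i)" for k
      by (auto simp: vec_eq_iff M_def cayley_matrix_def pderiv_pCons algebra_simps)
    then have "poly (pderiv (cayley_poly A)) u
      = (\<Sum>k\<in>UNIV. det (\<chi> i. if i = k then \<i> *s (mat 1 $ k) + \<i> *s (A $ k) else M $ i))"
      unfolding cayley_poly_def pderiv_det poly_sum poly_det by simp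
    then show ?thesis unfolding det_row_linear2 \<alpha>_def \<beta>_def
      by (simp add: sum_distrib_left distrib_left)
  qed
  have sumM: "of_nat CARD('n) * det M = p * (\<Sum>k\<in>UNIV. \<alpha> k) - q * (\<Sum>k\<in>UNIV. \<beta> k)"
  proof -
    have "of_nat CARD('n) * det M = (\<Sum>k\<in>(UNIV::'n set). det M)" by simp
    also have "\<dots> = (\<Sum>k\<in>UNIV. p * \<alpha> k - q * \<beta> k)" by (intro sum.cong refl M)
    finally show ?thesis by (simp add: sum_subtractf sum_distrib_left)
  qed
  have pq: "p * q = 1 + u\<^sup>2" "p + q = 2" by (simp_all add: p_def q_def algebra_simps power2_eq_square)
  let ?a = "\<Sum>k\<in>UNIV. \<alpha> k" and ?b = "\<Sum>k\<in>UNIV. \<beta> k"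
  have "poly (trace_poly A) u = - q * ?b"
    by (simp add: trace_poly_def poly_sum slope sum_distrib_left sum_negf)
  also have "\<dots> = \<i> / 2 * (p * q * (\<i> * (?a + ?b))) + 1 / 2 * (q * (p * ?a - q * ?b))"
  proof -
    have "\<i> / 2 * (p * q * (\<i> * (?a + ?b))) + 1 / 2 * (q * (p * ?a - q * ?b)) = - (q * ?b) * ((p + q) / 2)"
      by (simp add: field_simps)
    then show ?thesis unfolding pq by simp
  qed
  also have "\<dots> = poly (smult (\<i> / 2) ([:1, 0, 1:] * pderiv (cayley_poly A))
    + smult (of_nat CARD('n) / 2) ([:1, -\<i>:] * cayley_poly A)) u"
    unfolding pq(1) sumM[symmetric]
    by (simp add: deriv sum.distrib poly_cayley_poly M_def q_def power2_eq_square algebra_simps)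
  finally show "poly (trace_poly A) u = \<dots>" .
qed

lemma coeff_trace_poly_0:
  fixes A :: "complex^'n^'n"
  shows "coeff (trace_poly A) 0 = of_nat CARD('n) / 2 * coeff (cayley_poly A) 0 + \<i> / 2 * coeff (cayley_poly A) 1"
  by (simp add: trace_poly_eq coeff_pderiv)

lemma coeff_trace_poly_Suc:
  fixes A :: "complex^'n^'n"
  shows "coeff (trace_poly A) (Suc k) = of_nat CARD('n) / 2 * (coeff (cayley_poly A) (Suc k)
    - \<i> * coeff (cayley_poly A) k)
    + \<i> / 2 * (of_nat (k + 2) * coeff (cayley_poly A) (k + 2) + of_nat k * coeff (cayley_poly A) k)"
  by (cases k) (simp_all add: trace_poly_eq coeff_pderiv algebra_simps)

definition frame_index :: "('n::finite \<times> 'n \<times> nat) set" where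
  "frame_index = UNIV \<times> UNIV \<times> {..<4}"

text \<open>
  The vectors \<open>e\<^sub>a\<close> and \<open>(e\<^sub>a + \<i>\<^sup>m e\<^sub>b)/\<surd>2\<close> for \<open>a \<noteq> b\<close>. With the weights below they form a weighted projective
  2-design, up to normalisation; some weights are negative if \<open>N > 3\<close>. The index \<open>(a, a, m)\<close> gives \<open>e\<^sub>a\<close>
  four times, whence the factor \<open>1/4\<close> in its weight.
\<close>

definition frame_vec :: "'n \<times> 'n \<times> nat \<Rightarrow> complex^'n" where
  "frame_vec = (\<lambda>(a, b, m). if a = b then axis a 1 else
     (\<chi> i. if i = a then 1 / of_real (sqrt 2) else if i = b then \<i> ^ m / of_real (sqrt 2) else 0))"

definition frame_weight :: "'n::finite \<times> 'n \<times> nat \<Rightarrow> real" where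
  "frame_weight = (\<lambda>(a, b, m). if a = b then (3 - real CARD('n)) / 4 else 1 / 2)"

definition frame_sum :: "(complex^'n \<Rightarrow> complex) \<Rightarrow> complex" where
  "frame_sum f = (\<Sum>x\<in>frame_index. of_real (frame_weight x) * f (frame_vec x))"

lemma frame_vec_unit: "unit_vec (frame_vec x)"
proof (cases x)
  case (fields a b m)
  show ?thesis
  proof (cases "a = b")
    case True
    have "frame_vec x $ i * cnj (frame_vec x $ i) = (if i = a then 1 else 0)" for i
      using True by (simp add: fields frame_vec_def axis_def)
    then show ?thesis by simp
  next
    case False
    have h: "(1 / complex_of_real (sqrt 2)) * cnj (1 / complex_of_real (sqrt 2)) = 1/2"
      by (simp flip: of_real_mult)
    have h': "(\<i> ^ m / complex_of_real (sqrt 2)) * cnj (\<i> ^ m / complex_of_real (sqrt 2)) = 1/2"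
      by (simp flip: of_real_mult power_mult_distrib)
    have "(\<Sum>i\<in>UNIV. frame_vec x $ i * cnj (frame_vec x $ i))
      = (\<Sum>i\<in>{a,b}. frame_vec x $ i * cnj (frame_vec x $ i))"
      using False by (intro sum.mono_neutral_right) (auto simp: fields frame_vec_def)
    also have "\<dots> = 1/2 + 1/2" using False h h' by (simp add: fields frame_vec_def)
    finally show ?thesis by simp
  qed
qed

lemma herm_form_axis: "herm_form (axis a 1) B = B $ a $ a"
proof -
  have "(\<Sum>j\<in>UNIV. cnj (axis a 1 $ i) * B $ i $ j * axis a 1 $ j) = (if i = a then B $ a $ a else 0)" for i
  proof -
    have "cnj (axis a 1 $ i) * B $ i $ j * axis a 1 $ j = (if j = a then (if i = a then B $ a $ a else 0) else 0)" for j
      by (simp add: axis_def)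
    then show ?thesis by simp
  qed
  then show ?thesis by (simp add: herm_form_def)
qed

lemma herm_form_frame_vec:
  assumes "a \<noteq> b"
  shows "herm_form (frame_vec (a, b, m)) B
    = (B $ a $ a + B $ b $ b + \<i> ^ m * B $ a $ b + cnj (\<i> ^ m) * B $ b $ a) / 2"
proof -
  let ?v = "frame_vec (a, b, m)" and ?r = "complex_of_real (sqrt 2)"
  have va: "?v $ a = 1 / ?r" and vb: "?v $ b = \<i> ^ m / ?r" and v0: "i \<noteq> a \<Longrightarrow>
    i \<noteq> b \<Longrightarrow> ?v $ i = 0" for i
    using assms by (auto simp: frame_vec_def)
  have r: "?r * ?r = 2" "cnj ?r = ?r" by (simp_all flip: of_real_mult)
  have inner: "(\<Sum>j\<in>UNIV. cnj (?v $ i) * B $ i $ j * ?v $ j) = cnj (?v $ i) * B $ i $ a * ?v $ a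
    + cnj (?v $ i) * B $ i $ b * ?v $ b" for i
  proof -
    have "(\<Sum>j\<in>UNIV. cnj (?v $ i) * B $ i $ j * ?v $ j) = (\<Sum>j\<in>{a,b}. cnj (?v $ i) * B $ i $ j * ?v $ j)"
      by (intro sum.mono_neutral_right) (auto simp: v0)
    then show ?thesis using assms by simp
  qed
  have "herm_form ?v B = (\<Sum>i\<in>UNIV. cnj (?v $ i) * B $ i $ a * ?v $ a + cnj (?v $ i) * B $ i $ b * ?v $ b)"
    unfolding herm_form_def inner ..
  also have "\<dots> = (\<Sum>i\<in>{a,b}. cnj (?v $ i) * B $ i $ a * ?v $ a + cnj (?v $ i) * B $ i $ b * ?v $ b)"
    by (intro sum.mono_neutral_right) (auto simp: v0)
  also have "\<dots> = cnj (?v $ a) * ?v $ a * B $ a $ a + cnj (?v $ a) * ?v $ b * B $ a $ b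
      + (cnj (?v $ b) * ?v $ a * B $ b $ a + cnj (?v $ b) * ?v $ b * B $ b $ b)"
    using assms by simp
  also have "cnj (?v $ a) * ?v $ a = 1/2" unfolding va by (simp add: r)
  also have "cnj (?v $ a) * ?v $ b = \<i> ^ m / 2" unfolding va vb by (simp add: r)
  also have "cnj (?v $ b) * ?v $ a = cnj (\<i> ^ m) / 2" unfolding va vb by (simp add: r)
  also have "cnj (?v $ b) * ?v $ b = 1/2" unfolding vb by (simp add: r flip: power_mult_distrib)
  finally show ?thesis by (simp add: add_divide_distrib algebra_simps)
qed

text \<open>
  Terms \<open>g a a\<close> are added to complete the double sum and subtracted again.
\<close>

lemma frame_sum_split:
  fixes f :: "complex^'n \<Rightarrow> complex"
  assumes "\<And>a b. a \<noteq> b \<Longrightarrow> (\<Sum>m<4. f (frame_vec (a, b, m))) = 2 * g a b"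
    and "\<And>a. f (axis a 1) = h a"
  shows "frame_sum f = (\<Sum>a\<in>UNIV. \<Sum>b\<in>UNIV. g a b) + (\<Sum>a\<in>UNIV. (3 - of_nat CARD('n)) * h a - g a a)"
proof -
  have inner: "(\<Sum>m<4. of_real (frame_weight (a, b, m)) * f (frame_vec (a, b, m)))
     = g a b + (if b = a then (3 - of_nat CARD('n)) * h a - g a a else 0)" for a b :: 'n
  proof (cases "a = b")
    case True
    then have "(\<Sum>m<4. of_real (frame_weight (a, b, m)) * f (frame_vec (a, b, m)))
      = (\<Sum>m<(4::nat). (3 - of_nat CARD('n)) / 4 * h a)"
      by (intro sum.cong) (simp_all add: frame_weight_def frame_vec_def assms(2))
    then show ?thesis using True by simp
  next
    case False
    then have "(\<Sum>m<4. of_real (frame_weight (a, b, m)) * f (frame_vec (a, b, m)))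
      = (1 / 2) * (\<Sum>m<4. f (frame_vec (a, b, m)))"
      unfolding sum_distrib_left by (intro sum.cong) (simp_all add: frame_weight_def)
    then show ?thesis using False assms(1)[of a b] by simp
  qed
  have "frame_sum f = (\<Sum>a\<in>UNIV. \<Sum>b\<in>UNIV. \<Sum>m<4. of_real (frame_weight (a, b, m))
    * f (frame_vec (a, b, m)))"
    unfolding frame_sum_def frame_index_def by (simp add: sum.cartesian_product)
  then show ?thesis unfolding inner by (simp add: sum.distrib)
qed

lemma sum_lessThan_4: "(\<Sum>m<4. f m) = f 0 + f 1 + f 2 + f (3::nat)"
  by (simp add: eval_nat_numeral)

text \<open>
  Summation over the fourth roots of unity \<open>\<i>\<^sup>m\<close> kills \<open>P\<^sub>a\<^sub>b Q\<^sub>a\<^sub>b\<close> and keeps \<open>P\<^sub>a\<^sub>b Q\<^sub>b\<^sub>a\<close>. The weight of the \<open>e\<^sub>a\<close>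
  is the one for which the remaining diagonal terms \<open>P\<^sub>a\<^sub>a Q\<^sub>a\<^sub>a\<close> cancel.
\<close>

lemma frame_sum_herm_form_mult:
  fixes P Q :: "complex^'n^'n"
  shows "frame_sum (\<lambda>v. herm_form v P * herm_form v Q) = trace P * trace Q + trace (P ** Q)"
proof -
  define g where "g a b = ((P $ a $ a + P $ b $ b) * (Q $ a $ a + Q $ b $ b) + P $ a $ b * Q $ b $ a
    + P $ b $ a * Q $ a $ b) / 2" for a b
  have "(\<Sum>m<4. herm_form (frame_vec (a, b, m)) P * herm_form (frame_vec (a, b, m)) Q) = 2 * g a b"
    if "a \<noteq> b" for a b
    unfolding sum_lessThan_4 herm_form_frame_vec[OF that] g_def
    by (simp add: field_simps power3_eq_cube)
  then have "frame_sum (\<lambda>v. herm_form v P * herm_form v Q)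
     = (\<Sum>a\<in>UNIV. \<Sum>b\<in>UNIV. g a b) + (\<Sum>a\<in>UNIV. (3
       - of_nat CARD('n)) * (P $ a $ a * Q $ a $ a) - g a a)"
    by (rule frame_sum_split) (simp_all add: herm_form_axis)
  also have "(\<Sum>a\<in>UNIV. (3 - of_nat CARD('n)) * (P $ a $ a * Q $ a $ a) - g a a)
    = - of_nat CARD('n) * (\<Sum>a\<in>UNIV. P $ a $ a * Q $ a $ a)"
    unfolding sum_distrib_left by (intro sum.cong) (simp_all add: g_def algebra_simps)
  also have "(\<Sum>a\<in>UNIV. \<Sum>b\<in>UNIV. g a b)
     = (\<Sum>a\<in>UNIV. \<Sum>b\<in>(UNIV::'n set). P $ a $ a * Q $ a $ a) / 2
       + (\<Sum>a\<in>(UNIV::'n set). \<Sum>b\<in>UNIV. P $ b $ b * Q $ b $ b) / 2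
       + (\<Sum>a\<in>UNIV. \<Sum>b\<in>UNIV. P $ a $ a * Q $ b $ b) / 2
       + (\<Sum>a\<in>UNIV. \<Sum>b\<in>UNIV. P $ b $ b * Q $ a $ a) / 2
       + (\<Sum>a\<in>UNIV. \<Sum>b\<in>UNIV. P $ a $ b * Q $ b $ a) / 2
       + (\<Sum>a\<in>UNIV. \<Sum>b\<in>UNIV. P $ b $ a * Q $ a $ b) / 2"
    unfolding g_def sum_divide_distrib sum.distrib[symmetric]
    by (intro sum.cong refl) (simp add: field_simps)
  also have "(\<Sum>a\<in>UNIV. \<Sum>b\<in>UNIV. P $ b $ a * Q $ a $ b) = trace (P ** Q)"
    by (subst sum.swap) (simp add: trace_def matrix_matrix_mult_def)
  also have "(\<Sum>a\<in>UNIV. \<Sum>b\<in>UNIV. P $ b $ b * Q $ a $ a) = trace P * trace Q"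
    by (subst sum.swap) (simp add: trace_def sum_product)
  also have "(\<Sum>a\<in>UNIV. \<Sum>b\<in>UNIV. P $ a $ a * Q $ b $ b) = trace P * trace Q"
    by (simp add: trace_def sum_product)
  also have "(\<Sum>a\<in>UNIV. \<Sum>b\<in>UNIV. P $ a $ b * Q $ b $ a) = trace (P ** Q)"
    by (simp add: trace_def matrix_matrix_mult_def)
  also have "(\<Sum>a\<in>UNIV. \<Sum>b\<in>(UNIV::'n set). P $ a $ a * Q $ a $ a)
    = of_nat CARD('n) * (\<Sum>a\<in>UNIV. P $ a $ a * Q $ a $ a)"
    by (simp add: sum_distrib_left)
  also have "(\<Sum>a\<in>(UNIV::'n set). \<Sum>b\<in>UNIV. P $ b $ b * Q $ b $ b)
    = of_nat CARD('n) * (\<Sum>a\<in>UNIV. P $ a $ a * Q $ a $ a)"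
    by simp
  finally show ?thesis by simp
qed

text \<open>
  The product formula with \<open>Q = 1\<close>, as \<open>v\<^sup>*v = 1\<close> on the frame.
\<close>

lemma frame_sum_herm_form:
  fixes P :: "complex^'n^'n"
  shows "frame_sum (\<lambda>v. herm_form v P) = (of_nat CARD('n) + 1) * trace P"
proof -
  have one: "herm_form v (mat 1) = (\<Sum>i\<in>UNIV. v $ i * cnj (v $ i))" for v :: "complex^'n"
  proof -
    have "(\<Sum>j\<in>UNIV. cnj (v $ i) * mat 1 $ i $ j * v $ j) = v $ i * cnj (v $ i)" for i
      using sum_mat_1_left[of i "\<lambda>j. cnj (v $ i) * v $ j"] by (simp add: mult_ac)
    then show ?thesis by (simp add: herm_form_def)
  qed
  have "frame_sum (\<lambda>v. herm_form v P) = frame_sum (\<lambda>v. herm_form v P * herm_form v (mat 1))"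
    unfolding frame_sum_def one frame_vec_unit by simp
  then show ?thesis by (simp add: frame_sum_herm_form_mult trace_I algebra_simps)
qed

lemma mat_mult_left: "(mat c ** X) $ i $ j = c * X $ i $ j" for X :: "'a::comm_ring_1^'n^'m"
proof -
  have "mat c $ i $ l * X $ l $ j = mat 1 $ i $ l * (c * X $ l $ j)" for l
    by (simp add: mat_def)
  then show ?thesis by (simp add: matrix_matrix_mult_def sum_mat_1_left)
qed

lemma mat_mult_right: "(X ** mat c) $ i $ j = c * X $ i $ j" for X :: "'a::comm_ring_1^'n^'m"
proof -
  have "X $ i $ l * mat c $ l $ j = (c * X $ i $ l) * mat 1 $ l $ j" for l
    by (simp add: mat_def)
  then show ?thesis by (simp add: matrix_matrix_mult_def sum_mat_1_right)
qed

lemma mat_commutes: "mat c ** X = X ** mat c" for X :: "'a::comm_ring_1^'n^'n"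
  by (simp add: vec_eq_iff mat_mult_left mat_mult_right)

lemma trace_mat_mult: "trace (mat c ** X) = c * trace X" for X :: "'a::comm_ring_1^'n^'n"
  by (simp add: trace_def mat_mult_left sum_distrib_left)

lemma mat_pull: "X ** (mat c ** Y) = mat c ** (X ** Y)" for X Y :: "'a::comm_ring_1^'n^'n"
  by (simp only: matrix_mul_assoc mat_commutes[of c X, symmetric])

text \<open>
  The traced form of \<open>AR\<^sub>0 (M\<^sub>u - (1 + \<i>u)M\<^sub>0) R\<^sub>u = AR\<^sub>0 - (1 + \<i>u)AR\<^sub>u\<close>, where \<open>M\<^sub>u - (1 + \<i>u)M\<^sub>0 = 2\<i>uA\<close>.
\<close>

lemma resolvent_identity:
  fixes A :: "complex^'n^'n"
  assumes R0: "cayley_matrix A 0 ** R0 = mat 1" and R: "cayley_matrix A u ** R = mat 1"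
  shows "2 * \<i> * u * trace ((A ** R0) ** (A ** R)) = trace (A ** R0) - (1 + \<i> * u) * trace (A ** R)"
proof -
  let ?M0 = "cayley_matrix A 0"
  have distr: "(X + Y) ** Z = X ** Z + Y ** Z" for X Y Z :: "complex^'n^'n"
    by (simp add: vec_eq_iff matrix_matrix_mult_def distrib_right sum.distrib)
  have "cayley_matrix A u = mat (1 + \<i> * u) ** ?M0 + mat (2 * \<i> * u) ** A"
    by (simp add: vec_eq_iff mat_mult_left) (simp add: cayley_matrix_def algebra_simps)
  then have "(A ** R0) ** mat 1 = (A ** R0) ** ((mat (1 + \<i> * u) ** ?M0 + mat (2 * \<i> * u) ** A) ** R)"
    using R by simp
  also have "\<dots> = (A ** R0) ** (mat (1 + \<i> * u) ** (?M0 ** R)) + (A ** R0) ** (mat (2 * \<i> * u) ** (A ** R))"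
    by (simp only: distr matrix_add_ldistrib matrix_mul_assoc)
  also have "(A ** R0) ** (mat (1 + \<i> * u) ** (?M0 ** R)) = mat (1 + \<i> * u) ** (A ** (R0 ** ?M0) ** R)"
    by (simp only: mat_pull) (simp only: matrix_mul_assoc)
  also have "R0 ** ?M0 = mat 1" using R0 by (simp add: matrix_left_right_inverse)
  also have "(A ** R0) ** (mat (2 * \<i> * u) ** (A ** R)) = mat (2 * \<i> * u) ** ((A ** R0) ** (A ** R))"
    by (rule mat_pull)
  finally have "trace (A ** R0) = trace (mat (1 + \<i> * u) ** (A ** R) + mat (2 * \<i> * u) ** ((A ** R0) ** (A ** R)))"
    by simp
  then show ?thesis by (simp only: trace_add trace_mat_mult) simp
qed

lemma herm_form_scale: "c * herm_form v X = herm_form v (mat c ** X)"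
  by (simp add: herm_form_def mat_mult_left sum_distrib_left mult_ac)

definition frame_coeff :: "nat \<Rightarrow> complex^'n^'n \<Rightarrow> complex" where
  "frame_coeff k A = frame_sum (\<lambda>v. coeff (slope_poly v A) 0 * coeff (slope_poly v A) k)"

lemma frame_sum_slope: "frame_sum (\<lambda>v. coeff (slope_poly v A) k) = (of_nat CARD('n) + 1) * coeff (trace_poly A) k"
  for A :: "complex^'n^'n"
proof -
  have "(\<Sum>x\<in>frame_index. smult (of_real (frame_weight x)) (slope_poly (frame_vec x) A))
    = smult (of_nat CARD('n) + 1) (trace_poly A)" (is "?L = ?R")
  proof (rule poly_eqI_outside_finite[OF finite_singular_cayley])
    fix u assume "u \<notin> {u. det (cayley_matrix A u) = 0}"
    then obtain R where R: "cayley_matrix A u ** R = mat 1" using invertible_cayley by blast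
    define B where "B = mat (- (1 - \<i> * u) * poly (cayley_poly A) u) ** (A ** R)"
    have sl: "poly (slope_poly v A) u = herm_form v B" for v
      by (simp only: B_def poly_slope_poly[OF R] herm_form_scale)
    have "poly ?L u = frame_sum (\<lambda>v. herm_form v B)"
      by (simp add: poly_sum sl frame_sum_def)
    also have "\<dots> = (of_nat CARD('n) + 1) * trace B" by (rule frame_sum_herm_form)
    also have "trace B = poly (trace_poly A) u"
      by (simp add: trace_poly_def poly_sum sl herm_form_axis trace_def)
    finally show "poly ?L u = poly ?R u" by simp
  qed
  then have "coeff ?L k = coeff ?R k" by simp
  then show ?thesis by (simp add: coeff_sum frame_sum_def)
qed

text \<open>
  Both slopes are Hermitian forms, of \<open>-D AR\<^sub>0\<close> and of \<open>-(1 - \<i>u) C(u) AR\<^sub>u\<close>. The frame sum of their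
  product contains the trace of the product of these matrices, which the resolvent identity reduces to
  single traces. The statement compares the coefficients of \<open>u\<^bsup>k+1\<^esup>\<close>.
\<close>

lemma frame_coeff_recurrence:
  fixes A :: "complex^'n^'n"
  assumes nz: "coeff (cayley_poly A) 0 \<noteq> 0"
  defines "c \<equiv> coeff (cayley_poly A)" and "t \<equiv> coeff (trace_poly A)"
  shows "- 2 * \<i> * (frame_coeff k A - t 0 * t k)
    = t 0 * (c (Suc k) - \<i> * c k) - c 0 * (t (Suc k) + \<i> * t k)"
proof -
  define S where "S = (\<Sum>x\<in>frame_index. smult (of_real (frame_weight x)
    * coeff (slope_poly (frame_vec x) A) 0) (slope_poly (frame_vec x) A))"
  have Sk: "coeff S k = frame_coeff k A" for k
    by (simp add: S_def coeff_sum frame_coeff_def frame_sum_def mult.assoc)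
  have c0: "poly (cayley_poly A) 0 = c 0" and s0: "coeff (slope_poly v A) 0 = poly (slope_poly v A) 0"
    and t0: "poly (trace_poly A) 0 = t 0" for v
    by (simp_all add: c_def t_def poly_0_coeff_0)
  obtain R0 where R0: "cayley_matrix A 0 ** R0 = mat 1"
    using invertible_cayley[of A 0] nz c0 by (auto simp: poly_cayley_poly c_def)
  have "[:0, - 2 * \<i>:] * (S - smult (t 0) (trace_poly A))
     = [:1, -\<i>:] * smult (t 0) (cayley_poly A) - [:1, \<i>:] * smult (c 0) (trace_poly A)" (is "?L = ?R")
  proof (rule poly_eqI_outside_finite[OF finite_singular_cayley])
    fix u assume "u \<notin> {u. det (cayley_matrix A u) = 0}"
    then obtain R where R: "cayley_matrix A u ** R = mat 1" using invertible_cayley by blast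
    define B where "B = mat (- (1 - \<i> * u) * poly (cayley_poly A) u) ** (A ** R)"
    define B0 where "B0 = mat (- c 0) ** (A ** R0)"
    have sl: "poly (slope_poly v A) u = herm_form v B" for v
      by (simp only: B_def poly_slope_poly[OF R] herm_form_scale)
    have sl0: "poly (slope_poly v A) 0 = herm_form v B0" for v
      unfolding poly_slope_poly[OF R0] c0 B0_def herm_form_scale[symmetric] by simp
    have "poly S u = frame_sum (\<lambda>v. herm_form v B0 * herm_form v B)"
      by (simp add: S_def poly_sum s0 sl sl0 frame_sum_def mult.assoc)
    then have S: "poly S u = trace B0 * trace B + trace (B0 ** B)"
      by (simp add: frame_sum_herm_form_mult)
    have tB: "poly (trace_poly A) u = trace B"
      by (simp add: trace_poly_def poly_sum sl herm_form_axis trace_def)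
    have tB0: "t 0 = trace B0"
      unfolding t0[symmetric] by (simp add: trace_poly_def poly_sum sl0 herm_form_axis trace_def)
    have "B0 ** B = mat (- c 0) ** (mat (- (1 - \<i> * u) * poly (cayley_poly A) u) ** ((A ** R0) ** (A ** R)))"
      unfolding B0_def B_def by (subst matrix_mul_assoc[symmetric], subst mat_pull[of "A ** R0"], rule refl)
    then have trBB: "trace (B0 ** B) = (1 - \<i> * u) * poly (cayley_poly A) u * c 0 * trace ((A ** R0) ** (A ** R))"
      by (simp add: trace_mat_mult algebra_simps)
    have trB: "trace B = - (1 - \<i> * u) * poly (cayley_poly A) u * trace (A ** R)" "trace B0 = - c 0 * trace (A ** R0)"
      by (simp_all only: B_def B0_def trace_mat_mult)
    have "poly ?L u = - (2 * \<i> * u * trace (B0 ** B))"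
      by (simp add: S tB tB0 algebra_simps)
    also have "\<dots> = - ((1 - \<i> * u) * poly (cayley_poly A) u * c 0 * (2 * \<i> * u * trace ((A ** R0) ** (A ** R))))"
      by (simp add: trBB)
    also have "\<dots> = (1 - \<i> * u) * trace B0 * poly (cayley_poly A) u - (1 + \<i> * u) * c 0 * trace B"
      unfolding resolvent_identity[OF R0 R] trB by (simp add: algebra_simps)
    also have "\<dots> = poly ?R u"
      by (simp add: tB tB0 algebra_simps)
    finally show "poly ?L u = poly ?R u" .
  qed
  then have "coeff ?L (Suc k) = coeff ?R (Suc k)" by simp
  then show ?thesis by (simp add: Sk c_def t_def algebra_simps)
qed

section \<open>Unitary matrices and the derivative along a flow\<close>

lemma adjoint_matrix_nth: "adjoint_matrix A $ i $ j = cnj (A $ j $ i)"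
  by (simp add: adjoint_matrix_def transpose_def)

lemma adjoint_matrix_mult: "adjoint_matrix (A ** B) = adjoint_matrix B ** adjoint_matrix A"
  by (simp add: vec_eq_iff adjoint_matrix_nth matrix_matrix_mult_def mult.commute)

lemma unitary_mult:
  assumes "A \<in> unitary_group" "B \<in> unitary_group" shows "A ** B \<in> unitary_group"
proof -
  have "(A ** B) ** adjoint_matrix (A ** B) = A ** (B ** adjoint_matrix B) ** adjoint_matrix A"
    and "adjoint_matrix (A ** B) ** (A ** B) = adjoint_matrix B ** (adjoint_matrix A ** A) ** B"
    by (simp_all only: adjoint_matrix_mult matrix_mul_assoc)
  then show ?thesis using assms by (simp add: unitary_group_def)
qed

lemma rank_one_update_one: "rank_one_update v 1 = mat 1"
  by (simp add: vec_eq_iff rank_one_update_def)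

lemma rank_one_update_mult:
  assumes "unit_vec v"
  shows "rank_one_update v z ** rank_one_update v w = rank_one_update v (z * w)"
proof -
  have "(rank_one_update v z ** rank_one_update v w) $ i $ j = rank_one_update v (z * w) $ i $ j" for i j
  proof -
    have "(\<Sum>l\<in>UNIV. ((z - 1) * v $ i * cnj (v $ l)) * ((w - 1) * v $ l * cnj (v $ j)))
      = (z - 1) * (w - 1) * v $ i * cnj (v $ j) * (\<Sum>l\<in>UNIV. v $ l * cnj (v $ l))"
      unfolding sum_distrib_left by (intro sum.cong) (simp_all add: mult_ac)
    then have s: "(\<Sum>l\<in>UNIV. ((z - 1) * v $ i * cnj (v $ l)) * ((w - 1) * v $ l * cnj (v $ j)))
      = (z - 1) * (w - 1) * v $ i * cnj (v $ j)" using assms by simp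
    have "(rank_one_update v z ** rank_one_update v w) $ i $ j
      = rank_one_update v w $ i $ j + (\<Sum>l\<in>UNIV. ((z - 1) * v $ i * cnj (v $ l)) * (mat 1 $ l $ j))
         + (\<Sum>l\<in>UNIV. ((z - 1) * v $ i * cnj (v $ l)) * ((w - 1) * v $ l * cnj (v $ j)))"
      unfolding rank_one_update_def matrix_matrix_mult_def vec_lambda_beta distrib_right sum.distrib sum_mat_1_left
      unfolding distrib_left sum.distrib by simp
    also have "\<dots> = rank_one_update v (z * w) $ i $ j"
      unfolding s sum_mat_1_right by (simp add: rank_one_update_def algebra_simps)
    finally show ?thesis .
  qed
  then show ?thesis by (simp add: vec_eq_iff)
qed

lemma rank_one_update_unitary:
  assumes "unit_vec v" and "cmod z = 1"
  shows "rank_one_update v z \<in> unitary_group"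
proof -
  have "adjoint_matrix (rank_one_update v z) = rank_one_update v (cnj z)"
    by (auto simp: vec_eq_iff adjoint_matrix_nth rank_one_update_def mat_def)
  moreover have "z * cnj z = 1" using assms(2) by (simp flip: complex_norm_square)
  ultimately show ?thesis
    by (simp add: unitary_group_def rank_one_update_mult[OF assms(1)] rank_one_update_one mult.commute)
qed

lemma det_rank_one_update:
  assumes "unit_vec v"
  shows "det (rank_one_update v z) = z"
proof -
  have "det (\<chi> i j. mat 1 $ i $ j + (\<chi> i. (z - 1) * v $ i) $ i * (\<chi> j. cnj (v $ j)) $ j)
    = 1 + (\<Sum>i\<in>UNIV. (\<chi> j. cnj (v $ j)) $ i * (\<chi> i. (z - 1) * v $ i) $ i)"
    by (rule det_identity_rank_one_update)
  also have "(\<Sum>i\<in>UNIV. (\<chi> j. cnj (v $ j)) $ i * (\<chi> i. (z - 1) * v $ i) $ i)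
    = (z - 1) * (\<Sum>i\<in>UNIV. v $ i * cnj (v $ i))"
    unfolding sum_distrib_left by (intro sum.cong) (simp_all add: mult_ac)
  finally show ?thesis using assms by (simp add: rank_one_update_def)
qed

lemma slope_poly_rank_one_update:
  assumes "unit_vec v"
  shows "slope_poly v (rank_one_update v z ** A) = smult z (slope_poly v A)"
proof -
  have "rank_one_update v 0 ** (rank_one_update v z ** A) = rank_one_update v 0 ** A"
    by (simp add: matrix_mul_assoc rank_one_update_mult[OF assms])
  then show ?thesis
    by (simp add: slope_poly_def[of v "rank_one_update v z ** A"] cayley_poly_rank_one_update)
       (simp add: slope_poly_def algebra_simps smult_diff_left)
qed

lemma det_cnj: "det (\<chi> i j. cnj (A $ i $ j)) = cnj (det A)"
  by (simp add: det_def)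

lemma det_unitary_nonzero: "A \<in> unitary_group \<Longrightarrow> det A \<noteq> 0"
  by (metis (mono_tags, lifting) det_I det_mul mem_Collect_eq mult_zero_left unitary_group_def zero_neq_one)

text \<open>
  On the unitary group complex conjugation of the coefficients \<open>c\<^sub>k\<close> is multiplication by this number.
\<close>

definition conj_phase :: "complex^'n^'n \<Rightarrow> complex" where
  "conj_phase A = (-1) ^ CARD('n) / det A"

text \<open>
  For real \<open>u\<close> conjugation exchanges \<open>1 + \<i>u\<close> and \<open>1 - \<i>u\<close>, and multiplication by \<open>A\<close> turns
  \<open>(1 - \<i>u) - (1 + \<i>u)A\<^sup>*\<close> into \<open>-((1 + \<i>u) - (1 - \<i>u)A)\<close>.
\<close>

lemma cnj_coeff_cayley_poly:
  fixes A :: "complex^'n^'n"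
  assumes A: "A \<in> unitary_group"
  shows "cnj (coeff (cayley_poly A) k) = conj_phase A * coeff (cayley_poly A) k"
proof -
  have "map_poly cnj (cayley_poly A) = smult (conj_phase A) (cayley_poly A)"
  proof (rule poly_eqI_infinite)
    show "infinite (range complex_of_real)"
      using finite_imageD[of complex_of_real UNIV] infinite_UNIV_char_0[where 'a = real] by (auto simp: inj_on_def)
    fix u assume "u \<in> range complex_of_real"
    then have u: "cnj u = u" by auto
    let ?p = "1 + \<i> * u" and ?q = "1 - \<i> * u"
    let ?K = "\<chi> i j. ?q * mat 1 $ i $ j - ?p * adjoint_matrix A $ i $ j"
    have "transpose ?K = (\<chi> i j. cnj (cayley_matrix A u $ i $ j))"
      by (auto simp: vec_eq_iff transpose_def adjoint_matrix_nth cayley_matrix_def u mat_def)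
    from arg_cong[OF this, of det] have K: "det ?K = cnj (det (cayley_matrix A u))"
      unfolding det_transpose det_cnj .
    have "A ** ?K = mat (-1) ** cayley_matrix A u"
    proof -
      have "(A ** ?K) $ i $ j = - cayley_matrix A u $ i $ j" for i j
      proof -
        have "(A ** ?K) $ i $ j = (\<Sum>l\<in>UNIV. (?q * A $ i $ l) * mat 1 $ l $ j)
          - ?p * (A ** adjoint_matrix A) $ i $ j"
          unfolding matrix_matrix_mult_def vec_lambda_beta sum_distrib_left sum_subtractf[symmetric]
          by (intro sum.cong) (simp_all add: algebra_simps)
        then show ?thesis using A by (simp add: unitary_group_def sum_mat_1_right cayley_matrix_def)
      qed
      then show ?thesis by (simp add: vec_eq_iff mat_mult_left)
    qed
    from arg_cong[OF this, of det]
    have "det A * det ?K = det (mat (-1) :: complex^'n^'n) * det (cayley_matrix A u)"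
      unfolding det_mul .
    moreover have "det (mat (-1) :: complex^'n^'n) = (-1) ^ CARD('n)"
      by (subst det_diagonal) (simp_all add: mat_def)
    ultimately have "det A * det ?K = (-1) ^ CARD('n) * det (cayley_matrix A u)"
      by simp
    then have "cnj (poly (cayley_poly A) u) = conj_phase A * poly (cayley_poly A) u"
      using det_unitary_nonzero[OF A] unfolding K poly_cayley_poly conj_phase_def
      by (simp add: field_simps)
    moreover have "poly (map_poly cnj (cayley_poly A)) u = cnj (poly (cayley_poly A) u)"
      using poly_cnj[of "cayley_poly A" u, unfolded u] by (rule sym)
    ultimately show "poly (map_poly cnj (cayley_poly A)) u = poly (smult (conj_phase A) (cayley_poly A)) u"
      by (simp only: poly_smult)
  qed
  then have "coeff (map_poly cnj (cayley_poly A)) k = coeff (smult (conj_phase A) (cayley_poly A)) k" by simp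
  then show ?thesis by (simp add: coeff_map_poly)
qed

text \<open>
  The rule for the coefficients \<open>c\<^sub>k\<close>, applied to \<open>A\<close> and to the reflected matrix \<open>R\<^sub>v(-1)A\<close>, whose
  coefficients are \<open>c\<^sub>k - 2b\<^sub>k\<close> and whose determinant has the opposite sign.
\<close>

lemma cnj_coeff_slope_poly:
  fixes A :: "complex^'n^'n"
  assumes A: "A \<in> unitary_group" and v: "unit_vec v"
  shows "cnj (coeff (slope_poly v A) k) = conj_phase A * (coeff (cayley_poly A) k - coeff (slope_poly v A) k)"
proof -
  let ?B = "rank_one_update v (-1) ** A" and ?c = "coeff (cayley_poly A) k" and ?b = "coeff (slope_poly v A) k"
  have B: "?B \<in> unitary_group"
    using A rank_one_update_unitary[OF v, of "-1"] by (intro unitary_mult) auto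
  have "conj_phase ?B = - conj_phase A"
    by (simp add: conj_phase_def det_mul det_rank_one_update[OF v])
  moreover have "coeff (cayley_poly ?B) k = ?c - 2 * ?b"
    by (simp add: cayley_poly_rank_one_update)
  ultimately have "cnj (?c - 2 * ?b) = - conj_phase A * (?c - 2 * ?b)"
    using cnj_coeff_cayley_poly[OF B, of k] by simp
  then have "conj_phase A * ?c - 2 * cnj ?b = - conj_phase A * ?c + 2 * conj_phase A * ?b"
    using cnj_coeff_cayley_poly[OF A, of k] by (simp add: algebra_simps)
  then have "2 * cnj ?b = 2 * (conj_phase A * (?c - ?b))"
    by (simp add: algebra_simps)
  then show ?thesis by simp
qed

text \<open>
  On the unitary group this is \<open>|D|\<^sup>2 e\<^sub>j e\<^sub>k\<close>, and \<open>M\<^sub>j\<^sub>k\<close> is the average of \<open>|D|\<^bsup>2s-2\<^esup>\<close> times it. The form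
  chosen here is a polynomial in the entries of \<open>A\<close> and their conjugates, hence continuous, also where
  \<open>1 - A\<close> is singular.
\<close>

definition moment_density :: "nat \<Rightarrow> nat \<Rightarrow> complex^'n^'n \<Rightarrow> real" where
  "moment_density j k A = Re (cnj (coeff (cayley_poly A) j) * coeff (cayley_poly A) k)"

abbreviation cayley_modulus :: "complex^'n^'n \<Rightarrow> real" where
  "cayley_modulus A \<equiv> moment_density 0 0 A"

lemma cayley_modulus_nonneg: "0 \<le> cayley_modulus A"
  by (simp add: moment_density_def)

text \<open>
  Up to a factor \<open>\<i>\<close>, the derivative of \<open>w(|D|\<^sup>2) cnj(c\<^sub>j) y\<close> along \<open>R\<^sub>v(e\<^bsup>\<i>t\<^esup>)A\<close> at \<open>t = 0\<close>, where \<open>w'\<close> is the derivative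
  of \<open>w\<close> and \<open>\<i>y'\<close> that of \<open>y\<close>: the coefficient \<open>c\<^sub>k\<close> has derivative \<open>\<i>b\<^sub>k\<close>.
\<close>

definition flow_derivative ::
    "real \<Rightarrow> real \<Rightarrow> nat \<Rightarrow> complex \<Rightarrow> complex \<Rightarrow>
      complex^'n \<Rightarrow> complex^'n^'n \<Rightarrow> complex" where
  "flow_derivative w w' j y y' v A =
    (let c = coeff (cayley_poly A); b = coeff (slope_poly v A)
     in of_real w' * (b 0 * cnj (c 0) - c 0 * cnj (b 0)) * cnj (c j) * y
        + of_real w * (cnj (c j) * y' - cnj (b j) * y))"

lemma flow_derivative_conj_phase:
  assumes A: "A \<in> unitary_group" and v: "unit_vec v"
  defines "c \<equiv> coeff (cayley_poly A)" and "b \<equiv> coeff (slope_poly v A)" and "\<tau> \<equiv> conj_phase A"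
  shows "flow_derivative w w' j y y' v A = of_real w' * (\<tau>\<^sup>2 * c 0 * c j) * ((2 * b 0 - c 0) * y)
    + of_real w * \<tau> * (c j * y' + b j * y - c j * y)"
  unfolding flow_derivative_def Let_def cnj_coeff_cayley_poly[OF A] cnj_coeff_slope_poly[OF A v]
  unfolding c_def[symmetric] b_def[symmetric] \<tau>_def[symmetric]
  by (simp add: algebra_simps power2_eq_square)

text \<open>
  If \<open>j\<close> or \<open>k\<close> is zero, the products \<open>b\<^sub>0 b\<^sub>k\<close> and \<open>b\<^sub>j b\<^sub>k\<close> are both of the kind collected in \<open>frame_coeff\<close>.
\<close>

lemma frame_sum_gradient:
  fixes A :: "complex^'n^'n"
  assumes A: "A \<in> unitary_group" and jk: "j = 0 \<or> k = 0"
  defines "c \<equiv> coeff (cayley_poly A)" and "t \<equiv> coeff (trace_poly A)" and "\<tau> \<equiv> conj_phase A"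
  shows "frame_sum (\<lambda>v. flow_derivative w w' j (coeff (slope_poly v A) k) (coeff (slope_poly v A) k) v A)
     = of_real w' * (\<tau>\<^sup>2 * c 0 * c j) * (2 * frame_coeff k A - c 0 * ((of_nat CARD('n) + 1) * t k))
       + of_real w * \<tau> * frame_coeff (j + k) A"
proof -
  let ?b = "\<lambda>v. coeff (slope_poly v A)"
  have "frame_sum (\<lambda>v. flow_derivative w w' j (?b v k) (?b v k) v A)
    = (\<Sum>x\<in>frame_index. of_real w' * (\<tau>\<^sup>2 * c 0 * c j) * (2 * (of_real (frame_weight x)
      * (?b (frame_vec x) 0 * ?b (frame_vec x) k))
           - c 0 * (of_real (frame_weight x) * ?b (frame_vec x) k))
       + of_real w * \<tau> * (of_real (frame_weight x) * (?b (frame_vec x) 0 * ?b (frame_vec x) (j + k))))"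
    unfolding frame_sum_def
  proof (rule sum.cong[OF refl])
    fix x :: "'n \<times> 'n \<times> nat"
    show "of_real (frame_weight x) * flow_derivative w w' j (?b (frame_vec x) k) (?b (frame_vec x) k) (frame_vec x) A
      = of_real w' * (\<tau>\<^sup>2 * c 0 * c j) * (2 * (of_real (frame_weight x) * (?b (frame_vec x) 0
        * ?b (frame_vec x) k))
           - c 0 * (of_real (frame_weight x) * ?b (frame_vec x) k))
       + of_real w * \<tau> * (of_real (frame_weight x) * (?b (frame_vec x) 0 * ?b (frame_vec x) (j + k)))"
      unfolding flow_derivative_conj_phase[OF A frame_vec_unit] c_def \<tau>_def
      using jk by (elim disjE) (simp_all add: algebra_simps)
  qed
  also have "\<dots> = of_real w' * (\<tau>\<^sup>2 * c 0 * c j) * (2 * frame_coeff k A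
    - c 0 * frame_sum (\<lambda>v. ?b v k))
       + of_real w * \<tau> * frame_coeff (j + k) A"
    unfolding frame_coeff_def frame_sum_def
    by (simp add: sum.distrib sum_subtractf flip: sum_distrib_left)
  finally show ?thesis unfolding frame_sum_slope t_def .
qed

lemma axis_unit: "unit_vec (axis a 1 :: complex^'n)"
proof -
  have "(axis a 1 :: complex^'n) $ i * cnj (axis a 1 $ i) = (if i = a then 1 else 0)" for i
    by (simp add: axis_def)
  then show ?thesis by simp
qed

lemma axis_sum_rotation:
  fixes A :: "complex^'n^'n"
  assumes A: "A \<in> unitary_group"
  defines "c \<equiv> coeff (cayley_poly A)" and "t \<equiv> coeff (trace_poly A)" and "\<tau> \<equiv> conj_phase A"
  shows "(\<Sum>a\<in>UNIV. flow_derivative w w' j (c l) (coeff (slope_poly (axis a 1) A) l) (axis a 1) A)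
    = of_real w' * (\<tau>\<^sup>2 * c 0 * c j) * ((2 * t 0 - of_nat CARD('n) * c 0) * c l)
      + of_real w * \<tau> * (c j * t l + t j * c l - of_nat CARD('n) * c j * c l)"
proof -
  have t: "t k = (\<Sum>a\<in>UNIV. coeff (slope_poly (axis a 1) A) k)" for k
    by (simp add: t_def trace_poly_def coeff_sum)
  show ?thesis
    unfolding flow_derivative_conj_phase[OF A axis_unit] c_def[symmetric] \<tau>_def[symmetric] t
    by (simp add: sum.distrib sum_subtractf sum_distrib_left sum_distrib_right algebra_simps)
qed

section \<open>The derivatives in terms of the Cayley eigenvalues\<close>

text \<open>
  Where the Cayley transform \<open>H\<close> exists, \<open>x k\<close> is \<open>e\<^sub>k(H)\<close>, and the derivatives above become polynomials in
  these real numbers: \<open>T k\<close> stands for \<open>tr B\<^sub>k / D\<close> and \<open>\<Phi> k\<close> for \<open>(tr B\<^sub>0 tr B\<^sub>k + tr(B\<^sub>0 B\<^sub>k)) / D\<^sup>2\<close>, where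
  \<open>b\<^sub>v\<^sub>,\<^sub>k = v\<^sup>*B\<^sub>k v\<close>.
\<close>

locale nonsingular_unitary =
  fixes A :: "complex^'n^'n" and N :: real
  assumes unitary: "A \<in> unitary_group"
    and nonsingular: "coeff (cayley_poly A) 0 \<noteq> 0"
    and N_def: "N = real CARD('n)"
begin

definition x :: "nat \<Rightarrow> real" where
  "x k = Re (coeff (cayley_poly A) k / coeff (cayley_poly A) 0)"

definition T :: "nat \<Rightarrow> complex" where
  "T k = (if k = 0 then (of_real N + \<i> * of_real (x 1)) / 2
     else of_real N / 2 * (of_real (x k) - \<i> * of_real (x (k - 1)))
       + \<i> / 2 * (of_nat (k + 1) * of_real (x (k + 1)) + of_nat (k - 1) * of_real (x (k - 1))))"

definition \<Phi> :: "nat \<Rightarrow> complex" where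
  "\<Phi> k = T 0 * T k + \<i> / 2 * (T 0 * (of_real (x (Suc k)) - \<i> * of_real (x k)) - (T (Suc k) + \<i> * T k))"

abbreviation "c0 \<equiv> coeff (cayley_poly A) 0"

lemma of_nat_N: "(of_nat CARD('n) :: complex) = of_real N"
  by (simp add: N_def)

lemma x_0: "x 0 = 1" using nonsingular by (simp add: x_def)

lemma coeff_eq: "coeff (cayley_poly A) k = of_real (x k) * c0"
proof -
  let ?c = "coeff (cayley_poly A)"
  have "cnj (?c k / c0) = ?c k / c0"
    using cnj_coeff_cayley_poly[OF unitary, of k] cnj_coeff_cayley_poly[OF unitary, of 0] nonsingular
      det_unitary_nonzero[OF unitary]
    by (simp add: conj_phase_def)
  then have "?c k / c0 = of_real (x k)"
    unfolding x_def by (metis Reals_cnj_iff of_real_Re)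
  then show ?thesis using nonsingular by (simp add: field_simps)
qed

lemma phase_square: "conj_phase A * c0\<^sup>2 = of_real (cayley_modulus A)"
proof -
  have "conj_phase A * c0\<^sup>2 = cnj c0 * c0"
    using cnj_coeff_cayley_poly[OF unitary, of 0] by (simp add: power2_eq_square mult.assoc)
  also have "\<dots> = of_real (cayley_modulus A)"
    by (simp add: moment_density_def complex_eq_iff)
  finally show ?thesis .
qed

lemma moment_density_eq: "moment_density j k A = cayley_modulus A * (x j * x k)"
proof -
  have "cnj (coeff (cayley_poly A) j) * coeff (cayley_poly A) k = of_real (x j * x k) * (cnj c0 * c0)"
    unfolding coeff_eq[of j] coeff_eq[of k] by simp
  then show ?thesis by (simp add: moment_density_def)
qed

lemma trace_coeff_eq: "coeff (trace_poly A) k = c0 * T k"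
proof (cases k)
  case 0
  then show ?thesis
    by (simp add: coeff_trace_poly_0 T_def of_nat_N coeff_eq[of 1] coeff_eq[of "Suc 0"] field_simps)
next
  case (Suc m)
  then show ?thesis
    by (simp add: coeff_trace_poly_Suc T_def of_nat_N coeff_eq[of m] coeff_eq[of "Suc m"] coeff_eq[of "Suc (Suc
      m)"] algebra_simps)
qed

lemma frame_coeff_eq: "frame_coeff k A = c0\<^sup>2 * \<Phi> k"
proof -
  have "frame_coeff k A = c0 * T 0 * (c0 * T k) + \<i> / 2 * (- 2 * \<i> * (frame_coeff k A - c0 * T 0 * (c0 * T k)))"
    by (simp add: algebra_simps)
  also have "- 2 * \<i> * (frame_coeff k A - c0 * T 0 * (c0 * T k))
     = c0 * T 0 * (coeff (cayley_poly A) (Suc k) - \<i> * coeff (cayley_poly A) k) - c0 * (c0 * T (Suc k)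
       + \<i> * (c0 * T k))"
    using frame_coeff_recurrence[OF nonsingular, of k] unfolding trace_coeff_eq .
  also have "c0 * T 0 * (c0 * T k) + \<i> / 2 * \<dots> = c0\<^sup>2 * \<Phi> k"
    unfolding coeff_eq[of k] coeff_eq[of "Suc k"] \<Phi>_def by (simp add: power2_eq_square algebra_simps)
  finally show ?thesis .
qed

lemma frame_sum_gradient_eq:
  assumes jk: "j = 0 \<or> k = 0"
  shows "frame_sum (\<lambda>v. flow_derivative w w' j (coeff (slope_poly v A) k) (coeff (slope_poly v A) k) v A)
     = of_real (w' * (cayley_modulus A)\<^sup>2 * x j) * (2 * \<Phi> k - (of_real N + 1) * T k)
       + of_real (w * cayley_modulus A) * \<Phi> (j + k)"
proof -
  have "frame_sum (\<lambda>v. flow_derivative w w' j (coeff (slope_poly v A) k) (coeff (slope_poly v A) k) v A)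
    = of_real w' * (conj_phase A * c0\<^sup>2)\<^sup>2 * of_real (x j) * (2 * \<Phi> k - (of_real N + 1) * T k)
     + of_real w * (conj_phase A * c0\<^sup>2) * \<Phi> (j + k)"
    unfolding frame_sum_gradient[OF unitary jk] trace_coeff_eq frame_coeff_eq coeff_eq[of j] of_nat_N
    by (simp add: power2_eq_square algebra_simps)
  then show ?thesis unfolding phase_square by (simp add: mult_ac)
qed

lemma axis_sum_rotation_eq:
  "(\<Sum>a\<in>UNIV. flow_derivative w w' j (coeff (cayley_poly A) l) (coeff (slope_poly (axis a 1) A) l) (axis a 1) A)
    = of_real (w' * (cayley_modulus A)\<^sup>2 * (x j * x l)) * (2 * T 0 - of_real N)
      + of_real (w * cayley_modulus A) * (of_real (x j) * T l + T j * of_real (x l) - of_real (N * (x j * x l)))"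
proof -
  have "(\<Sum>a\<in>UNIV. flow_derivative w w' j (coeff (cayley_poly A) l) (coeff (slope_poly (axis a 1) A) l) (axis a 1) A)
   = of_real w' * (conj_phase A * c0\<^sup>2)\<^sup>2 * of_real (x j * x l) * (2 * T 0 - of_real N)
      + of_real w * (conj_phase A * c0\<^sup>2) * (of_real (x j) * T l + T j * of_real (x l) - of_real (N * (x j * x l)))"
    unfolding axis_sum_rotation[OF unitary]
    unfolding trace_coeff_eq coeff_eq[of j] coeff_eq[of l] of_nat_N
    by (simp add: power2_eq_square algebra_simps)
  then show ?thesis unfolding phase_square by (simp add: mult_ac)
qed

lemma Re_gradient_00:
  "Re (frame_sum (\<lambda>v. flow_derivative w w' 0 (coeff (slope_poly v A) 0) (coeff (slope_poly v A) 0) v A))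
   = w' * cayley_modulus A * (moment_density 0 2 A - moment_density 1 1 A)
     + w * (N * (N + 1) / 2 * moment_density 0 0 A - moment_density 1 1 A + moment_density 0 2 A) / 2"
  unfolding frame_sum_gradient_eq[of 0 0, simplified] moment_density_eq[of 0 2] moment_density_eq[of 1 1]
  by (simp add: \<Phi>_def T_def x_0 numeral_2_eq_2 power2_eq_square field_simps)

lemma Re_gradient_02:
  "Re (frame_sum (\<lambda>v. flow_derivative w w' 0 (coeff (slope_poly v A) 2) (coeff (slope_poly v A) 2) v A))
   = w' * cayley_modulus A * (- 2 * moment_density 1 3 A + (N - 1) / 2 * moment_density 1 1 A
     + moment_density 0 2 A + 2 * moment_density 0 4 A)
     + w * (N * (N + 1) / 2 * moment_density 0 2 A
        - 2 * moment_density 1 3 A + (N - 1) / 2 * moment_density 1 1 A + moment_density 0 2 A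
          + 2 * moment_density 0 4 A) / 2"
  unfolding frame_sum_gradient_eq[of 0 2, simplified] moment_density_eq[of 0 2] moment_density_eq[of 1 1]
     moment_density_eq[of 0 4] moment_density_eq[of 1 3]
  by (simp add: \<Phi>_def T_def x_0 eval_nat_numeral power2_eq_square field_simps)

lemma Im_rotation_10:
  "Im (\<Sum>a\<in>UNIV. flow_derivative w w' 1 (coeff (cayley_poly A) 0) (coeff (slope_poly (axis a 1) A) 0) (axis a 1) A)
   = w' * cayley_modulus A * moment_density 1 1 A
     + w * (moment_density 1 1 A + 2 * moment_density 0 2 A - N * moment_density 0 0 A) / 2"
  unfolding axis_sum_rotation_eq moment_density_eq[of 0 2] moment_density_eq[of 1 1]
  by (simp add: T_def x_0 numeral_2_eq_2 power2_eq_square field_simps)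

lemma Im_rotation_30:
  "Im (\<Sum>a\<in>UNIV. flow_derivative w w' 3 (coeff (cayley_poly A) 0) (coeff (slope_poly (axis a 1) A) 0) (axis a 1) A)
   = w' * cayley_modulus A * moment_density 1 3 A
     + w * (moment_density 1 3 A + 4 * moment_density 0 4 A - (N - 2) * moment_density 0 2 A) / 2"
  unfolding axis_sum_rotation_eq moment_density_eq[of 0 2] moment_density_eq[of 1 3] moment_density_eq[of 0 4]
  by (simp add: T_def x_0 eval_nat_numeral power2_eq_square field_simps)

text \<open>
  Separately, the two summands contain \<open>w' |D|\<^sup>4 e\<^sub>1\<^sup>2 e\<^sub>2\<close> with opposite signs, which is too singular for the
  limit in which \<open>w'\<close> becomes \<open>(s - 1)|D|\<^bsup>2s-4\<^esup>\<close>; it cancels in the sum.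
\<close>

lemma Re_gradient_20_rotation_21:
  "Re (frame_sum (\<lambda>v. flow_derivative w w' 2 (coeff (slope_poly v A) 0) (coeff (slope_poly v A) 0) v A))
   + Im (\<Sum>a\<in>UNIV. flow_derivative w w' 2 (coeff (cayley_poly A) 1) (coeff (slope_poly (axis a 1) A) 1) (axis a 1) A)
   = w' * cayley_modulus A * moment_density 2 2 A
     + w * (2 * moment_density 2 2 A + moment_density 1 3 A - (N - 1) / 2 * moment_density 1 1 A
        + (N * (N - 1) / 2 + 1) * moment_density 0 2 A + 2 * moment_density 0 4 A) / 2"
  unfolding axis_sum_rotation_eq frame_sum_gradient_eq[of 2 0, simplified]
    moment_density_eq[of 0 2] moment_density_eq[of 1 3] moment_density_eq[of 0 4] moment_density_eq[of 1 1]
      moment_density_eq[of 2 2]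
  by (simp add: \<Phi>_def T_def x_0 eval_nat_numeral power2_eq_square field_simps)

end

section \<open>Haar measure: continuity and translation\<close>

lemma continuous_on_coeff_mult:
  fixes p q :: "'a::topological_space \<Rightarrow> complex poly"
  assumes "\<And>k. continuous_on S (\<lambda>x. coeff (p x) k)" "\<And>k. continuous_on S (\<lambda>x. coeff (q x) k)"
  shows "continuous_on S (\<lambda>x. coeff (p x * q x) k)"
  unfolding coeff_mult by (intro continuous_intros assms)

lemma continuous_on_coeff_prod:
  fixes p :: "'i \<Rightarrow> 'a::topological_space \<Rightarrow> complex poly"
  assumes "\<And>i k. continuous_on S (\<lambda>x. coeff (p i x) k)"
  shows "continuous_on S (\<lambda>x. coeff (\<Prod>i\<in>I. p i x) k)"
proof (induction I arbitrary: k rule: infinite_finite_induct)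
  case (insert i I)
  then show ?case by (simp add: continuous_on_coeff_mult assms)
qed simp_all

lemma continuous_on_coeff_det:
  fixes M :: "'a::topological_space \<Rightarrow> complex poly^'n^'n"
  assumes "\<And>i j k. continuous_on S (\<lambda>x. coeff (M x $ i $ j) k)"
  shows "continuous_on S (\<lambda>x. coeff (det (M x)) k)"
proof -
  have "continuous_on S (\<lambda>x. coeff (of_int (sign p)
    * (\<Prod>i\<in>UNIV. M x $ i $ p i)) k)" for p :: "'n \<Rightarrow> 'n"
    by (intro continuous_on_coeff_mult continuous_on_coeff_prod assms) simp
  then show ?thesis unfolding det_def coeff_sum by (intro continuous_on_sum)
qed

lemma continuous_on_coeff_cayley_poly:
  fixes f :: "'a::topological_space \<Rightarrow> complex^'n^'n"
  assumes "continuous_on S f"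
  shows "continuous_on S (\<lambda>x. coeff (cayley_poly (f x)) k)"
  unfolding cayley_poly_def
proof (rule continuous_on_coeff_det)
  fix i j k
  show "continuous_on S (\<lambda>x. coeff ((\<chi> i j. [:mat 1 $ i $ j - f x $ i $ j, \<i> * (mat 1 $ i $ j
    + f x $ i $ j):]) $ i $ j) k)"
    by (cases k; cases "k - 1") (auto intro!: continuous_intros assms simp: coeff_pCons split: nat.splits)
qed

lemma continuous_on_moment_density: "continuous_on S (moment_density j k)"
  unfolding moment_density_def by (intro continuous_intros continuous_on_coeff_cayley_poly)

lemma continuous_on_matrix_mult_left:
  fixes U :: "complex^'n^'n"
  shows "continuous_on S (\<lambda>A. U ** A)"
  unfolding matrix_matrix_mult_def by (intro continuous_intros)

lemma continuous_on_coeff_slope_poly: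
  fixes v :: "complex^'n"
  shows "continuous_on S (\<lambda>A. coeff (slope_poly v A) k)"
  unfolding slope_poly_def coeff_diff
  by (intro continuous_on_diff continuous_on_coeff_cayley_poly continuous_on_matrix_mult_left continuous_on_id)

lemma compact_unitary_group: "compact (unitary_group :: (complex^'n^'n) set)"
proof -
  have "closed (unitary_group :: (complex^'n^'n) set)"
  proof -
    have eq: "unitary_group = {A. A ** adjoint_matrix A
      = mat 1} \<inter> {A :: complex^'n^'n. adjoint_matrix A ** A = mat 1}"
      by (auto simp: unitary_group_def)
    have c: "continuous_on UNIV (\<lambda>A :: complex^'n^'n. A ** adjoint_matrix A)"
      "continuous_on UNIV (\<lambda>A :: complex^'n^'n. adjoint_matrix A ** A)"
      unfolding matrix_matrix_mult_def adjoint_matrix_nth by (intro continuous_intros)+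
    show ?thesis
      unfolding eq by (intro closed_Int closed_Collect_eq c continuous_on_const)
  qed
  moreover have "bounded (unitary_group :: (complex^'n^'n) set)"
  proof (rule boundedI)
    fix A :: "complex^'n^'n" assume A: "A \<in> unitary_group"
    have entry: "norm (A $ i $ j) \<le> 1" for i j
    proof -
      have "(\<Sum>l\<in>UNIV. A $ i $ l * cnj (A $ i $ l)) = 1"
        using A by (auto simp: unitary_group_def vec_eq_iff matrix_matrix_mult_def adjoint_matrix_nth mat_def)
      then have "complex_of_real (\<Sum>l\<in>UNIV. (norm (A $ i $ l))\<^sup>2) = of_real 1"
        by (simp add: complex_norm_square[symmetric])
      then have s: "(\<Sum>l\<in>UNIV. (norm (A $ i $ l))\<^sup>2) = 1" by (simp only: of_real_eq_iff)
      have "(norm (A $ i $ j))\<^sup>2 \<le> (\<Sum>l\<in>UNIV. (norm (A $ i $ l))\<^sup>2)"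
        by (intro member_le_sum) auto
      then have "(norm (A $ i $ j))\<^sup>2 \<le> 1" unfolding s .
      then show ?thesis by (simp add: power_le_one_iff abs_square_le_1)
    qed
    have "norm (A $ i) \<le> real CARD('n)" for i
    proof -
      have "norm (A $ i) \<le> (\<Sum>j\<in>UNIV. norm (A $ i $ j))" unfolding norm_vec_def by (rule L2_set_le_sum) simp
      also have "\<dots> \<le> (\<Sum>j\<in>(UNIV::'n set). 1)" by (intro sum_mono entry)
      finally show ?thesis by simp
    qed
    moreover have "norm A \<le> (\<Sum>i\<in>UNIV. norm (A $ i))"
      unfolding norm_vec_def[of A] by (rule L2_set_le_sum) simp
    ultimately show "norm A \<le> (\<Sum>i\<in>(UNIV::'n set). real CARD('n))"
      using sum_mono[of UNIV "\<lambda>i. norm (A $ i)" "\<lambda>i. real CARD('n)"] by fastforce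
  qed
  ultimately show ?thesis by (simp add: compact_eq_bounded_closed)
qed

lemma bounded_on_unitary_group:
  fixes f :: "complex^'n^'n \<Rightarrow> 'b::real_normed_vector"
  assumes "continuous_on unitary_group f"
  obtains K where "K \<ge> 0" and "\<And>A. A \<in> unitary_group \<Longrightarrow> norm (f A) \<le> K"
proof -
  have "bounded (f ` unitary_group)"
    by (intro compact_imp_bounded compact_continuous_image assms compact_unitary_group)
  then obtain K where "K > 0" "\<forall>x\<in>f ` unitary_group. norm x \<le> K"
    unfolding bounded_pos by blast
  then show ?thesis using that[of K] by auto
qed

locale haar =
  fixes \<mu> :: "(complex^'n^'n) measure"
  assumes haar: "haar_unitary \<mu>"
begin

sublocale prob_space \<mu> using haar by (simp add: haar_unitary_def)

lemma sets_eq: "sets \<mu> = sets (restrict_space borel unitary_group)"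
  using haar by (simp add: haar_unitary_def)

lemma space_eq: "space \<mu> = unitary_group"
  using sets_eq_imp_space_eq[OF sets_eq] by (simp add: space_restrict_space)

lemma measurable_continuous:
  fixes f :: "complex^'n^'n \<Rightarrow> 'b::topological_space"
  assumes "continuous_on unitary_group f"
  shows "f \<in> borel_measurable \<mu>"
  using borel_measurable_continuous_on_restrict[OF assms] measurable_cong_sets[OF sets_eq refl] by blast

lemma measurable_translation:
  assumes "U \<in> unitary_group"
  shows "(\<lambda>A. U ** A) \<in> measurable \<mu> \<mu>"
proof -
  have "(\<lambda>A. U ** A) \<in> measurable \<mu> (restrict_space borel unitary_group)"
  proof (rule measurable_restrict_space2)
    show "(\<lambda>A. U ** A) \<in> space \<mu> \<rightarrow> unitary_group"
      using assms by (auto simp: space_eq intro: unitary_mult)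
    show "(\<lambda>A. U ** A) \<in> borel_measurable \<mu>"
      by (intro measurable_continuous continuous_on_matrix_mult_left)
  qed
  then show ?thesis using measurable_cong_sets[OF refl sets_eq] by blast
qed

lemma distr_translation: "U \<in> unitary_group \<Longrightarrow> distr \<mu> \<mu> (\<lambda>A. U ** A) = \<mu>"
  using haar by (simp add: haar_unitary_def)

lemma integral_translation:
  fixes f :: "complex^'n^'n \<Rightarrow> 'b::{banach, second_countable_topology}"
  assumes U: "U \<in> unitary_group" and f: "f \<in> borel_measurable \<mu>"
  shows "(LINT A|\<mu>. f (U ** A)) = (LINT A|\<mu>. f A)"
  using integral_distr[OF measurable_translation[OF U] f] by (simp add: distr_translation[OF U])

lemma nn_integral_translation:
  assumes U: "U \<in> unitary_group" and f: "f \<in> borel_measurable \<mu>"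
  shows "(\<integral>\<^sup>+ A. f (U ** A) \<partial>\<mu>) = (\<integral>\<^sup>+ A. f A \<partial>\<mu>)"
  using nn_integral_distr[OF measurable_translation[OF U], of f] f by (simp add: distr_translation[OF U])

lemma integrable_continuous:
  fixes f :: "complex^'n^'n \<Rightarrow> 'b::{banach, second_countable_topology}"
  assumes "continuous_on unitary_group f"
  shows "integrable \<mu> f"
proof -
  obtain K where "\<And>A. A \<in> unitary_group \<Longrightarrow> norm (f A) \<le> K"
    using bounded_on_unitary_group[OF assms] by blast
  then show ?thesis
    by (intro integrable_const_bound[where B = K] measurable_continuous assms AE_I2) (simp add: space_eq)
qed

end

section \<open>Negative moments of the determinant\<close>

lemma abs_sin_ge:
  fixes x :: real
  assumes "\<bar>x\<bar> \<le> 2"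
  shows "\<bar>x\<bar> / 3 \<le> \<bar>sin x\<bar>"
proof -
  have *: "y / 3 \<le> sin y" if y: "0 \<le> y" "y \<le> 2" for y :: real
  proof -
    have "\<bar>sin y - (\<Sum>m<3. sin_coeff m * y ^ m)\<bar> \<le> inverse (fact 3) * \<bar>y\<bar> ^ 3"
      by (rule Maclaurin_sin_bound)
    also have "(\<Sum>m<3. sin_coeff m * y ^ m) = y"
      by (simp add: eval_nat_numeral sin_coeff_def)
    finally have "sin y \<ge> y - y ^ 3 / 6"
      using y abs_ge_minus_self[of "sin y - y"] by (simp add: fact_numeral)
    moreover have "y ^ 3 = y * y\<^sup>2" by (simp add: eval_nat_numeral)
    moreover have "y * y\<^sup>2 \<le> y * 2\<^sup>2" using y by (intro mult_left_mono power_mono) auto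
    ultimately show ?thesis by simp
  qed
  show ?thesis
  proof (cases "x \<ge> 0")
    case True
    then show ?thesis using *[of x] assms by linarith
  next
    case False
    then show ?thesis using *[of "- x"] assms by simp
  qed
qed

text \<open>
  After division by \<open>\<alpha>\<close> and a rotation, this is the bound of a modulus by the imaginary part. The phase
  \<open>\<phi>\<close> can be taken modulo \<open>\<pi>\<close>, since only \<open>|sin|\<close> occurs.
\<close>

lemma norm_circle_ge:
  fixes \<alpha> \<beta> :: complex
  obtains \<phi> :: real where "\<bar>\<phi>\<bar> \<le> pi / 2" and "\<And>t. cmod \<alpha> * \<bar>sin (t
    + \<phi>)\<bar> \<le> cmod (\<alpha> + \<beta> * cis t)"
proof (cases "\<alpha> = 0")
  case True
  then show ?thesis using that[of 0] by simp
next
  case False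
  define \<gamma> where "\<gamma> = \<beta> / \<alpha>"
  define \<psi> where "\<psi> = Arg \<gamma>"
  have bound: "cmod \<alpha> * \<bar>sin (t + \<psi>)\<bar> \<le> cmod (\<alpha> + \<beta> * cis t)" for t
  proof -
    have g: "\<gamma> = of_real (cmod \<gamma>) * cis \<psi>"
      unfolding \<psi>_def using rcis_cmod_Arg[of \<gamma>] by (simp add: rcis_def)
    have "\<alpha> + \<beta> * cis t = \<alpha> * (1 + \<gamma> * cis t)"
      using False by (simp add: \<gamma>_def field_simps)
    also have "1 + \<gamma> * cis t = cis (t + \<psi>) * (cis (- (t + \<psi>)) + of_real (cmod \<gamma>))"
      by (subst g) (simp add: algebra_simps cis_mult)
    finally have "cmod (\<alpha> + \<beta> * cis t) = cmod \<alpha> * cmod (cis (- (t + \<psi>)) + of_real (cmod \<gamma>))"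
      by (simp add: norm_mult)
    moreover have "\<bar>sin (t + \<psi>)\<bar> \<le> cmod (cis (- (t + \<psi>)) + of_real (cmod \<gamma>))"
      using abs_Im_le_cmod[of "cis (- (t + \<psi>)) + of_real (cmod \<gamma>)"] by (simp del: minus_add_distrib)
    ultimately show ?thesis by (simp add: mult_left_mono)
  qed
  have psi: "- pi < \<psi>" "\<psi> \<le> pi" using mpi_less_Arg Arg_le_pi by (auto simp: \<psi>_def)
  consider "\<bar>\<psi>\<bar> \<le> pi / 2" | "\<psi> > pi / 2" | "\<psi> < - pi / 2" by linarith
  then show ?thesis
  proof cases
    case 1
    then show ?thesis using that bound by blast
  next
    case 2
    have "sin (t + (\<psi> - pi)) = - sin (t + \<psi>)" for t
      using sin_minus_pi[of "t + \<psi>"] by (simp add: algebra_simps)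
    then show ?thesis using that[of "\<psi> - pi"] bound 2 psi by (auto simp: abs_le_iff)
  next
    case 3
    have "sin (t + (\<psi> + pi)) = - sin (t + \<psi>)" for t
      using sin_periodic_pi[of "t + \<psi>"] by (simp add: algebra_simps)
    then show ?thesis using that[of "\<psi> + pi"] bound 3 psi by (auto simp: abs_le_iff)
  qed
qed

lemma nn_integral_abs_powr_finite:
  fixes p :: real
  assumes p: "- 1 < p"
  shows "(\<integral>\<^sup>+ x. ennreal (\<bar>x\<bar> powr p) * indicator {-2..2} x \<partial>lborel) < \<infinity>"
proof -
  have pos: "(\<integral>\<^sup>+ x. ennreal (x powr p) * indicator {0..2} x \<partial>lborel) < \<infinity>"
  proof -
    have "((\<lambda>x. x powr p) has_integral (2 powr (p + 1) / (p + 1))) {0..2}"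
      using has_integral_powr_from_0[OF p, of 2] by simp
    then have "((\<lambda>x. if x \<in> {0..2} then x powr p else 0) has_integral (2 powr (p + 1) / (p + 1))) UNIV"
      by (simp only: has_integral_restrict_UNIV)
    then have "(\<integral>\<^sup>+ x. ennreal (if x \<in> {0..2} then x powr p else 0) \<partial>lborel)
      = ennreal (2 powr (p + 1) / (p + 1))"
      by (intro nn_integral_has_integral_lborel) auto
    moreover have "(\<integral>\<^sup>+ x. ennreal (if x \<in> {0..2} then x powr p else 0) \<partial>lborel)
       = (\<integral>\<^sup>+ x. ennreal (x powr p) * indicator {0..2} x \<partial>lborel)"
      by (intro nn_integral_cong) (auto split: split_indicator)
    ultimately show ?thesis by (metis ennreal_less_top infinity_ennreal_def)
  qed
  have neg: "(\<integral>\<^sup>+ x. ennreal ((- x) powr p) * indicator {0..2} (- x) \<partial>lborel)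
     = (\<integral>\<^sup>+ x. ennreal (x powr p) * indicator {0..2} x \<partial>lborel)"
    using nn_integral_real_affine[of "\<lambda>x. ennreal (x powr p) * indicator {0..2} x" "-1" 0] by simp
  have "(\<integral>\<^sup>+ x. ennreal (\<bar>x\<bar> powr p) * indicator {-2..2} x \<partial>lborel)
    \<le> (\<integral>\<^sup>+ x. ennreal (x powr p) * indicator {0..2} x
      + ennreal ((- x) powr p) * indicator {0..2} (- x) \<partial>lborel)"
    by (intro nn_integral_mono) (auto split: split_indicator simp: abs_if)
  also have "\<dots> = (\<integral>\<^sup>+ x. ennreal (x powr p) * indicator {0..2} x \<partial>lborel)
      + (\<integral>\<^sup>+ x. ennreal ((- x) powr p) * indicator {0..2} (- x) \<partial>lborel)"
    by (intro nn_integral_add) auto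
  also have "\<dots> < \<infinity>" unfolding neg using pos by (simp add: ennreal_add_eq_top less_top)
  finally show ?thesis .
qed

definition circle_const :: "real \<Rightarrow> ennreal" where
  "circle_const p = ennreal (9 powr (- p)) * (\<integral>\<^sup>+ x. ennreal (\<bar>x\<bar> powr (2 * p))
    * indicator {-2..2} x \<partial>lborel)"

lemma circle_const_finite: "- 1 / 2 < p \<Longrightarrow> circle_const p < \<infinity>"
  unfolding circle_const_def using nn_integral_abs_powr_finite[of "2 * p"]
  by (simp add: ennreal_mult_less_top)

text \<open>
  On the interval \<open>[-2/5, 2/5]\<close> the argument \<open>t + \<phi>\<close> stays in \<open>[-2, 2]\<close>, where \<open>|sin x| \<ge> |x|/3\<close>. The bound
  is uniform in \<open>\<beta>\<close> and \<open>\<epsilon>\<close>.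
\<close>

lemma circle_average_le:
  fixes \<alpha> \<beta> :: complex and p \<epsilon> :: real
  assumes p: "p \<le> 0" and eps: "\<epsilon> > 0"
  shows "(\<integral>\<^sup>+ t. ennreal (((cmod (\<alpha> + \<beta> * cis t))\<^sup>2
    + \<epsilon>) powr p) * indicator {-(2/5)..2/5} t \<partial>lborel)
    \<le> circle_const p * ennreal (((cmod \<alpha>)\<^sup>2 + \<epsilon>) powr p)"
proof -
  obtain \<phi> :: real where phi: "\<bar>\<phi>\<bar> \<le> pi / 2"
    and low: "\<And>t. cmod \<alpha> * \<bar>sin (t + \<phi>)\<bar> \<le> cmod (\<alpha> + \<beta> * cis t)"
    by (rule norm_circle_ge[of \<alpha> \<beta>]) blast
  let ?E = "((cmod \<alpha>)\<^sup>2 + \<epsilon>) powr p"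
  let ?h = "\<lambda>x. ennreal (9 powr (- p) * ?E) * (ennreal (\<bar>x\<bar> powr (2 * p)) * indicator {-2..2} x)"
  have pt: "((cmod (\<alpha> + \<beta> * cis t))\<^sup>2 + \<epsilon>) powr p \<le> 9 powr (- p) * ?E * \<bar>t
    + \<phi>\<bar> powr (2 * p)"
    if t: "t \<in> {-(2/5)..2/5}" "t + \<phi> \<noteq> 0" for t
  proof -
    let ?x = "t + \<phi>"
    have x2: "\<bar>?x\<bar> \<le> 2" using t(1) phi pi_less_4 pi_approx by (auto simp: abs_le_iff)
    have s: "?x\<^sup>2 / 9 \<le> (sin ?x)\<^sup>2"
      using power_mono[OF abs_sin_ge[OF x2], of 2] by (simp add: power_divide)
    have pos: "0 < ?x\<^sup>2 / 9 * ((cmod \<alpha>)\<^sup>2 + \<epsilon>)"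
      using t(2) eps by (simp add: add_nonneg_pos)
    have "?x\<^sup>2 / 9 * ((cmod \<alpha>)\<^sup>2 + \<epsilon>) \<le> (sin ?x)\<^sup>2
      * ((cmod \<alpha>)\<^sup>2 + \<epsilon>)"
      using s eps by (intro mult_right_mono) auto
    also have "\<dots> \<le> (cmod \<alpha> * \<bar>sin ?x\<bar>)\<^sup>2 + \<epsilon>"
    proof -
      have "(sin ?x)\<^sup>2 * \<epsilon> \<le> 1 * \<epsilon>"
        using eps by (intro mult_right_mono) (auto simp: abs_square_le_1)
      then show ?thesis by (simp add: power_mult_distrib algebra_simps)
    qed
    also have "\<dots> \<le> (cmod (\<alpha> + \<beta> * cis t))\<^sup>2 + \<epsilon>"
      using power_mono[OF low[of t], of 2] by simp
    finally have "((cmod (\<alpha> + \<beta> * cis t))\<^sup>2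
      + \<epsilon>) powr p \<le> (?x\<^sup>2 / 9 * ((cmod \<alpha>)\<^sup>2 + \<epsilon>)) powr p"
      by (intro powr_mono2' p pos)
    also have "\<dots> = 9 powr (- p) * ?E * (?x\<^sup>2) powr p"
    proof -
      define E where "E = (cmod \<alpha>)\<^sup>2 + \<epsilon>"
      have "E > 0" using eps by (simp add: E_def add_nonneg_pos)
      then show ?thesis unfolding E_def[symmetric]
        by (simp add: powr_mult powr_divide powr_minus_divide)
    qed
    also have "(?x\<^sup>2) powr p = \<bar>?x\<bar> powr (2 * p)"
      using t(2) by (metis abs_ge_zero abs_zero power2_abs powr_powr powr_numeral zero_less_abs_iff)
    finally show ?thesis .
  qed
  have ae: "AE t in lborel. t \<noteq> - \<phi>" by (rule AE_lborel_singleton)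
  have "(\<integral>\<^sup>+ t. ennreal (((cmod (\<alpha> + \<beta> * cis t))\<^sup>2
    + \<epsilon>) powr p) * indicator {-(2/5)..2/5} t \<partial>lborel)
     \<le> (\<integral>\<^sup>+ t. ?h (\<phi> + 1 * t) \<partial>lborel)"
  proof (rule nn_integral_mono_AE, rule AE_mp[OF ae], rule AE_I2, rule impI)
    fix t :: real assume "t \<noteq> - \<phi>"
    then have nz: "t + \<phi> \<noteq> 0" by simp
    show "ennreal (((cmod (\<alpha> + \<beta> * cis t))\<^sup>2
      + \<epsilon>) powr p) * indicator {-(2/5)..2/5} t \<le> ?h (\<phi> + 1 * t)"
    proof (cases "t \<in> {-(2/5)..2/5}")
      case True
      then have "\<phi> + t \<in> {-2..2}" using phi pi_approx by auto
      then have "?h (\<phi> + 1 * t) = ennreal (9 powr (- p) * ?E * \<bar>t + \<phi>\<bar> powr (2 * p))"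
        by (simp add: add.commute flip: ennreal_mult)
      then show ?thesis using pt[OF True nz] True by (simp add: ennreal_leI)
    qed simp
  qed
  also have "\<dots> = (\<integral>\<^sup>+ x. ?h x \<partial>lborel)"
    using nn_integral_real_affine[of ?h 1 \<phi>] by simp
  also have "\<dots> = circle_const p * ennreal ?E"
    by (subst nn_integral_cmult) (simp_all add: circle_const_def ennreal_mult mult_ac)
  finally show ?thesis .
qed

definition zero_rows :: "'n set \<Rightarrow> complex^'n^'n \<Rightarrow> complex^'n^'n" where
  "zero_rows S A = (\<chi> i. if i \<in> S then 0 else A $ i)"

text \<open>
  The value at \<open>z\<^sub>a = 0\<close> (\<open>a \<in> S\<close>), \<open>z\<^sub>a = 1\<close> (\<open>a \<notin> S\<close>) of the function \<open>det(1 - diag(z)A)\<close>, which is affine in each \<open>z\<^sub>a\<close>.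
\<close>

definition row_det :: "'n set \<Rightarrow> complex^'n^'n \<Rightarrow> complex" where
  "row_det S A = coeff (cayley_poly (zero_rows S A)) 0"

lemma row_det_empty: "row_det {} A = coeff (cayley_poly A) 0"
  by (simp add: row_det_def zero_rows_def)

lemma row_det_UNIV: "row_det UNIV A = 1" for A :: "complex^'b^'b"
proof -
  have "cayley_matrix (0 :: complex^'b^'b) 0 = mat 1"
    by (simp add: vec_eq_iff cayley_matrix_def)
  then have "poly (cayley_poly (0 :: complex^'b^'b)) 0 = 1"
    by (simp add: poly_cayley_poly)
  moreover have "zero_rows UNIV A = 0" for A :: "complex^'b^'b" by (simp add: zero_rows_def vec_eq_iff)
  ultimately show ?thesis by (simp add: row_det_def poly_0_coeff_0)
qed

lemma row_det_rank_one_update: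
  assumes "a \<notin> S"
  obtains \<beta> where "\<And>z. row_det S (rank_one_update (axis a 1) z ** A) = row_det (insert a S) A + \<beta> * z"
proof -
  have scale: "zero_rows S (rank_one_update (axis a 1) z ** A) = rank_one_update (axis a 1) z ** zero_rows S A" for z
    by (simp add: vec_eq_iff zero_rows_def rank_one_update_axis)
  have zero: "rank_one_update (axis a 1) 0 ** zero_rows S A = zero_rows (insert a S) A"
    by (auto simp: vec_eq_iff zero_rows_def rank_one_update_axis)
  define \<beta> where "\<beta> = coeff (slope_poly (axis a 1) (zero_rows S A)) 0"
  have "coeff (cayley_poly (zero_rows S A)) 0 = row_det (insert a S) A + \<beta>"
    by (simp add: \<beta>_def slope_poly_def zero row_det_def)
  then have "row_det S (rank_one_update (axis a 1) z ** A) = row_det (insert a S) A + \<beta> * z" for z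
    unfolding row_det_def[of S] scale cayley_poly_rank_one_update
    by (simp add: \<beta>_def algebra_simps)
  then show ?thesis by (rule that)
qed

lemma continuous_on_row_det: "continuous_on S (row_det R)"
proof -
  have "continuous_on S (zero_rows R)"
    unfolding zero_rows_def
  proof (intro continuous_on_vec_lambda)
    fix i show "continuous_on S (\<lambda>A. if i \<in> R then 0 else A $ i)"
      by (cases "i \<in> R") (auto intro!: continuous_intros)
  qed
  then show ?thesis unfolding row_det_def by (rule continuous_on_coeff_cayley_poly)
qed

context haar
begin

text \<open>
  Multiplication of row \<open>a\<close> by \<open>e\<^bsup>\<i>t\<^esup>\<close> preserves the Haar measure; averaged over \<open>t\<close>, the affine function
  of \<open>e\<^bsup>\<i>t\<^esup>\<close> is bounded by its constant term.
\<close>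

lemma row_det_moment_step:
  assumes p: "p \<le> 0" and eps: "\<epsilon> > 0" and a: "a \<notin> S"
  shows "ennreal (4/5) * (\<integral>\<^sup>+ A. ennreal (((cmod (row_det S A))\<^sup>2
    + \<epsilon>) powr p) \<partial>\<mu>)
    \<le> circle_const p * (\<integral>\<^sup>+ A. ennreal (((cmod (row_det (insert a S) A))\<^sup>2
      + \<epsilon>) powr p) \<partial>\<mu>)"
proof -
  define h where "h S A = ennreal (((cmod (row_det S A))\<^sup>2 + \<epsilon>) powr p)" for S and A :: "complex^'n^'n"
  let ?R = "\<lambda>t. rank_one_update (axis a 1) (cis t) :: complex^'n^'n"
  have rd[measurable]: "row_det S \<in> borel_measurable \<mu>" for S
    by (intro measurable_continuous continuous_on_row_det)
  have hm[measurable]: "h S \<in> borel_measurable \<mu>" for S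
    unfolding h_def by measurable
  have U: "?R t \<in> unitary_group" for t
    by (intro rank_one_update_unitary axis_unit) simp
  define \<beta> where "\<beta> A = row_det S A - row_det (insert a S) A" for A
  have split: "row_det S (?R t ** A) = row_det (insert a S) A + \<beta> A * cis t" for t A
  proof -
    obtain b where b: "\<And>z. row_det S (rank_one_update (axis a 1) z ** A) = row_det (insert a S) A + b * z"
      using row_det_rank_one_update[OF a, of A] by blast
    have "b = \<beta> A" using b[of 1] by (simp add: rank_one_update_one \<beta>_def)
    then show ?thesis using b by simp
  qed
  have [measurable]: "\<beta> \<in> borel_measurable \<mu>" unfolding \<beta>_def by measurable
  have [measurable]: "cis \<in> borel_measurable borel"
    by (intro borel_measurable_continuous_onI continuous_intros)
  interpret P: pair_sigma_finite lborel \<mu> ..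
  have "ennreal (4/5) * (\<integral>\<^sup>+ A. h S A \<partial>\<mu>)
    = (\<integral>\<^sup>+ t. (\<integral>\<^sup>+ A. h S A \<partial>\<mu>)
      * indicator {-(2/5)..2/5::real} t \<partial>lborel)"
    by (subst nn_integral_cmult_indicator) (simp_all add: mult.commute)
  also have "\<dots> = (\<integral>\<^sup>+ t. (\<integral>\<^sup>+ A. h S (?R t ** A)
    * indicator {-(2/5)..2/5} t \<partial>\<mu>) \<partial>lborel)"
  proof (intro nn_integral_cong)
    fix t :: real
    have "(\<lambda>A. h S (?R t ** A)) \<in> borel_measurable \<mu>"
      using measurable_compose[OF measurable_translation[OF U[of t]] hm[of S]] .
    then show "(\<integral>\<^sup>+ A. h S A \<partial>\<mu>) * indicator {-(2/5)..2/5} t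
      = (\<integral>\<^sup>+ A. h S (?R t ** A) * indicator {-(2/5)..2/5} t \<partial>\<mu>)"
      using nn_integral_translation[OF U[of t] hm[of S]] by (simp add: nn_integral_multc)
  qed
  also have "\<dots> = (\<integral>\<^sup>+ A. (\<integral>\<^sup>+ t. h S (?R t ** A)
    * indicator {-(2/5)..2/5} t \<partial>lborel) \<partial>\<mu>)"
    unfolding h_def split by (rule P.Fubini'[symmetric]) measurable
  also have "\<dots> \<le> (\<integral>\<^sup>+ A. circle_const p * h (insert a S) A \<partial>\<mu>)"
    unfolding h_def split by (intro nn_integral_mono circle_average_le p eps)
  also have "\<dots> = circle_const p * (\<integral>\<^sup>+ A. h (insert a S) A \<partial>\<mu>)"
    by (rule nn_integral_cmult) measurable
  finally show ?thesis unfolding h_def .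
qed

text \<open>
  Induction on the number of rows averaged over; once all rows are replaced by zero the determinant is one.
\<close>

lemma regularised_moment_bounded:
  assumes p: "- 1 / 2 < p" "p \<le> 0"
  obtains K :: real where "K \<ge> 0"
    and "\<And>\<epsilon>. \<epsilon> > 0 \<Longrightarrow> (\<integral>\<^sup>+ A. ennreal ((cayley_modulus A
      + \<epsilon>) powr p) \<partial>\<mu>) \<le> ennreal K"
proof -
  obtain c :: real where c: "circle_const p = ennreal c" "c \<ge> 0"
    using circle_const_finite[OF p(1)] by (cases "circle_const p") auto
  have step: "(\<integral>\<^sup>+ A. ennreal (((cmod (row_det (UNIV - T) A))\<^sup>2
    + \<epsilon>) powr p) \<partial>\<mu>) \<le> ennreal ((5/4 * c) ^ card T)"
    if eps: "\<epsilon> > 0" and "finite T" for \<epsilon> and T :: "'n set"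
    using that(2)
  proof (induction T rule: finite_induct)
    case empty
    have "(1 + \<epsilon>) powr p \<le> 1" using eps p powr_mono2'[of p 1 "1 + \<epsilon>"] by simp
    then have "ennreal ((1 + \<epsilon>) powr p) \<le> 1" by simp
    then show ?case by (simp add: row_det_UNIV emeasure_space_1)
  next
    case (insert a T)
    let ?I = "\<lambda>T. \<integral>\<^sup>+ A. ennreal (((cmod (row_det (UNIV - T) A))\<^sup>2
      + \<epsilon>) powr p) \<partial>\<mu>"
    have "insert a (UNIV - insert a T) = UNIV - T" using insert(2) by auto
    then have "ennreal (4/5) * ?I (insert a T) \<le> circle_const p * ?I T"
      using row_det_moment_step[OF p(2) eps, of a "UNIV - insert a T"] by simp
    \<comment> \<open>The number \<open>4/5\<close> is the length of the interval of averaging.\<close>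
    then have "ennreal (5/4) * (ennreal (4/5) * ?I (insert a T)) \<le> ennreal (5/4) * (circle_const p * ?I T)"
      by (intro mult_left_mono) auto
    moreover have "ennreal (5/4) * (ennreal (4/5) * ?I (insert a T)) = ?I (insert a T)"
      by (simp flip: mult.assoc ennreal_mult)
    moreover have "ennreal (5/4) * (circle_const p * ?I T) \<le> ennreal (5/4) * (ennreal c * ennreal ((5/4 * c) ^ card T))"
      unfolding c(1) by (intro mult_left_mono insert.IH) auto
    moreover have "ennreal (5/4) * (ennreal c * ennreal ((5/4 * c) ^ card T)) = ennreal ((5/4 * c) ^ card (insert a T))"
      using c(2) insert(1,2) by (simp add: mult_ac flip: ennreal_mult)
    ultimately show ?case by simp
  qed
  have eq: "cayley_modulus A = (cmod (row_det {} A))\<^sup>2" for A :: "complex^'n^'n"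
    by (simp add: moment_density_def row_det_empty cmod_power2 flip: power2_eq_square)
  show ?thesis
  proof (rule that[of "(5/4 * c) ^ card (UNIV :: 'n set)"])
    show "0 \<le> (5/4 * c) ^ card (UNIV :: 'n set)" using c by simp
    show "(\<integral>\<^sup>+ A. ennreal ((cayley_modulus A
      + \<epsilon>) powr p) \<partial>\<mu>) \<le> ennreal ((5/4 * c) ^ card (UNIV :: 'n set))"
      if "\<epsilon> > 0" for \<epsilon>
      using step[OF that, of UNIV] by (simp add: eq)
  qed
qed

lemma measurable_moment_density[measurable]: "moment_density j k \<in> borel_measurable \<mu>"
  by (intro measurable_continuous continuous_on_moment_density)

text \<open>
  On the singular set the regularised integrand equals \<open>\<epsilon>\<^bsup>-1/4\<^esup>\<close>, but its integral stays bounded as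
  \<open>\<epsilon> \<rightarrow> 0\<close>. Any exponent between \<open>-1/2\<close> and \<open>0\<close> would do in place of \<open>-1/4\<close>.
\<close>

lemma AE_nonsingular: "AE A in \<mu>. cayley_modulus A > 0"
proof -
  obtain K :: real where K: "K \<ge> 0"
    "\<And>\<epsilon>. \<epsilon> > 0 \<Longrightarrow> (\<integral>\<^sup>+ A. ennreal ((cayley_modulus A
      + \<epsilon>) powr (-1/4)) \<partial>\<mu>) \<le> ennreal K"
    using regularised_moment_bounded[of "-1/4"] by auto
  let ?Z = "{A \<in> space \<mu>. cayley_modulus A = 0}"
  have Z: "?Z \<in> sets \<mu>" by measurable
  have bound: "measure \<mu> ?Z \<le> K * \<epsilon> powr (1/4)" if eps: "\<epsilon> > 0" for \<epsilon>
  proof -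
    have "ennreal (\<epsilon> powr (-1/4)) * emeasure \<mu> ?Z
      = (\<integral>\<^sup>+ A. ennreal (\<epsilon> powr (-1/4)) * indicator ?Z A \<partial>\<mu>)"
      by (rule nn_integral_cmult_indicator[symmetric, OF Z])
    also have "\<dots> \<le> (\<integral>\<^sup>+ A. ennreal ((cayley_modulus A + \<epsilon>) powr (-1/4)) \<partial>\<mu>)"
      by (intro nn_integral_mono) (auto split: split_indicator)
    also have "\<dots> \<le> ennreal K" by (rule K(2)[OF eps])
    finally have "\<epsilon> powr (-1/4) * measure \<mu> ?Z \<le> K"
      using K(1) by (simp add: emeasure_eq_measure flip: ennreal_mult)
    then have "\<epsilon> powr (1/4) * (\<epsilon> powr (-1/4) * measure \<mu> ?Z) \<le> \<epsilon> powr (1/4) * K"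
      by (intro mult_left_mono) auto
    moreover have "\<epsilon> powr (1/4) * \<epsilon> powr (-1/4) = 1" using eps by (simp flip: powr_add)
    ultimately show ?thesis by (simp only: mult.assoc[symmetric] mult_1_left mult.commute[of K])
  qed
  have "((\<lambda>\<epsilon>::real. K * \<epsilon> powr (1/4)) \<longlongrightarrow> K * 0 powr (1/4)) (at_right 0)"
    by (intro tendsto_intros tendsto_powr2) (auto simp: eventually_at_right_less eventually_at_filter)
  then have "measure \<mu> ?Z \<le> K * 0 powr (1/4)"
    by (rule tendsto_lowerbound) (auto simp: eventually_at_filter bound)
  then have "measure \<mu> ?Z = 0" by (simp add: measure_le_0_iff)
  then have "AE A in \<mu>. A \<notin> ?Z"
    using Z by (intro AE_not_in) (auto simp: null_sets_def emeasure_eq_measure)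
  then show ?thesis
    using cayley_modulus_nonneg by (auto elim!: AE_mp intro!: AE_I2 simp: less_le)
qed

lemma integrable_cayley_modulus_powr:
  assumes s: "1 / 2 < s"
  shows "integrable \<mu> (\<lambda>A. cayley_modulus A powr (s - 1))"
proof (cases "s \<ge> 1")
  case True
  obtain K where K: "K \<ge> 0" "\<And>A :: complex^'n^'n. A \<in> unitary_group \<Longrightarrow>
    norm (cayley_modulus A) \<le> K"
    using bounded_on_unitary_group[OF continuous_on_moment_density] by blast
  show ?thesis
  proof (rule integrable_const_bound[where B = "K powr (s - 1)"])
    show "AE A in \<mu>. norm (cayley_modulus A powr (s - 1)) \<le> K powr (s - 1)"
      using K True cayley_modulus_nonneg by (intro AE_I2) (auto simp: space_eq intro!: powr_mono2)
  qed measurable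
next
  case False
  then have p: "- 1 / 2 < s - 1" "s - 1 \<le> 0" using s by auto
  obtain K :: real where K: "K \<ge> 0"
    "\<And>\<epsilon>. \<epsilon> > 0 \<Longrightarrow> (\<integral>\<^sup>+ A. ennreal ((cayley_modulus A
      + \<epsilon>) powr (s - 1)) \<partial>\<mu>) \<le> ennreal K"
    using regularised_moment_bounded[OF p] by auto
  let ?e = "\<lambda>n. 1 / real (Suc n)"
  have "(\<integral>\<^sup>+ A. ennreal (cayley_modulus A powr (s - 1)) \<partial>\<mu>)
    = (\<integral>\<^sup>+ A. liminf (\<lambda>n. ennreal ((cayley_modulus A + ?e n) powr (s - 1))) \<partial>\<mu>)"
  proof (rule nn_integral_cong_AE, rule AE_mp[OF AE_nonsingular], rule AE_I2, rule impI)
    fix A :: "complex^'n^'n" assume pos: "cayley_modulus A > 0"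
    have "(\<lambda>n. (cayley_modulus A + ?e n) powr (s - 1)) \<longlonglongrightarrow> (cayley_modulus A + 0) powr (s - 1)"
      using pos LIMSEQ_inverse_real_of_nat
      by (intro tendsto_powr tendsto_add tendsto_const) (auto simp: inverse_eq_divide)
    then have "(\<lambda>n. ennreal ((cayley_modulus A
      + ?e n) powr (s - 1))) \<longlonglongrightarrow> ennreal (cayley_modulus A powr (s - 1))"
      by (intro tendsto_ennrealI) simp
    then show "ennreal (cayley_modulus A powr (s - 1)) = liminf (\<lambda>n. ennreal ((cayley_modulus A
      + ?e n) powr (s - 1)))"
      using lim_imp_Liminf[OF sequentially_bot] by metis
  qed
  also have "\<dots> \<le> liminf (\<lambda>n. \<integral>\<^sup>+ A. ennreal ((cayley_modulus A
    + ?e n) powr (s - 1)) \<partial>\<mu>)"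
    by (rule nn_integral_liminf) measurable
  also have "\<dots> \<le> liminf (\<lambda>n. ennreal K)"
    by (intro Liminf_mono eventuallyI K(2)) simp
  also have "\<dots> = ennreal K" by (simp add: Liminf_const)
  finally show ?thesis
    by (intro integrableI_nonneg) (auto simp: le_less_trans[OF _ ennreal_less_top])
qed

end

section \<open>Invariance in infinitesimal form\<close>

lemma has_vector_derivative_cis: "(cis has_vector_derivative \<i> * cis t) (at t)"
  by (auto intro!: derivative_eq_intros simp: has_vector_derivative_def cis_conv_exp scaleR_conv_of_real mult_ac)

context haar
begin

text \<open>
  The difference quotients of \<open>g\<close> along the flow have integral zero by invariance, and are bounded by the
  maximum of \<open>|g'|\<close> by the mean value inequality, so dominated convergence applies. Derivatives at
  other times reduce to those at \<open>t = 0\<close>, because the flow is a one-parameter group.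
\<close>

lemma flow_integral_eq_0:
  fixes g g' :: "complex^'n^'n \<Rightarrow> complex"
  assumes v: "unit_vec v"
    and g: "continuous_on unitary_group g" and g': "continuous_on unitary_group g'"
    and deriv: "\<And>A. A \<in> unitary_group \<Longrightarrow>
      ((\<lambda>t. g (rank_one_update v (cis t) ** A)) has_vector_derivative g' A) (at 0)"
  shows "(LINT A|\<mu>. g' A) = 0"
proof -
  let ?R = "\<lambda>t. rank_one_update v (cis t)"
  have U: "?R t \<in> unitary_group" for t by (intro rank_one_update_unitary v) simp
  obtain K where K: "K \<ge> 0" "\<And>A. A \<in> unitary_group \<Longrightarrow> norm (g' A) \<le> K"
    using bounded_on_unitary_group[OF g'] by blast
  have gm[measurable]: "g \<in> borel_measurable \<mu>" "g' \<in> borel_measurable \<mu>"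
    by (intro measurable_continuous g g')+
  have shift: "((\<lambda>t. g (?R t ** A)) has_vector_derivative g' (?R t ** A)) (at t)"
    if A: "A \<in> unitary_group" for A t
  proof -
    have "((\<lambda>h. g (?R h ** (?R t ** A))) has_vector_derivative g' (?R t ** A)) (at (t - t))"
      using deriv[OF unitary_mult[OF U A], of t] by simp
    moreover have "((\<lambda>x. x - t) has_vector_derivative 1) (at t)"
      by (auto intro!: derivative_eq_intros)
    ultimately have "((\<lambda>h. g (?R h ** (?R t ** A))) \<circ> (\<lambda>x. x
      - t) has_vector_derivative 1 *\<^sub>R g' (?R t ** A)) (at t)"
      by (intro vector_diff_chain_at)
    moreover have "(\<lambda>h. g (?R h ** (?R t ** A))) \<circ> (\<lambda>x. x - t) = (\<lambda>x. g (?R x ** A))"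
      by (rule ext) (simp add: matrix_mul_assoc rank_one_update_mult[OF v] cis_mult)
    ultimately show ?thesis by simp
  qed
  define h where "h n = 1 / real (Suc n)" for n
  have h: "h n > 0" for n by (simp add: h_def)
  define q where "q n A = (g (?R (h n) ** A) - g A) /\<^sub>R h n" for n A
  have tr[measurable]: "(\<lambda>A. g (?R t ** A)) \<in> borel_measurable \<mu>" for t
    using measurable_compose[OF measurable_translation[OF U] gm(1)] .
  have int: "(LINT A|\<mu>. q n A) = 0" for n
  proof -
    have i1: "integrable \<mu> g" by (rule integrable_continuous[OF g])
    have "integrable \<mu> (\<lambda>A. g (?R (h n) ** A))"
      using integrable_distr[OF measurable_translation[OF U], of "h n" g] i1 distr_translation[OF U] by simp
    then have "(LINT A|\<mu>. q n A) = ((LINT A|\<mu>. g (?R (h n) ** A)) - (LINT A|\<mu>. g A)) /\<^sub>R h n"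
      unfolding q_def using i1 by simp
    then show ?thesis using integral_translation[OF U gm(1)] by simp
  qed
  have "(\<lambda>n. LINT A|\<mu>. q n A) \<longlonglongrightarrow> (LINT A|\<mu>. g' A)"
  proof (rule integral_dominated_convergence[where w = "\<lambda>_. K"])
    show "q n \<in> borel_measurable \<mu>" for n unfolding q_def by measurable
    show "AE A in \<mu>. (\<lambda>n. q n A) \<longlonglongrightarrow> g' A"
    proof (rule AE_I2)
      fix A assume "A \<in> space \<mu>"
      then have A: "A \<in> unitary_group" by (simp add: space_eq)
      have "((\<lambda>t. (g (?R t ** A) - g (?R 0 ** A)) /\<^sub>R (t - 0)) \<longlongrightarrow> g' A) (at 0)"
      proof (rule Lim_null[THEN iffD2], rule tendsto_norm_zero_cancel)
        have "((\<lambda>t. norm (g (?R t ** A) - g (?R 0 ** A) - (t - 0) *\<^sub>R g' A) / norm (t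
          - 0)) \<longlongrightarrow> 0) (at 0)"
          using deriv[OF A] unfolding has_vector_derivative_def has_derivative_iff_norm by blast
        moreover have "\<forall>\<^sub>F t in at 0. norm (g (?R t ** A) - g (?R 0 ** A) - (t
          - 0) *\<^sub>R g' A) / norm (t - 0)
            = norm ((g (?R t ** A) - g (?R 0 ** A)) /\<^sub>R (t - 0) - g' A)"
        proof (rule eventually_at_filter[THEN iffD2], rule always_eventually, intro allI impI)
          fix t :: real assume "t \<noteq> 0"
          then have "(g (?R t ** A) - g (?R 0 ** A)) /\<^sub>R (t - 0) - g' A
            = (g (?R t ** A) - g (?R 0 ** A) - (t - 0) *\<^sub>R g' A) /\<^sub>R (t - 0)"
            by (simp add: scaleR_diff_right)
          then show "norm (g (?R t ** A) - g (?R 0 ** A) - (t - 0) *\<^sub>R g' A) / norm (t - 0)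
            = norm ((g (?R t ** A) - g (?R 0 ** A)) /\<^sub>R (t - 0) - g' A)"
            by (simp add: divide_inverse mult.commute)
        qed
        ultimately show "((\<lambda>t. norm ((g (?R t ** A) - g (?R 0 ** A)) /\<^sub>R (t - 0)
          - g' A)) \<longlongrightarrow> 0) (at 0)"
          by (rule Lim_transform_eventually)
      qed
      moreover have "filterlim h (at 0) sequentially"
        unfolding h_def by (rule filterlim_atI) (use LIMSEQ_inverse_real_of_nat in \<open>auto simp:
          inverse_eq_divide\<close>)
      ultimately have "(\<lambda>n. (g (?R (h n) ** A) - g (?R 0 ** A)) /\<^sub>R (h n - 0)) \<longlonglongrightarrow> g' A"
        by (rule filterlim_compose)
      then show "(\<lambda>n. q n A) \<longlonglongrightarrow> g' A"
        by (simp add: q_def rank_one_update_one)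
    qed
    show "AE A in \<mu>. norm (q n A) \<le> K" for n
    proof (rule AE_I2)
      fix A assume "A \<in> space \<mu>"
      then have A: "A \<in> unitary_group" by (simp add: space_eq)
      have "norm (g (?R (h n) ** A) - g (?R 0 ** A)) \<le> K * norm (h n - 0)"
      proof (rule differentiable_bound[of UNIV])
        show "((\<lambda>t. g (?R t ** A)) has_derivative (\<lambda>x. x *\<^sub>R g' (?R t ** A))) (at t within UNIV)" for t
          using shift[OF A, of t] by (simp add: has_vector_derivative_def)
        show "onorm (\<lambda>x. x *\<^sub>R g' (?R t ** A)) \<le> K" for t
          using K(2)[OF unitary_mult[OF U A], of t] by (intro onorm_le) (simp add: mult.commute[of K] mult_left_mono)
      qed auto
      then have "norm (g (?R (h n) ** A) - g A) \<le> K * h n"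
        using h[of n] by (simp add: rank_one_update_one)
      then show "norm (q n A) \<le> K"
        unfolding q_def norm_scaleR using h[of n] by (simp add: inverse_eq_divide pos_divide_le_eq)
    qed
  qed auto
  then show ?thesis unfolding int using LIMSEQ_unique tendsto_const by blast
qed

end

lemma has_vector_derivative_coeff_flow:
  "((\<lambda>t. coeff (cayley_poly (rank_one_update v (cis t) ** A)) k) has_vector_derivative \<i>
    * coeff (slope_poly v A) k) (at 0)"
proof -
  have "((\<lambda>t. coeff (cayley_poly A) k + (cis t
    - 1) * coeff (slope_poly v A) k) has_vector_derivative (\<i> * cis 0) * coeff (slope_poly v A) k) (at 0)"
    by (rule derivative_eq_intros has_vector_derivative_cis refl | simp)+
  then show ?thesis by (simp add: cayley_poly_rank_one_update)
qed

lemma has_vector_derivative_slope_flow: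
  assumes "unit_vec v"
  shows "((\<lambda>t. coeff (slope_poly v (rank_one_update v (cis t) ** A)) k) has_vector_derivative \<i>
    * coeff (slope_poly v A) k) (at 0)"
proof -
  have "((\<lambda>t. cis t * coeff (slope_poly v A) k) has_vector_derivative (\<i> * cis 0)
    * coeff (slope_poly v A) k) (at 0)"
    by (rule derivative_eq_intros has_vector_derivative_cis refl | simp)+
  then show ?thesis by (simp add: slope_poly_rank_one_update[OF assms])
qed

text \<open>
  This form displays the product rule: the first summand contains the derivative of the weight, which is real.
\<close>

lemma flow_derivative_real_form:
  "\<i> * flow_derivative w w' j y y' v A =
    of_real (w' * Re (\<i> * (cnj (coeff (cayley_poly A) 0) * coeff (slope_poly v A) 0
      - cnj (coeff (slope_poly v A) 0) * coeff (cayley_poly A) 0)))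
      * (cnj (coeff (cayley_poly A) j) * y)
    + of_real w * (cnj (coeff (cayley_poly A) j) * (\<i> * y') + cnj (\<i> * coeff (slope_poly v A) j) * y)"
proof -
  let ?z = "cnj (coeff (cayley_poly A) 0) * coeff (slope_poly v A) 0
    - cnj (coeff (slope_poly v A) 0) * coeff (cayley_poly A) 0"
  have "complex_of_real (Re (\<i> * ?z)) = \<i> * ?z" by (simp add: complex_eq_iff)
  show ?thesis unfolding of_real_mult \<open>complex_of_real (Re (\<i> * ?z)) = \<i> * ?z\<close>
    by (simp add: flow_derivative_def Let_def algebra_simps)
qed

definition regular_weight :: "real \<Rightarrow> real \<Rightarrow> complex^'n^'n \<Rightarrow> real" where
  "regular_weight e \<epsilon> A = (cayley_modulus A + \<epsilon>) powr e"

lemma continuous_on_regular_weight: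
  assumes "\<epsilon> > 0"
  shows "continuous_on S (regular_weight e \<epsilon> :: complex^'n^'n \<Rightarrow> real)"
proof -
  have "cayley_modulus A + \<epsilon> \<noteq> 0" for A :: "complex^'n^'n"
    using add_nonneg_pos[OF cayley_modulus_nonneg assms, of A] by simp
  then show ?thesis unfolding regular_weight_def
    by (intro continuous_on_powr continuous_on_add continuous_on_const continuous_on_moment_density) simp
qed

definition weighted_flow ::
    "real \<Rightarrow> real \<Rightarrow> nat \<Rightarrow> (complex^'n^'n \<Rightarrow> complex) \<Rightarrow>
      (complex^'n^'n \<Rightarrow> complex) \<Rightarrow> complex^'n \<Rightarrow> complex^'n^'n \<Rightarrow> complex" where
  "weighted_flow s \<epsilon> j y y' v A =
     flow_derivative (regular_weight (s - 1) \<epsilon> A) ((s - 1) * regular_weight (s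
       - 2) \<epsilon> A) j (y A) (y' A) v A"

lemma continuous_on_weighted_flow:
  assumes "\<epsilon> > 0" "continuous_on S y" "continuous_on S y'"
  shows "continuous_on S (weighted_flow s \<epsilon> j y y' v)"
  unfolding weighted_flow_def flow_derivative_def Let_def
  by (intro continuous_intros continuous_on_regular_weight continuous_on_coeff_cayley_poly
    continuous_on_coeff_slope_poly assms)

text \<open>
  Up to the factor \<open>\<i>\<close>, this and the next sum are divergences of vector fields on the unitary group: of
  \<open>(|D|\<^sup>2 + \<epsilon>)\<^bsup>s-1\<^esup> cnj(c\<^sub>j)\<close> times the gradient of \<open>c\<^sub>k\<close>, with respect to the quadratic form given by the
  frame, and of \<open>(|D|\<^sup>2 + \<epsilon>)\<^bsup>s-1\<^esup> cnj(c\<^sub>j) c\<^sub>l\<close> times the generator of the rotations \<open>A \<mapsto> e\<^bsup>\<i>t\<^esup>A\<close>.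
\<close>

definition gradient_divergence :: "real \<Rightarrow> real \<Rightarrow> nat \<Rightarrow> nat \<Rightarrow>
  complex^'n^'n \<Rightarrow> complex" where
  "gradient_divergence s \<epsilon> j k A = frame_sum (\<lambda>v.
     weighted_flow s \<epsilon> j (\<lambda>A. coeff (slope_poly v A) k) (\<lambda>A. coeff (slope_poly v A) k) v A)"

definition rotation_divergence :: "real \<Rightarrow> real \<Rightarrow> nat \<Rightarrow> nat \<Rightarrow>
  complex^'n^'n \<Rightarrow> complex" where
  "rotation_divergence s \<epsilon> j l A = (\<Sum>a\<in>UNIV.
     weighted_flow s \<epsilon> j (\<lambda>A. coeff (cayley_poly A) l) (\<lambda>A. coeff (slope_poly (axis a 1)
       A) l) (axis a 1) A)"

context haar
begin

lemma weighted_flow_integral_eq_0: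
  assumes v: "unit_vec v" and eps: "\<epsilon> > 0"
    and y: "continuous_on unitary_group y" and y': "continuous_on unitary_group y'"
    and deriv: "\<And>A. A \<in> unitary_group \<Longrightarrow>
      ((\<lambda>t. y (rank_one_update v (cis t) ** A)) has_vector_derivative \<i> * y' A) (at 0)"
  shows "(LINT A|\<mu>. weighted_flow s \<epsilon> j y y' v A) = 0"
proof -
  let ?c = "\<lambda>k A. coeff (cayley_poly A) k" and ?b = "\<lambda>k A. coeff (slope_poly v A) k"
  define g where "g A = of_real (regular_weight (s - 1) \<epsilon> A) * (cnj (?c j A) * y A)" for A
  have "(LINT A|\<mu>. \<i> * weighted_flow s \<epsilon> j y y' v A) = 0"
  proof (rule flow_integral_eq_0[OF v])
    show "continuous_on unitary_group g" unfolding g_def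
      by (intro continuous_intros continuous_on_regular_weight continuous_on_coeff_cayley_poly y eps)
    show "continuous_on unitary_group (\<lambda>A. \<i> * weighted_flow s \<epsilon> j y y' v A)"
      by (intro continuous_intros continuous_on_weighted_flow eps y y')
    fix A :: "complex^'n^'n" assume A: "A \<in> unitary_group"
    let ?A = "\<lambda>t. rank_one_update v (cis t) ** A"
    have A0: "?A 0 = A" by (simp add: rank_one_update_one)
    note c = has_vector_derivative_coeff_flow[of v A]
    have cc: "((\<lambda>t. cnj (?c k (?A t))) has_vector_derivative cnj (\<i> * ?b k A)) (at 0)" for k
      by (rule has_vector_derivative_cnj[OF c])
    have "((\<lambda>t. cnj (?c 0 (?A t)) * ?c 0 (?A t)) has_vector_derivative
        (cnj (?c 0 (?A 0)) * (\<i> * ?b 0 A) + cnj (\<i> * ?b 0 A) * ?c 0 (?A 0))) (at 0)"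
      by (rule has_vector_derivative_mult[OF cc c])
    from bounded_linear.has_vector_derivative[OF bounded_linear_Re this]
    have "((\<lambda>t. cayley_modulus (?A t)) has_real_derivative
        Re (\<i> * (cnj (?c 0 A) * ?b 0 A - cnj (?b 0 A) * ?c 0 A))) (at 0)" (is "(_ has_real_derivative ?\<rho>) _")
      unfolding moment_density_def A0 has_real_derivative_iff_has_vector_derivative
      by (simp add: algebra_simps)
    then have m: "((\<lambda>t. cayley_modulus (?A t) + \<epsilon>) has_real_derivative ?\<rho>) (at 0)"
      by (auto intro!: derivative_eq_intros)
    have "((\<lambda>t. regular_weight (s - 1) \<epsilon> (?A t)) has_real_derivative
        ((s - 1) * regular_weight (s - 2) \<epsilon> A) * ?\<rho>) (at 0)"
    proof -
      have pos: "0 < cayley_modulus (?A 0) + \<epsilon>" using eps cayley_modulus_nonneg by (rule add_nonneg_pos[rotated])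
      show ?thesis
        unfolding regular_weight_def
        using DERIV_chain2[OF has_real_derivative_powr[OF pos, of "s - 1"] m] by (simp add: A0 rank_one_update_one)
    qed
    then have W: "((\<lambda>t. complex_of_real (regular_weight (s - 1) \<epsilon> (?A t))) has_vector_derivative
        of_real (((s - 1) * regular_weight (s - 2) \<epsilon> A) * ?\<rho>)) (at 0)"
      by (intro has_vector_derivative_of_real) (simp add: has_real_derivative_iff_has_vector_derivative)
    have "((\<lambda>t. g (?A t)) has_vector_derivative
       of_real (regular_weight (s - 1) \<epsilon> (?A 0)) * (cnj (?c j (?A 0)) * (\<i> * y' A)
         + cnj (\<i> * ?b j A) * y (?A 0))
       + of_real (((s - 1) * regular_weight (s - 2) \<epsilon> A) * ?\<rho>) * (cnj (?c j (?A 0)) * y (?A 0))) (at 0)"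
      unfolding g_def by (intro has_vector_derivative_mult W cc deriv A)
    then show "((\<lambda>t. g (?A t)) has_vector_derivative \<i> * weighted_flow s \<epsilon> j y y' v A) (at 0)"
      unfolding A0 weighted_flow_def flow_derivative_real_form by (simp add: add.commute)
  qed
  moreover have "integrable \<mu> (weighted_flow s \<epsilon> j y y' v)"
    by (intro integrable_continuous continuous_on_weighted_flow eps y y')
  ultimately show ?thesis by simp
qed

lemma gradient_integral_eq_0:
  assumes eps: "\<epsilon> > 0"
  shows "integrable \<mu> (gradient_divergence s \<epsilon> j k)" and "(LINT A|\<mu>. gradient_divergence s
    \<epsilon> j k A) = 0"
proof -
  have i: "integrable \<mu> (weighted_flow s \<epsilon> j (\<lambda>A. coeff (slope_poly v A) k) (\<lambda>A.
    coeff (slope_poly v A) k) v)" for v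
    by (intro integrable_continuous continuous_on_weighted_flow continuous_on_coeff_slope_poly eps)
  show "integrable \<mu> (gradient_divergence s \<epsilon> j k)"
    unfolding gradient_divergence_def frame_sum_def
    by (intro Bochner_Integration.integrable_sum integrable_mult_right i)
  show "(LINT A|\<mu>. gradient_divergence s \<epsilon> j k A) = 0"
    unfolding gradient_divergence_def frame_sum_def
    using weighted_flow_integral_eq_0[OF frame_vec_unit eps continuous_on_coeff_slope_poly continuous_on_coeff_slope_poly
        has_vector_derivative_slope_flow[OF frame_vec_unit]]
    by (subst Bochner_Integration.integral_sum) (simp_all add: i)
qed

lemma rotation_integral_eq_0:
  assumes eps: "\<epsilon> > 0"
  shows "integrable \<mu> (rotation_divergence s \<epsilon> j l)" and "(LINT A|\<mu>. rotation_divergence s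
    \<epsilon> j l A) = 0"
proof -
  have i: "integrable \<mu> (weighted_flow s \<epsilon> j (\<lambda>A. coeff (cayley_poly A) l) (\<lambda>A. coeff
    (slope_poly v A) l) v)" for v
    by (intro integrable_continuous continuous_on_weighted_flow continuous_on_coeff_slope_poly
        continuous_on_coeff_cayley_poly continuous_on_id eps)
  show "integrable \<mu> (rotation_divergence s \<epsilon> j l)"
    unfolding rotation_divergence_def by (intro Bochner_Integration.integrable_sum i)
  show "(LINT A|\<mu>. rotation_divergence s \<epsilon> j l A) = 0"
    unfolding rotation_divergence_def
    using weighted_flow_integral_eq_0[OF axis_unit eps continuous_on_coeff_cayley_poly[OF continuous_on_id]
        continuous_on_coeff_slope_poly has_vector_derivative_coeff_flow]
    by (subst Bochner_Integration.integral_sum) (simp_all add: i)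
qed

end

section \<open>Linear equations between the moments\<close>

context haar
begin

definition moment :: "real \<Rightarrow> nat \<Rightarrow> nat \<Rightarrow> real" where
  "moment s j k = (LINT A|\<mu>. cayley_modulus A powr (s - 1) * moment_density j k A)"

lemma integrable_weighted_density:
  fixes f :: "complex^'n^'n \<Rightarrow> real"
  assumes s: "1 / 2 < s" and f: "continuous_on unitary_group f"
  shows "integrable \<mu> (\<lambda>A. cayley_modulus A powr (s - 1) * f A)"
proof -
  obtain K where K: "K \<ge> 0" "\<And>A. A \<in> unitary_group \<Longrightarrow> norm (f A) \<le> K"
    using bounded_on_unitary_group[OF f] by blast
  have [measurable]: "f \<in> borel_measurable \<mu>" by (rule measurable_continuous[OF f])
  show ?thesis
  proof (rule Bochner_Integration.integrable_bound)
    show "integrable \<mu> (\<lambda>A. cayley_modulus A powr (s - 1) * K)"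
      using integrable_cayley_modulus_powr[OF s] by simp
    show "AE A in \<mu>. norm (cayley_modulus A powr (s - 1) * f A) \<le> norm (cayley_modulus A powr (s - 1) * K)"
      using K by (intro AE_I2) (auto simp: space_eq abs_mult intro!: mult_left_mono)
  qed measurable
qed

text \<open>
  The factor \<open>|D|\<^sup>2\<close> next to \<open>(|D|\<^sup>2 + \<epsilon>)\<^bsup>s-2\<^esup>\<close> restores the integrable power \<open>s - 1\<close>.
\<close>

lemma regularised_limit:
  fixes P Q :: "complex^'n^'n \<Rightarrow> real"
  assumes s: "1 / 2 < s"
    and P: "continuous_on unitary_group P" and Q: "continuous_on unitary_group Q"
    and eq: "\<And>\<epsilon>. \<epsilon> > 0 \<Longrightarrow>
      (LINT A|\<mu>. (s - 1) * regular_weight (s - 2) \<epsilon> A * cayley_modulus A * P A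
        + regular_weight (s - 1) \<epsilon> A * Q A) = 0"
  shows "(LINT A|\<mu>. cayley_modulus A powr (s - 1) * ((s - 1) * P A + Q A)) = 0"
proof -
  obtain KP where KP: "KP \<ge> 0" "\<And>A. A \<in> unitary_group \<Longrightarrow> norm (P A) \<le> KP"
    using bounded_on_unitary_group[OF P] by blast
  obtain KQ where KQ: "KQ \<ge> 0" "\<And>A. A \<in> unitary_group \<Longrightarrow> norm (Q A) \<le> KQ"
    using bounded_on_unitary_group[OF Q] by blast
  obtain R where R: "R \<ge> 0" "\<And>A :: complex^'n^'n. A \<in> unitary_group \<Longrightarrow>
    norm (cayley_modulus A) \<le> R"
    using bounded_on_unitary_group[OF continuous_on_moment_density] by blast
  have [measurable]: "P \<in> borel_measurable \<mu>" "Q \<in> borel_measurable \<mu>"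
    by (intro measurable_continuous P Q)+
  define e where "e n = 1 / real (Suc n)" for n
  have e: "0 < e n" "e n \<le> 1" for n by (simp_all add: e_def)
  have elim: "e \<longlonglongrightarrow> 0" unfolding e_def using LIMSEQ_inverse_real_of_nat by (simp add:
    inverse_eq_divide)
  have [measurable]: "regular_weight a (e n) \<in> borel_measurable \<mu>" for a n
    unfolding regular_weight_def by measurable
  let ?f = "\<lambda>n A. (s - 1) * regular_weight (s - 2) (e n) A * cayley_modulus A * P A
    + regular_weight (s - 1) (e n) A * Q A"
  let ?w = "\<lambda>A. (cayley_modulus A powr (s - 1) + (R + 1) powr (s - 1)) * (\<bar>s - 1\<bar> * KP + KQ)"
  have "(\<lambda>n. LINT A|\<mu>. ?f n A) \<longlonglongrightarrow> (LINT A|\<mu>. cayley_modulus A powr (s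
    - 1) * ((s - 1) * P A + Q A))"
  proof (rule integral_dominated_convergence[where w = ?w])
    show "integrable \<mu> ?w"
      using integrable_cayley_modulus_powr[OF s] by simp
    show "AE A in \<mu>. (\<lambda>n. ?f n A) \<longlonglongrightarrow> cayley_modulus A powr (s - 1) * ((s
      - 1) * P A + Q A)"
    proof (rule AE_mp[OF AE_nonsingular], rule AE_I2, rule impI)
      fix A :: "complex^'n^'n" assume pos: "0 < cayley_modulus A"
      have w: "(\<lambda>n. regular_weight a (e n) A) \<longlonglongrightarrow> cayley_modulus A powr a" for a
      proof -
        have "(\<lambda>n. (cayley_modulus A + e n) powr a) \<longlonglongrightarrow> (cayley_modulus A + 0) powr a"
          using pos elim by (intro tendsto_powr tendsto_add tendsto_const) auto
        then show ?thesis by (simp add: regular_weight_def)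
      qed
      have "(\<lambda>n. ?f n A) \<longlonglongrightarrow> (s - 1) * cayley_modulus A powr (s
        - 2) * cayley_modulus A * P A + cayley_modulus A powr (s - 1) * Q A"
        by (intro tendsto_intros w)
      moreover have "cayley_modulus A powr (s - 2) * cayley_modulus A = cayley_modulus A powr (s - 1)"
        using pos powr_add[of "cayley_modulus A" "s - 2" 1] by simp
      ultimately show "(\<lambda>n. ?f n A) \<longlonglongrightarrow> cayley_modulus A powr (s - 1) * ((s - 1) * P A + Q A)"
        by (simp add: algebra_simps)
    qed
    show "AE A in \<mu>. norm (?f n A) \<le> ?w A" for n
    proof (rule AE_mp[OF AE_nonsingular], rule AE_I2, rule impI)
      fix A :: "complex^'n^'n" assume "A \<in> space \<mu>" and pos: "0 < cayley_modulus A"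
      then have A: "A \<in> unitary_group" by (simp add: space_eq)
      let ?r = "cayley_modulus A"
      have W: "regular_weight (s - 1) (e n) A \<le> ?r powr (s - 1) + (R + 1) powr (s - 1)"
      proof (cases "s \<ge> 1")
        case True
        have "(?r + e n) powr (s - 1) \<le> (R + 1) powr (s - 1)"
          using True R(2)[OF A] pos e[of n] by (intro powr_mono2) auto
        then show ?thesis by (simp add: regular_weight_def add_increasing)
      next
        case False
        have "(?r + e n) powr (s - 1) \<le> ?r powr (s - 1)"
          using False pos e[of n] by (intro powr_mono2') auto
        then show ?thesis by (simp add: regular_weight_def add_increasing2)
      qed
      have V: "regular_weight (s - 2) (e n) A * ?r \<le> regular_weight (s - 1) (e n) A"
      proof -
        have "(?r + e n) powr (s - 2) * ?r \<le> (?r + e n) powr (s - 2) * (?r + e n)"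
          using e[of n] by (intro mult_left_mono) auto
        also have "\<dots> = (?r + e n) powr (s - 1)"
          using pos e[of n] powr_add[of "?r + e n" "s - 2" 1] by simp
        finally show ?thesis by (simp add: regular_weight_def)
      qed
      have nonneg: "0 \<le> regular_weight a (e n) A" for a by (simp add: regular_weight_def)
      have "norm (?f n A) \<le> (regular_weight (s - 2) (e n) A * ?r) * (\<bar>s - 1\<bar> * \<bar>P A\<bar>)
        + regular_weight (s - 1) (e n) A * \<bar>Q A\<bar>"
        using abs_triangle_ineq[of "(s - 1) * regular_weight (s - 2) (e n) A * cayley_modulus A * P A"
            "regular_weight (s - 1) (e n) A * Q A"] nonneg pos
        by (simp add: abs_mult mult_ac)
      also have "\<dots> \<le> regular_weight (s - 1) (e n) A * (\<bar>s - 1\<bar> * KP)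
        + regular_weight (s - 1) (e n) A * KQ"
        using KP(2)[OF A] KQ(2)[OF A] nonneg by (intro add_mono mult_mono V) auto
      also have "\<dots> = regular_weight (s - 1) (e n) A * (\<bar>s - 1\<bar> * KP + KQ)"
        by (simp add: distrib_left)
      also have "\<dots> \<le> ?w A"
        using KP KQ by (intro mult_right_mono W) auto
      finally show "norm (?f n A) \<le> ?w A" .
    qed
  qed measurable
  then show ?thesis unfolding eq[OF e(1)] using LIMSEQ_unique tendsto_const by blast
qed

lemma AE_nonsingular_unitary: "AE A in \<mu>. nonsingular_unitary A (real CARD('n))"
proof (rule AE_mp[OF AE_nonsingular], rule AE_I2, rule impI)
  fix A assume "A \<in> space \<mu>" "0 < cayley_modulus A"
  then show "nonsingular_unitary A (real CARD('n))"
    by unfold_locales (auto simp: space_eq moment_density_def)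
qed

lemma integral_moment_combination:
  assumes s: "1 / 2 < s"
  shows "(LINT A|\<mu>. cayley_modulus A powr (s - 1) *
      (c00 * moment_density 0 0 A + c11 * moment_density 1 1 A + c02 * moment_density 0 2 A
       + c13 * moment_density 1 3 A + c04 * moment_density 0 4 A + c22 * moment_density 2 2 A))
    = c00 * moment s 0 0 + c11 * moment s 1 1 + c02 * moment s 0 2
       + c13 * moment s 1 3 + c04 * moment s 0 4 + c22 * moment s 2 2"
proof -
  have i: "integrable \<mu> (\<lambda>A. cayley_modulus A powr (s - 1) * moment_density j k A)" for j k
    by (intro integrable_weighted_density s continuous_on_moment_density)
  have "cayley_modulus A powr (s - 1) *
      (c00 * moment_density 0 0 A + c11 * moment_density 1 1 A + c02 * moment_density 0 2 A
       + c13 * moment_density 1 3 A + c04 * moment_density 0 4 A + c22 * moment_density 2 2 A)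
    = c00 * (cayley_modulus A powr (s - 1) * moment_density 0 0 A)
      + c11 * (cayley_modulus A powr (s - 1) * moment_density 1 1 A)
      + c02 * (cayley_modulus A powr (s - 1) * moment_density 0 2 A)
      + c13 * (cayley_modulus A powr (s - 1) * moment_density 1 3 A)
      + c04 * (cayley_modulus A powr (s - 1) * moment_density 0 4 A)
      + c22 * (cayley_modulus A powr (s - 1) * moment_density 2 2 A)"
    for A :: "complex^'n^'n" by (simp add: algebra_simps)
  then show ?thesis unfolding moment_def
    by (simp only: Bochner_Integration.integral_add Bochner_Integration.integrable_add i integrable_mult_right
      integral_mult_right_zero)
qed

text \<open>
  The function \<open>P\<close> collects the terms with the derivative of the weight, \<open>Q\<close> those with the weight itself.
  In the limit the derivative contributes the factor \<open>s - 1\<close>.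
\<close>

lemma moment_equation:
  fixes F :: "real \<Rightarrow> complex^'n^'n \<Rightarrow> real"
  assumes s: "1 / 2 < s"
    and int: "\<And>\<epsilon>. \<epsilon> > 0 \<Longrightarrow> (LINT A|\<mu>. F \<epsilon> A) = 0"
    and meas: "\<And>\<epsilon>. \<epsilon> > 0 \<Longrightarrow> F \<epsilon> \<in> borel_measurable \<mu>"
    and eq: "\<And>\<epsilon> A. \<epsilon> > 0 \<Longrightarrow> nonsingular_unitary A (real CARD('n)) \<Longrightarrow>
      F \<epsilon> A = (s - 1) * regular_weight (s - 2) \<epsilon> A * cayley_modulus A * P A
        + regular_weight (s - 1) \<epsilon> A * Q A"
    and P: "continuous_on unitary_group P" and Q: "continuous_on unitary_group Q"
    and comb: "\<And>A. (s - 1) * P A + Q A = c00 * moment_density 0 0 A + c11 * moment_density 1 1 A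
      + c02 * moment_density 0 2 A
       + c13 * moment_density 1 3 A + c04 * moment_density 0 4 A + c22 * moment_density 2 2 A"
  shows "c00 * moment s 0 0 + c11 * moment s 1 1 + c02 * moment s 0 2
       + c13 * moment s 1 3 + c04 * moment s 0 4 + c22 * moment s 2 2 = 0"
proof -
  have "(LINT A|\<mu>. cayley_modulus A powr (s - 1) * ((s - 1) * P A + Q A)) = 0"
  proof (rule regularised_limit[OF s P Q])
    fix \<epsilon> :: real assume eps: "\<epsilon> > 0"
    let ?G = "\<lambda>A. (s - 1) * regular_weight (s - 2) \<epsilon> A * cayley_modulus A * P A
      + regular_weight (s - 1) \<epsilon> A * Q A"
    have "continuous_on unitary_group ?G"
      by (intro continuous_intros continuous_on_regular_weight continuous_on_moment_density P Q eps)
    then have G: "?G \<in> borel_measurable \<mu>" by (rule measurable_continuous)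
    have "(LINT A|\<mu>. ?G A) = (LINT A|\<mu>. F \<epsilon> A)"
    proof (rule integral_cong_AE[OF G meas[OF eps]])
      show "AE A in \<mu>. ?G A = F \<epsilon> A"
        using AE_nonsingular_unitary by eventually_elim (rule eq[OF eps, symmetric])
    qed
    then show "(LINT A|\<mu>. ?G A) = 0" using int[OF eps] by simp
  qed
  then show ?thesis unfolding comb integral_moment_combination[OF s] .
qed

lemma Re_gradient_integral:
  assumes eps: "\<epsilon> > 0"
  shows "integrable \<mu> (\<lambda>A. Re (gradient_divergence s \<epsilon> j k A))" and "(LINT A|\<mu>. Re
    (gradient_divergence s \<epsilon> j k A)) = 0"
  using gradient_integral_eq_0[OF eps, of s j k] by simp_all

lemma Im_rotation_integral:
  assumes eps: "\<epsilon> > 0"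
  shows "integrable \<mu> (\<lambda>A. Im (rotation_divergence s \<epsilon> j l A))" and "(LINT A|\<mu>. Im
    (rotation_divergence s \<epsilon> j l A)) = 0"
  using rotation_integral_eq_0[OF eps, of s j l] by simp_all

text \<open>
  The five equations come from the test functions \<open>cnj(c\<^sub>0) b\<^sub>v\<^sub>,\<^sub>0\<close>, \<open>cnj(c\<^sub>0) b\<^sub>v\<^sub>,\<^sub>2\<close>, \<open>cnj(c\<^sub>1) c\<^sub>0\<close>, \<open>cnj(c\<^sub>3) c\<^sub>0\<close> and
  from the combination of \<open>cnj(c\<^sub>2) b\<^sub>v\<^sub>,\<^sub>0\<close> with \<open>cnj(c\<^sub>2) c\<^sub>1\<close>.
\<close>

lemma moment_gradient_00:
  assumes s: "1 / 2 < s" and N: "N = real CARD('n)"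
  shows "N * (N + 1) / 4 * moment s 0 0 + (1 / 2 - s) * moment s 1 1 + (s - 1 / 2) * moment s 0 2 = 0"
proof -
  define P Q :: "complex^'n^'n \<Rightarrow> real"
    where "P = (\<lambda>A. moment_density 0 2 A - moment_density 1 1 A)"
      and "Q = (\<lambda>A. (N * (N + 1) / 2 * moment_density 0 0 A - moment_density 1 1 A + moment_density 0 2 A) / 2)"
  define F where "F = (\<lambda>\<epsilon> (A :: complex^'n^'n). Re (gradient_divergence s \<epsilon> 0 0 A))"
  have F: "integrable \<mu> (F \<epsilon>)" "(LINT A|\<mu>. F \<epsilon> A) = 0" if "\<epsilon> > 0" for \<epsilon>
    using Re_gradient_integral[OF that] unfolding F_def by simp_all
  have "N * (N + 1) / 4 * moment s 0 0 + (1 / 2 - s) * moment s 1 1 + (s - 1 / 2) * moment s 0 2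
      + 0 * moment s 1 3 + 0 * moment s 0 4 + 0 * moment s 2 2 = 0"
  proof (rule moment_equation[OF s F(2) borel_measurable_integrable[OF F(1)], where P = P and Q = Q])
    fix \<epsilon> :: real and A :: "complex^'n^'n" assume "nonsingular_unitary A (real CARD('n))"
    then interpret nonsingular_unitary A N unfolding N .
    show "F \<epsilon> A = (s - 1) * regular_weight (s - 2) \<epsilon> A * cayley_modulus A * P A
      + regular_weight (s - 1) \<epsilon> A * Q A"
      unfolding F_def gradient_divergence_def rotation_divergence_def weighted_flow_def Re_gradient_00 P_def Q_def
      by (simp add: field_simps)
  next
    show "continuous_on unitary_group P" "continuous_on unitary_group Q"
      unfolding P_def Q_def by (intro continuous_intros continuous_on_moment_density; simp)+
  qed (simp_all add: P_def Q_def field_simps)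
  then show ?thesis by simp
qed

lemma moment_gradient_02:
  assumes s: "1 / 2 < s" and N: "N = real CARD('n)"
  shows "(s - 1 / 2) * ((N - 1) / 2) * moment s 1 1 + (N * (N + 1) / 4 + (s - 1 / 2)) * moment s 0 2
    + (1 - 2 * s) * moment s 1 3
      + (2 * s - 1) * moment s 0 4 = 0"
proof -
  define P Q :: "complex^'n^'n \<Rightarrow> real"
    where "P = (\<lambda>A. - 2 * moment_density 1 3 A + (N - 1) / 2 * moment_density 1 1 A
      + moment_density 0 2 A + 2 * moment_density 0 4 A)"
      and "Q = (\<lambda>A. (N * (N + 1) / 2 * moment_density 0 2 A - 2 * moment_density 1 3 A
        + (N - 1) / 2 * moment_density 1 1 A + moment_density 0 2 A + 2 * moment_density 0 4 A) / 2)"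
  define F where "F = (\<lambda>\<epsilon> (A :: complex^'n^'n). Re (gradient_divergence s \<epsilon> 0 2 A))"
  have F: "integrable \<mu> (F \<epsilon>)" "(LINT A|\<mu>. F \<epsilon> A) = 0" if "\<epsilon> > 0" for \<epsilon>
    using Re_gradient_integral[OF that] unfolding F_def by simp_all
  have "0 * moment s 0 0 + (s - 1 / 2) * ((N - 1) / 2) * moment s 1 1 + (N * (N + 1) / 4 + (s - 1 / 2)) * moment s 0 2
      + (1 - 2 * s) * moment s 1 3 + (2 * s - 1) * moment s 0 4 + 0 * moment s 2 2 = 0"
  proof (rule moment_equation[OF s F(2) borel_measurable_integrable[OF F(1)], where P = P and Q = Q])
    fix \<epsilon> :: real and A :: "complex^'n^'n" assume "nonsingular_unitary A (real CARD('n))"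
    then interpret nonsingular_unitary A N unfolding N .
    show "F \<epsilon> A = (s - 1) * regular_weight (s - 2) \<epsilon> A * cayley_modulus A * P A
      + regular_weight (s - 1) \<epsilon> A * Q A"
      unfolding F_def gradient_divergence_def rotation_divergence_def weighted_flow_def Re_gradient_02 P_def Q_def
      by (simp add: field_simps)
  next
    show "continuous_on unitary_group P" "continuous_on unitary_group Q"
      unfolding P_def Q_def by (intro continuous_intros continuous_on_moment_density; simp)+
  qed (simp_all add: P_def Q_def field_simps)
  then show ?thesis by simp
qed

lemma moment_rotation_10:
  assumes s: "1 / 2 < s" and N: "N = real CARD('n)"
  shows "(- N / 2) * moment s 0 0 + (s - 1 / 2) * moment s 1 1 + 1 * moment s 0 2 = 0"
proof -
  define P Q :: "complex^'n^'n \<Rightarrow> real"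
    where "P = (\<lambda>A. moment_density 1 1 A)"
      and "Q = (\<lambda>A. (moment_density 1 1 A + 2 * moment_density 0 2 A - N * moment_density 0 0 A) / 2)"
  define F where "F = (\<lambda>\<epsilon> (A :: complex^'n^'n). Im (rotation_divergence s \<epsilon> 1 0 A))"
  have F: "integrable \<mu> (F \<epsilon>)" "(LINT A|\<mu>. F \<epsilon> A) = 0" if "\<epsilon> > 0" for \<epsilon>
    using Im_rotation_integral[OF that] unfolding F_def by simp_all
  have "(- N / 2) * moment s 0 0 + (s - 1 / 2) * moment s 1 1 + 1 * moment s 0 2
      + 0 * moment s 1 3 + 0 * moment s 0 4 + 0 * moment s 2 2 = 0"
  proof (rule moment_equation[OF s F(2) borel_measurable_integrable[OF F(1)], where P = P and Q = Q])
    fix \<epsilon> :: real and A :: "complex^'n^'n" assume "nonsingular_unitary A (real CARD('n))"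
    then interpret nonsingular_unitary A N unfolding N .
    show "F \<epsilon> A = (s - 1) * regular_weight (s - 2) \<epsilon> A * cayley_modulus A * P A
      + regular_weight (s - 1) \<epsilon> A * Q A"
      unfolding F_def gradient_divergence_def rotation_divergence_def weighted_flow_def Im_rotation_10 P_def Q_def
      by (simp add: field_simps)
  next
    show "continuous_on unitary_group P" "continuous_on unitary_group Q"
      unfolding P_def Q_def by (intro continuous_intros continuous_on_moment_density; simp)+
  qed (simp_all add: P_def Q_def field_simps)
  then show ?thesis by simp
qed

lemma moment_rotation_30:
  assumes s: "1 / 2 < s" and N: "N = real CARD('n)"
  shows "(1 - N / 2) * moment s 0 2 + (s - 1 / 2) * moment s 1 3 + 2 * moment s 0 4 = 0"
proof -
  define P Q :: "complex^'n^'n \<Rightarrow> real"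
    where "P = (\<lambda>A. moment_density 1 3 A)"
      and "Q = (\<lambda>A. (moment_density 1 3 A + 4 * moment_density 0 4 A - (N - 2) * moment_density 0 2 A) / 2)"
  define F where "F = (\<lambda>\<epsilon> (A :: complex^'n^'n). Im (rotation_divergence s \<epsilon> 3 0 A))"
  have F: "integrable \<mu> (F \<epsilon>)" "(LINT A|\<mu>. F \<epsilon> A) = 0" if "\<epsilon> > 0" for \<epsilon>
    using Im_rotation_integral[OF that] unfolding F_def by simp_all
  have "0 * moment s 0 0 + 0 * moment s 1 1 + (1 - N / 2) * moment s 0 2
      + (s - 1 / 2) * moment s 1 3 + 2 * moment s 0 4 + 0 * moment s 2 2 = 0"
  proof (rule moment_equation[OF s F(2) borel_measurable_integrable[OF F(1)], where P = P and Q = Q])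
    fix \<epsilon> :: real and A :: "complex^'n^'n" assume "nonsingular_unitary A (real CARD('n))"
    then interpret nonsingular_unitary A N unfolding N .
    show "F \<epsilon> A = (s - 1) * regular_weight (s - 2) \<epsilon> A * cayley_modulus A * P A
      + regular_weight (s - 1) \<epsilon> A * Q A"
      unfolding F_def gradient_divergence_def rotation_divergence_def weighted_flow_def Im_rotation_30 P_def Q_def
      by (simp add: field_simps)
  next
    show "continuous_on unitary_group P" "continuous_on unitary_group Q"
      unfolding P_def Q_def by (intro continuous_intros continuous_on_moment_density; simp)+
  qed (simp_all add: P_def Q_def field_simps)
  then show ?thesis by simp
qed

lemma moment_gradient_20_rotation_21:
  assumes s: "1 / 2 < s" and N: "N = real CARD('n)"
  shows "(1 - N) / 4 * moment s 1 1 + (N * (N - 1) / 4 + 1 / 2) * moment s 0 2 + 1 / 2 * moment s 1 3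
      + 1 * moment s 0 4 + s * moment s 2 2 = 0"
proof -
  define P Q :: "complex^'n^'n \<Rightarrow> real"
    where "P = (\<lambda>A. moment_density 2 2 A)"
      and "Q = (\<lambda>A. (2 * moment_density 2 2 A + moment_density 1 3 A - (N
        - 1) / 2 * moment_density 1 1 A + (N * (N - 1) / 2 + 1) * moment_density 0 2 A + 2 * moment_density 0 4 A) / 2)"
  define F where "F = (\<lambda>\<epsilon> (A :: complex^'n^'n). Re (gradient_divergence s \<epsilon> 2 0 A)
    + Im (rotation_divergence s \<epsilon> 2 1 A))"
  have F: "integrable \<mu> (F \<epsilon>)" "(LINT A|\<mu>. F \<epsilon> A) = 0" if "\<epsilon> > 0" for \<epsilon>
    using Re_gradient_integral[OF that] Im_rotation_integral[OF that] unfolding F_def by simp_all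
  have "0 * moment s 0 0 + (1 - N) / 4 * moment s 1 1 + (N * (N - 1) / 4 + 1 / 2) * moment s 0 2
      + 1 / 2 * moment s 1 3 + 1 * moment s 0 4 + s * moment s 2 2 = 0"
  proof (rule moment_equation[OF s F(2) borel_measurable_integrable[OF F(1)], where P = P and Q = Q])
    fix \<epsilon> :: real and A :: "complex^'n^'n" assume "nonsingular_unitary A (real CARD('n))"
    then interpret nonsingular_unitary A N unfolding N .
    show "F \<epsilon> A = (s - 1) * regular_weight (s - 2) \<epsilon> A * cayley_modulus A * P A
      + regular_weight (s - 1) \<epsilon> A * Q A"
      unfolding F_def gradient_divergence_def rotation_divergence_def weighted_flow_def Re_gradient_20_rotation_21
        P_def Q_def
      by (simp add: field_simps)
  next
    show "continuous_on unitary_group P" "continuous_on unitary_group Q"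
      unfolding P_def Q_def by (intro continuous_intros continuous_on_moment_density; simp)+
  qed (simp_all add: P_def Q_def field_simps)
  then show ?thesis by simp
qed

end

section \<open>Eigenvalues and derivatives of Z\<close>

lemma coeff_prod_linear:
  fixes f :: "'i \<Rightarrow> 'a::comm_semiring_1 poly"
  assumes "finite I" "\<And>i. i \<in> I \<Longrightarrow> degree (f i) \<le> 1"
  shows "degree (\<Prod>i\<in>I. f i) \<le> card I \<and> coeff (\<Prod>i\<in>I. f i) (card I)
    = (\<Prod>i\<in>I. coeff (f i) 1)"
  using assms
proof (induction I rule: finite_induct)
  case (insert i I)
  let ?P = "\<Prod>i\<in>I. f i"
  have IH: "degree ?P \<le> card I" "coeff ?P (card I) = (\<Prod>i\<in>I. coeff (f i) 1)"
    using insert by auto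
  have fi: "degree (f i) \<le> 1" using insert by auto
  have "degree (f i * ?P) \<le> Suc (card I)"
    using degree_mult_le[of "f i" ?P] IH(1) fi by linarith
  moreover have "coeff (f i * ?P) (Suc (card I)) = coeff (f i) 1 * coeff ?P (card I)"
  proof -
    have "coeff (f i * ?P) (Suc (card I)) = (\<Sum>j\<le>Suc (card I). coeff (f i) j * coeff ?P (Suc (card I) - j))"
      by (rule coeff_mult)
    also have "\<dots> = (\<Sum>j\<in>{1}. coeff (f i) j * coeff ?P (Suc (card I) - j))"
    proof (rule sum.mono_neutral_right)
      show "\<forall>j\<in>{..Suc (card I)} - {1}. coeff (f i) j * coeff ?P (Suc (card I) - j) = 0"
      proof
        fix j assume "j \<in> {..Suc (card I)} - {1}"
        then consider "j = 0" | "j > 1" by force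
        then show "coeff (f i) j * coeff ?P (Suc (card I) - j) = 0"
          by cases (use fi IH(1) in \<open>auto simp: coeff_eq_0\<close>)
      qed
    qed auto
    finally show ?thesis by simp
  qed
  ultimately show ?case using insert(1,2) IH(2) by simp
qed simp

text \<open>
  The entries have degree at most one, so the coefficient of degree \<open>N\<close> is the determinant of the matrix of
  linear coefficients, which is the identity.
\<close>

lemma charpoly_monic:
  fixes A :: "complex^'n^'n"
  shows "degree (charpoly A) = CARD('n)" and "lead_coeff (charpoly A) = 1"
proof -
  let ?M = "\<chi> i j. (if i = j then [:0, 1:] else 0) - [:A $ i $ j:]"
  have d: "degree (?M $ i $ j) \<le> 1" and c: "coeff (?M $ i $ j) 1 = mat 1 $ i $ j" for i j
    by (auto simp: mat_def intro!: degree_diff_le)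
  have p: "degree (\<Prod>i\<in>UNIV. ?M $ i $ p i) \<le> CARD('n)"
    "coeff (\<Prod>i\<in>UNIV. ?M $ i $ p i) CARD('n) = (\<Prod>i\<in>UNIV. mat 1 $ i $ p i)" for p :: "'n \<Rightarrow> 'n"
    using coeff_prod_linear[of UNIV "\<lambda>i. ?M $ i $ p i"] d c by auto
  have sg: "degree (of_int (sign p) * q) \<le> degree q" "coeff (of_int (sign p) * q) k = of_int (sign p) * coeff q k"
    for p :: "'n \<Rightarrow> 'n" and q :: "complex poly" and k
    by (cases p rule: sign_cases; simp)+
  have "degree (charpoly A) \<le> CARD('n)"
    unfolding charpoly_def det_def by (intro degree_sum_le finite_permutations finite order_trans[OF sg(1) p(1)])
  moreover have "coeff (charpoly A) CARD('n) = det (mat 1 :: complex^'n^'n)"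
    unfolding charpoly_def det_def coeff_sum sg(2) p(2) ..
  then have "coeff (charpoly A) CARD('n) = 1" by simp
  ultimately show "degree (charpoly A) = CARD('n)" by (metis le_antisym le_degree zero_neq_one)
  with \<open>coeff (charpoly A) CARD('n) = 1\<close> show "lead_coeff (charpoly A) = 1" by simp
qed

lemma poly_charpoly: "poly (charpoly A) x = det (\<chi> i j. x * mat 1 $ i $ j - A $ i $ j)"
  unfolding charpoly_def poly_det
  by (rule arg_cong[where f = det]) (simp add: vec_eq_iff mat_def)

lemma poly_charpoly_roots:
  fixes A :: "complex^'n^'n"
  shows "poly (charpoly A) x = (\<Prod>z\<in>#proots (charpoly A). x - z)"
proof -
  have "poly (charpoly A) x = poly (\<Prod>z\<in>#proots (charpoly A). [:-z, 1:]) x"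
    using complex_poly_decompose_multiset[of "charpoly A"] charpoly_monic(2)[of A] by simp
  then show ?thesis by (simp add: poly_prod_mset image_mset.compositionality o_def)
qed

lemma power_size_mult_prod_mset:
  fixes q :: "'a::field"
  assumes "q \<noteq> 0"
  shows "q ^ size L * (\<Prod>z\<in>#L. p / q - f z) = (\<Prod>z\<in>#L. p - q * f z)"
proof (induction L)
  case (add x L)
  have "q ^ size (add_mset x L) * (\<Prod>z\<in>#add_mset x L. p / q - f z)
    = (q * (p / q - f x)) * (q ^ size L * (\<Prod>z\<in>#L. p / q - f z))" by (simp add: mult_ac)
  also have "q * (p / q - f x) = p - q * f x" using assms by (simp add: field_simps)
  finally show ?case using add by simp
qed simp

lemma size_proots_charpoly: "size (proots (charpoly A)) = CARD('n)" for A :: "complex^'n^'n"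
  by (simp add: size_proots_complex charpoly_monic)

text \<open>
  Homogeneity: \<open>det(p - qA) = q\<^sup>N det(p/q - A)\<close>.
\<close>

lemma cayley_poly_roots:
  fixes A :: "complex^'n^'n"
  shows "poly (cayley_poly A) u = (\<Prod>z\<in>#proots (charpoly A). (1 - z) + \<i> * (1 + z) * u)"
proof -
  let ?L = "proots (charpoly A)"
  have poly_R: "poly (\<Prod>z\<in>#?L. [:1 - z, \<i> * (1 + z):]) u = (\<Prod>z\<in>#?L. (1 - z) + \<i> * (1
    + z) * u)" for u
    by (simp add: poly_prod_mset image_mset.compositionality o_def mult_ac)
  have "cayley_poly A = (\<Prod>z\<in>#?L. [:1 - z, \<i> * (1 + z):])"
  proof (rule poly_eqI_outside_finite[of "{-\<i>}"])
    \<comment> \<open>Here the factor \<open>1 - \<i>u\<close> of \<open>A\<close> does not vanish.\<close>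
    fix u assume u: "u \<notin> {-\<i>}"
    define p where "p = 1 + \<i> * u"
    define q where "q = 1 - \<i> * u"
    have q: "q \<noteq> 0" using u by (auto simp: q_def complex_eq_iff)
    have "cayley_matrix A u = (\<chi> i. q *s (\<chi> j. (p / q) * mat 1 $ i $ j - A $ i $ j))"
      using q by (simp add: vec_eq_iff cayley_matrix_def p_def[symmetric] q_def[symmetric] right_diff_distrib)
    then have "poly (cayley_poly A) u = det (\<chi> i. q *s (\<chi> j. (p / q) * mat 1 $ i $ j - A $ i $ j))"
      unfolding poly_cayley_poly by (rule arg_cong)
    also have "\<dots> = (\<Prod>i\<in>(UNIV::'n set). q) * det (\<chi> i. \<chi> j. (p / q) * mat 1 $ i $ j - A $ i $ j)"
      by (rule det_rows_mul)
    also have "\<dots> = q ^ size ?L * (\<Prod>z\<in>#?L. p / q - z)"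
      by (simp add: size_proots_charpoly poly_charpoly_roots[symmetric] poly_charpoly)
    also have "\<dots> = (\<Prod>z\<in>#?L. p - q * z)"
      by (rule power_size_mult_prod_mset[OF q])
    also have "\<dots> = (\<Prod>z\<in>#?L. (1 - z) + \<i> * (1 + z) * u)"
      by (rule arg_cong[where f = prod_mset], rule image_mset_cong) (simp add: p_def q_def algebra_simps)
    finally show "poly (cayley_poly A) u = poly (\<Prod>z\<in>#?L. [:1 - z, \<i> * (1 + z):]) u"
      unfolding poly_R .
  qed auto
  then show ?thesis using poly_R by simp
qed

lemma unitary_eigenvalue_norm:
  fixes A :: "complex^'n^'n"
  assumes A: "A \<in> unitary_group" and z: "z \<in># proots (charpoly A)"
  shows "cmod z = 1"
proof -
  let ?M = "\<chi> i j. z * mat 1 $ i $ j - A $ i $ j"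
  have "charpoly A \<noteq> 0" using z by auto
  then have "det ?M = 0" using z by (simp add: poly_charpoly[symmetric])
  then have "\<not> invertible ?M" by (simp add: invertible_det_nz)
  then have "\<not> (\<exists>B. B ** ?M = mat 1)" by (simp add: invertible_left_inverse)
  then obtain x where x: "?M *v x = 0" "x \<noteq> 0" unfolding matrix_left_invertible_ker by blast
  have Ax: "(\<Sum>j\<in>UNIV. A $ i $ j * x $ j) = z * x $ i" for i
  proof -
    have "(?M *v x) $ i = (\<Sum>j\<in>UNIV. mat 1 $ i $ j * (z * x $ j)) - (\<Sum>j\<in>UNIV. A $ i $ j * x $ j)"
      by (simp add: matrix_vector_mult_def algebra_simps sum_subtractf)
    then show ?thesis using x(1) by (simp add: sum_mat_1_left)
  qed
  have "(\<Sum>i\<in>UNIV. cnj (z * x $ i) * (z * x $ i))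
    = (\<Sum>i\<in>UNIV. cnj (\<Sum>j\<in>UNIV. A $ i $ j * x $ j) * (\<Sum>k\<in>UNIV. A $ i $ k * x $ k))"
    by (simp add: Ax)
  also have "\<dots> = (\<Sum>i\<in>UNIV. \<Sum>j\<in>UNIV. \<Sum>k\<in>UNIV. cnj (x $ j) * x $ k
    * (cnj (A $ i $ j) * A $ i $ k))"
    unfolding cnj_sum sum_product by (intro sum.cong refl) (simp add: mult_ac)
  also have "\<dots> = (\<Sum>j\<in>UNIV. \<Sum>k\<in>UNIV. \<Sum>i\<in>UNIV. cnj (x $ j) * x $ k
    * (cnj (A $ i $ j) * A $ i $ k))"
    by (subst sum.swap, rule sum.cong[OF refl], rule sum.swap)
  also have "\<dots> = (\<Sum>j\<in>UNIV. \<Sum>k\<in>UNIV. cnj (x $ j) * x $ k * (adjoint_matrix A ** A) $ j $ k)"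
    by (simp add: sum_distrib_left[symmetric] matrix_matrix_mult_def adjoint_matrix_nth)
  also have "adjoint_matrix A ** A = mat 1" using A by (simp add: unitary_group_def)
  also have "(\<Sum>j\<in>UNIV. \<Sum>k\<in>UNIV. cnj (x $ j) * x $ k * mat 1 $ j $ k)
    = (\<Sum>j\<in>UNIV. cnj (x $ j) * x $ j)"
  proof (rule sum.cong[OF refl])
    fix j
    show "(\<Sum>k\<in>UNIV. cnj (x $ j) * x $ k * mat 1 $ j $ k) = cnj (x $ j) * x $ j"
      using sum_mat_1_left[of j "\<lambda>k. cnj (x $ j) * x $ k"] by (simp add: mult_ac)
  qed
  finally have "cnj z * z * (\<Sum>i\<in>UNIV. cnj (x $ i) * x $ i) = (\<Sum>i\<in>UNIV. cnj (x $ i) * x $ i)"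
    by (simp add: sum_distrib_left mult_ac)
  moreover have "(\<Sum>i\<in>UNIV. cnj (x $ i) * x $ i) \<noteq> 0"
  proof
    assume 0: "(\<Sum>i\<in>UNIV. cnj (x $ i) * x $ i) = 0"
    have e: "(\<Sum>i\<in>UNIV. cnj (x $ i) * x $ i) = of_real (\<Sum>i\<in>UNIV. (cmod (x $ i))\<^sup>2)"
      unfolding of_real_sum complex_norm_square by (simp add: mult.commute)
    have "(\<Sum>i\<in>UNIV. (cmod (x $ i))\<^sup>2) = 0"
      using 0 unfolding e by (rule of_real_eq_0_iff[THEN iffD1])
    then have "x = 0" by (simp add: sum_nonneg_eq_0_iff vec_eq_iff)
    then show False using x(2) by simp
  qed
  ultimately have "cnj z * z = 1" by simp
  then have "complex_of_real ((cmod z)\<^sup>2) = of_real 1"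
    unfolding complex_norm_square by (simp add: mult.commute)
  then have "(cmod z)\<^sup>2 = 1" by (simp only: of_real_eq_iff)
  then show ?thesis using norm_ge_zero[of z] by (auto simp: power2_eq_1_iff simp del: norm_ge_zero)
qed

text \<open>
  Each factor \<open>1 - z e\<^bsup>-\<i>\<theta>\<^esup>\<close> takes a factor \<open>e\<^bsup>\<i>\<theta>/2\<^esup>\<close> from the exponential in front, which turns it into
  \<open>(1 - z) cos(\<theta>/2) + \<i>(1 + z) sin(\<theta>/2)\<close>.
\<close>

lemma Z_eq:
  fixes A :: "complex^'n^'n"
  assumes A: "A \<in> unitary_group"
  obtains K where "cmod K = 1"
    and "\<And>\<theta>. \<bar>\<theta>\<bar> < pi \<Longrightarrow> Z A \<theta>
      = K * (of_real (cos (\<theta> / 2) ^ CARD('n)) * poly (cayley_poly A) (of_real (tan (\<theta> / 2))))"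
proof -
  let ?L = "proots (charpoly A)"
  define K where "K = exp (\<i> * of_real (real CARD('n) * pi / 2 - (\<Sum>\<phi>\<in>#eigenangles A. \<phi> / 2)))"
  have ofr: "(\<Sum>\<phi>\<in>#M. complex_of_real \<phi> / 2) = of_real (\<Sum>\<phi>\<in>#M. \<phi> / 2)" for M
    by (induction M) simp_all
  show ?thesis
  proof (rule that[of K])
    show "cmod K = 1" unfolding K_def by (rule norm_exp_i_times)
    fix \<theta> :: real assume th: "\<bar>\<theta>\<bar> < pi"
    have cos: "cos (\<theta> / 2) \<noteq> 0" using th by (intro less_imp_neq[THEN not_sym] cos_gt_zero_pi) (auto
      simp: abs_less_iff)
    have eq1: "(\<Prod>\<phi>\<in>#eigenangles A. 1 - exp (\<i> * of_real (\<phi> - \<theta>)))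
      = (\<Prod>z\<in>#?L. 1 - z * exp (- \<i> * of_real \<theta>))"
      unfolding eigenangles_def image_mset.compositionality o_def
    proof (rule arg_cong[where f = prod_mset], rule image_mset_cong)
      fix z assume "z \<in># ?L"
      then have "z = exp (\<i> * of_real (Arg2pi z))"
        using Arg2pi_eq[of z] unitary_eigenvalue_norm[OF A, of z] by simp
      then show "1 - exp (\<i> * of_real (Arg2pi z - \<theta>)) = 1 - z * exp (- \<i> * of_real \<theta>)"
        by (simp add: right_diff_distrib exp_diff exp_minus field_simps)
    qed
    have fac: "exp (\<i> * of_real (\<theta> / 2)) * (1 - z * exp (- \<i> * of_real \<theta>))
       = of_real (cos (\<theta> / 2)) * ((1 - z) + \<i> * (1 + z) * of_real (tan (\<theta> / 2)))" for z
    proof -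
      have "exp (\<i> * of_real (\<theta> / 2)) * exp (- \<i> * of_real \<theta>) = exp (- (\<i> * of_real (\<theta> / 2)))"
        by (simp flip: exp_add)
      then have "exp (\<i> * of_real (\<theta> / 2)) * (1 - z * exp (- \<i> * of_real \<theta>))
        = cis (\<theta> / 2) - z * cis (- (\<theta> / 2))"
        by (simp add: cis_conv_exp algebra_simps)
      also have "\<dots> = (1 - z) * of_real (cos (\<theta> / 2)) + \<i> * (1 + z) * of_real (sin (\<theta> / 2))"
        by (simp add: complex_eq_iff algebra_simps)
      also have "sin (\<theta> / 2) = cos (\<theta> / 2) * tan (\<theta> / 2)" using cos by (simp add: tan_def)
      finally show ?thesis by (simp add: algebra_simps)
    qed
    have distr: "c ^ size M * (\<Prod>z\<in>#M. f z) = (\<Prod>z\<in>#M. c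
      * f z)" for c :: complex and f and M :: "complex multiset"
      by (induction M) (simp_all add: mult_ac)
    have "exp (\<i> * of_nat CARD('n) * (of_real (\<theta>
      + pi) / 2) - \<i> * (\<Sum>\<phi>\<in>#eigenangles A. of_real \<phi> / 2))
       = K * exp (\<i> * of_real (\<theta> / 2)) ^ size ?L"
      unfolding ofr K_def size_proots_charpoly exp_of_nat_mult[symmetric] exp_add[symmetric]
      by (simp add: algebra_simps add_divide_distrib)
    then have "Z A \<theta> = K * (exp (\<i> * of_real (\<theta> / 2)) ^ size ?L * (\<Prod>z\<in>#?L. 1
      - z * exp (- \<i> * of_real \<theta>)))"
      unfolding Z_def eq1 by simp
    also have "\<dots> = K * (of_real (cos (\<theta> / 2)) ^ size ?L * (\<Prod>z\<in>#?L. (1 - z) + \<i> * (1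
      + z) * of_real (tan (\<theta> / 2))))"
      unfolding distr fac ..
    finally show "Z A \<theta> = K * (of_real (cos (\<theta> / 2) ^ CARD('n))
      * poly (cayley_poly A) (of_real (tan (\<theta> / 2))))"
      by (simp add: size_proots_charpoly cayley_poly_roots)
  qed
qed

text \<open>
  The functions \<open>cos\<^sup>n(\<theta>/2) P(tan(\<theta>/2))\<close> with polynomial \<open>P\<close> are closed under differentiation; this is the
  induced operation on \<open>P\<close>.
\<close>

definition tangent_deriv :: "nat \<Rightarrow> complex poly \<Rightarrow> complex poly" where
  "tangent_deriv n P = smult (- of_nat n / 2) ([:0, 1:] * P) + smult (1 / 2) ([:1, 0, 1:] * pderiv P)"

lemma has_vector_derivative_tangent:
  fixes \<theta> :: real
  assumes th: "\<bar>\<theta>\<bar> < pi"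
  shows "((\<lambda>\<theta>. K * (of_real (cos (\<theta> / 2) ^ n)
    * poly P (of_real (tan (\<theta> / 2))))) has_vector_derivative
    K * (of_real (cos (\<theta> / 2) ^ n) * poly (tangent_deriv n P) (of_real (tan (\<theta> / 2))))) (at \<theta>)"
proof -
  let ?c = "cos (\<theta> / 2)" and ?t = "tan (\<theta> / 2)"
  have cos: "?c \<noteq> 0" using th by (intro less_imp_neq[THEN not_sym] cos_gt_zero_pi) (auto simp: abs_less_iff)
  have dcos: "((\<lambda>\<theta>. cos (\<theta> / 2) ^ n) has_real_derivative - (real n / 2) * ?t * ?c ^ n) (at \<theta>)"
  proof (cases n)
    case (Suc m)
    have "((\<lambda>\<theta>. cos (\<theta> / 2)) has_real_derivative - sin (\<theta> / 2) * (1 / 2)) (at \<theta>)"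
      by (auto intro!: derivative_eq_intros)
    from DERIV_power[OF this, of n]
    have "((\<lambda>\<theta>. cos (\<theta> / 2) ^ n) has_real_derivative real n * (- sin (\<theta> / 2)
      * (1 / 2) * ?c ^ m)) (at \<theta>)"
      by (simp add: Suc)
    moreover have "real n * (- sin (\<theta> / 2) * (1 / 2) * ?c ^ m) = - (real n / 2) * ?t * ?c ^ n"
      using cos by (simp add: Suc tan_def field_simps)
    ultimately show ?thesis by (simp only:)
  qed simp
  have sec: "inverse (?c\<^sup>2) = 1 + ?t\<^sup>2"
    using cos by (simp add: tan_sec flip: power_inverse)
  have "((\<lambda>\<theta>. tan (\<theta> / 2)) has_real_derivative inverse (?c\<^sup>2) * (1 / 2)) (at \<theta>)"
    by (rule DERIV_chain2[where f = tan and g = "\<lambda>\<theta>. \<theta> / 2", OF DERIV_tan[OF cos]]) (auto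
      intro!: derivative_eq_intros)
  then have "((\<lambda>\<theta>. complex_of_real (tan (\<theta> / 2))) has_vector_derivative of_real ((1
    + ?t\<^sup>2) / 2)) (at \<theta>)"
    unfolding sec by (intro has_vector_derivative_of_real) (simp add: has_real_derivative_iff_has_vector_derivative)
  then have "(poly P \<circ> (\<lambda>\<theta>. complex_of_real (tan (\<theta> / 2))) has_vector_derivative
      of_real ((1 + ?t\<^sup>2) / 2) * poly (pderiv P) (of_real ?t)) (at \<theta>)"
    by (rule field_vector_diff_chain_at[OF _ poly_DERIV])
  moreover have "((\<lambda>\<theta>. complex_of_real (cos (\<theta> / 2) ^ n)) has_vector_derivative of_real (-
    (real n / 2) * ?t * ?c ^ n)) (at \<theta>)"
    using dcos by (intro has_vector_derivative_of_real) (simp add: has_real_derivative_iff_has_vector_derivative)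
  ultimately have "((\<lambda>\<theta>. of_real (cos (\<theta> / 2) ^ n)
    * (poly P \<circ> (\<lambda>\<theta>. complex_of_real (tan (\<theta> / 2)))) \<theta>) has_vector_derivative
     of_real (?c ^ n) * (of_real ((1 + ?t\<^sup>2) / 2) * poly (pderiv P) (of_real ?t))
      + of_real (- (real n / 2) * ?t * ?c ^ n) * (poly P \<circ> (\<lambda>\<theta>. complex_of_real (tan
      (\<theta> / 2)))) \<theta>) (at \<theta>)"
    by (intro has_vector_derivative_mult)
  from has_vector_derivative_mult[OF has_vector_derivative_const[of K] this, unfolded o_def]
  show ?thesis
    by (rule has_vector_derivative_eq_rhs) (simp add: tangent_deriv_def power2_eq_square algebra_simps add_divide_distrib)
qed

lemma tangent_deriv_twice:
  "poly (tangent_deriv n (tangent_deriv n P)) 0 = (2 * coeff P 2 - of_nat n * coeff P 0) / 4"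
proof -
  have "coeff (tangent_deriv n P) 1 = coeff P 2 - of_nat n / 2 * coeff P 0"
    by (simp add: tangent_deriv_def coeff_pderiv numeral_2_eq_2 field_simps)
  then show ?thesis
    by (subst tangent_deriv_def) (simp add: poly_0_coeff_0 coeff_pderiv field_simps)
qed

lemma norm_Z_derivatives:
  fixes A :: "complex^'n^'n"
  assumes A: "A \<in> unitary_group"
  shows "cmod (Z A 0) = cmod (coeff (cayley_poly A) 0)"
    and "cmod (Z'' A 0) = cmod (2 * coeff (cayley_poly A) 2 - of_nat CARD('n) * coeff (cayley_poly A) 0) / 4"
proof -
  let ?n = "CARD('n)" and ?C = "cayley_poly A"
  obtain K where K: "cmod K = 1"
    and Z: "\<And>\<theta>. \<bar>\<theta>\<bar> < pi \<Longrightarrow> Z A \<theta>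
      = K * (of_real (cos (\<theta> / 2) ^ ?n) * poly ?C (of_real (tan (\<theta> / 2))))"
    using Z_eq[OF A] by blast
  define f where "f P \<theta> = K * (of_real (cos (\<theta> / 2) ^ ?n)
    * poly P (of_real (tan (\<theta> / 2))))" for P and \<theta> :: real
  have df: "vector_derivative g (at \<theta>) = f (tangent_deriv ?n P) \<theta>"
    if g: "\<And>x. \<bar>x\<bar> < pi \<Longrightarrow> g x = f P x" and th: "\<bar>\<theta>\<bar> < pi" for g P \<theta>
  proof (rule vector_derivative_at, rule has_vector_derivative_transform_within_open[where S = "{-pi<..<pi}" and f = "f P"])
    show "(f P has_vector_derivative f (tangent_deriv ?n P) \<theta>) (at \<theta>)"
      unfolding f_def by (rule has_vector_derivative_tangent[OF th])
  qed (use th g in \<open>auto simp: abs_less_iff\<close>)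
  have Z: "Z A x = f ?C x" if "\<bar>x\<bar> < pi" for x using Z[OF that] by (simp add: f_def)
  have Z1: "Z' A x = f (tangent_deriv ?n ?C) x" if "\<bar>x\<bar> < pi" for x
    unfolding Z'_def by (rule df[OF Z that])
  have Z2: "Z'' A 0 = f (tangent_deriv ?n (tangent_deriv ?n ?C)) 0"
    unfolding Z''_def by (rule df[OF Z1]) simp_all
  show "cmod (Z A 0) = cmod (coeff ?C 0)"
    using Z[of 0] K by (simp add: f_def norm_mult poly_0_coeff_0)
  show "cmod (Z'' A 0) = cmod (2 * coeff ?C 2 - of_nat ?n * coeff ?C 0) / 4"
    unfolding Z2 f_def using K by (simp add: norm_mult tangent_deriv_twice norm_divide)
qed

lemma square_powr: "(x\<^sup>2) powr a = x powr (2 * a)" if "x > 0" for x a :: real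
proof -
  have "(x\<^sup>2) powr a = (x powr 2) powr a" using that by simp
  then show ?thesis by (simp only: powr_powr)
qed

lemma integrand_0_eq:
  fixes A :: "complex^'n^'n"
  assumes A: "A \<in> unitary_group"
  shows "integrand_0 s A = cayley_modulus A powr (s - 1) * moment_density 0 0 A"
proof -
  let ?z = "cmod (coeff (cayley_poly A) 0)"
  have r: "cayley_modulus A = ?z\<^sup>2"
    by (simp add: moment_density_def cmod_power2 flip: power2_eq_square)
  show ?thesis
  proof (cases "?z = 0")
    case False
    then have "?z powr (2 * s) = (?z\<^sup>2) powr (s - 1) * ?z\<^sup>2"
      using powr_add[of ?z "2 * (s - 1)" 2] by (simp add: square_powr)
    then show ?thesis
      by (simp add: integrand_0_def norm_Z_derivatives[OF A] r)
  qed (simp add: integrand_0_def norm_Z_derivatives[OF A] r)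
qed

lemma integrand_20_eq:
  fixes A :: "complex^'n^'n"
  assumes A: "A \<in> unitary_group" and N: "N = real CARD('n)"
  shows "integrand_20 s A = cayley_modulus A powr (s - 1) *
    ((4 * moment_density 2 2 A - 4 * N * moment_density 0 2 A + N\<^sup>2 * moment_density 0 0 A) / 16)"
proof -
  let ?c = "coeff (cayley_poly A)"
  have r: "cayley_modulus A = (cmod (?c 0))\<^sup>2"
    by (simp add: moment_density_def cmod_power2 flip: power2_eq_square)
  have p: "(cmod (?c 0)) powr (2 * s - 2) = cayley_modulus A powr (s - 1)"
  proof (cases "?c 0 = 0")
    case False
    then show ?thesis using square_powr[of "cmod (?c 0)" "s - 1"] by (simp add: r right_diff_distrib)
  qed (simp add: r)
  have "(cmod (2 * ?c 2 - of_nat CARD('n) * ?c 0))\<^sup>2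
    = 4 * moment_density 2 2 A - 4 * N * moment_density 0 2 A + N\<^sup>2 * moment_density 0 0 A"
    unfolding cmod_power2 moment_density_def N by (simp add: power2_eq_square algebra_simps)
  then show ?thesis
    by (simp add: integrand_20_def norm_Z_derivatives[OF A] p power_divide)
qed

section \<open>The second moment of the second derivative\<close>

text \<open>
  The system is block triangular: the first and third equations give \<open>E02\<close> and \<open>E11\<close>, the second and fourth then
  \<open>E04\<close> and \<open>E13\<close>, and the last one \<open>E22\<close>. Each is solved by dividing by one of \<open>2s - 1\<close>, \<open>2s + 1\<close>,
  \<open>2s + 3\<close>, \<open>s\<close>; the factor \<open>s\<close> cancels in the end.
\<close>

lemma moment_system_solution:
  fixes s N M E02 E04 E11 E13 E22 :: real
  assumes s: "1 / 2 < s"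
    and g00: "N * (N + 1) / 4 * M + (1 / 2 - s) * E11 + (s - 1 / 2) * E02 = 0"
    and g02: "(s - 1 / 2) * ((N - 1) / 2) * E11 + (N * (N + 1) / 4 + (s - 1 / 2)) * E02 + (1 - 2 * s) * E13
      + (2 * s - 1) * E04 = 0"
    and r10: "(- N / 2) * M + (s - 1 / 2) * E11 + 1 * E02 = 0"
    and r30: "(1 - N / 2) * E02 + (s - 1 / 2) * E13 + 2 * E04 = 0"
    and g20: "(1 - N) / 4 * E11 + (N * (N - 1) / 4 + 1 / 2) * E02 + 1 / 2 * E13
      + 1 * E04 + s * E22 = 0"
  shows "(4 * E22 - 4 * N * E02 + N\<^sup>2 * M) / 16 = M / 16 *
      (N ^ 4 / ((2 * s + 3) * (2 * s - 1))
       + 4 * s * N ^ 3 / ((2 * s + 3) * (2 * s - 1))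
       + 4 * (2 * s ^ 3 + s ^ 2 - 1) * N ^ 2 / ((2 * s + 3) * (2 * s - 1) * (2 * s + 1))
       - 8 * s * N / ((2 * s + 3) * (2 * s - 1) * (2 * s + 1)))"
proof -
  define a b c where "a = 2 * s - 1" and "b = 2 * s + 1" and "c = 2 * s + 3"
  have nz: "a \<noteq> 0" "b \<noteq> 0" "c \<noteq> 0" "s \<noteq> 0" using s by (auto simp: a_def b_def c_def)
  have e02: "2 * b * E02 = - (N * (N - 1) * M)"
    using g00 r10 unfolding b_def by algebra
  have e11: "a * E11 = N * M - 2 * E02"
    using r10 unfolding a_def by algebra
  have e04: "4 * c * E04 = - ((N - 2) * (N - 3) * E02)"
    using g02 r10 r30 e02 unfolding b_def c_def by algebra
  have e13: "a * E13 = (N - 2) * E02 - 4 * E04"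
    using r30 unfolding a_def by algebra
  have e22: "4 * s * E22 = - (2 * E13 - (N - 1) * E11 + (N * (N - 1) + 2) * E02 + 4 * E04)"
    using g20 by algebra
  have "s * (a * b * c * (4 * E22 - 4 * N * E02 + N\<^sup>2 * M))
    = s * (M * (b * N ^ 4 + b * 4 * s * N ^ 3 + 4 * (2 * s ^ 3 + s ^ 2 - 1) * N ^ 2 - 8 * s * N))"
    using e02 e11 e04 e13 e22 unfolding a_def b_def c_def by algebra
  then have "a * b * c * (4 * E22 - 4 * N * E02 + N\<^sup>2 * M)
    = M * (b * N ^ 4 + b * 4 * s * N ^ 3 + 4 * (2 * s ^ 3 + s ^ 2 - 1) * N ^ 2 - 8 * s * N)"
    using nz by simp
  then have "4 * E22 - 4 * N * E02 + N\<^sup>2 * M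
    = M * (b * N ^ 4 + b * 4 * s * N ^ 3 + 4 * (2 * s ^ 3 + s ^ 2 - 1) * N ^ 2 - 8 * s * N) / (c * a * b)"
    using nz by (simp add: field_simps)
  also have "\<dots> = M * (N ^ 4 / (c * a) + 4 * s * N ^ 3 / (c * a)
       + 4 * (2 * s ^ 3 + s ^ 2 - 1) * N ^ 2 / (c * a * b) - 8 * s * N / (c * a * b))"
    using nz by (simp add: add_divide_distrib diff_divide_distrib ring_distribs)
  finally show ?thesis unfolding a_def b_def c_def by simp
qed

theorem proposition1p10:
  fixes \<mu> :: "(complex^'n^'n) measure" and s N :: real
  assumes "haar_unitary \<mu>"
    and "N = real CARD('n)"
    and "1 / 2 < s"
  shows "integrable \<mu> (integrand_20 s) \<and> integrable \<mu> (integrand_0 s) \<and>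
    F_20 \<mu> s = F_0 \<mu> s / 16 *
      (N ^ 4 / ((2 * s + 3) * (2 * s - 1))
       + 4 * s * N ^ 3 / ((2 * s + 3) * (2 * s - 1))
       + 4 * (2 * s ^ 3 + s ^ 2 - 1) * N ^ 2 / ((2 * s + 3) * (2 * s - 1) * (2 * s + 1))
       - 8 * s * N / ((2 * s + 3) * (2 * s - 1) * (2 * s + 1)))"
proof -
  interpret haar \<mu> by unfold_locales (rule assms(1))
  let ?d = "\<lambda>A. (4 * moment_density 2 2 A - 4 * N * moment_density 0 2 A + N\<^sup>2 * moment_density 0 0 A) / 16"
  have d: "?d A = N\<^sup>2 / 16 * moment_density 0 0 A + 0 * moment_density 1 1 A + (- N / 4) * moment_density 0 2 A
    + 0 * moment_density 1 3 A + 0 * moment_density 0 4 A + 1 / 4 * moment_density 2 2 A" for A :: "complex^'n^'n"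
    by simp
  have i20: "integrable \<mu> (\<lambda>A. cayley_modulus A powr (s - 1) * ?d A)"
    and i0: "integrable \<mu> (\<lambda>A. cayley_modulus A powr (s - 1) * moment_density 0 0 A)"
    by (intro integrable_weighted_density assms(3) continuous_intros continuous_on_moment_density; simp)+
  have e20: "integrand_20 s A = cayley_modulus A powr (s - 1) * ?d A"
    and e0: "integrand_0 s A = cayley_modulus A powr (s - 1) * moment_density 0 0 A" if "A \<in> space \<mu>" for A
    using that integrand_20_eq[OF _ assms(2)] integrand_0_eq by (auto simp: space_eq)
  have F20: "F_20 \<mu> s = (4 * moment s 2 2 - 4 * N * moment s 0 2 + N\<^sup>2 * moment s 0 0) / 16"
  proof -
    have "F_20 \<mu> s = (LINT A|\<mu>. cayley_modulus A powr (s - 1) * ?d A)"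
      unfolding F_20_def by (rule Bochner_Integration.integral_cong[OF refl e20])
    then show ?thesis unfolding d integral_moment_combination[OF assms(3)] by simp
  qed
  have F0: "F_0 \<mu> s = moment s 0 0"
    unfolding F_0_def moment_def by (rule Bochner_Integration.integral_cong[OF refl e0])
  have "integrable \<mu> (integrand_20 s)"
    by (rule iffD2[OF Bochner_Integration.integrable_cong[OF refl e20] i20])
  moreover have "integrable \<mu> (integrand_0 s)"
    by (rule iffD2[OF Bochner_Integration.integrable_cong[OF refl e0] i0])
  moreover note moment_system_solution[OF assms(3) moment_gradient_00[OF assms(3,2)] moment_gradient_02[OF assms(3,2)]
    moment_rotation_10[OF assms(3,2)] moment_rotation_30[OF assms(3,2)] moment_gradient_20_rotation_21[OF assms(3,2)]]
  ultimately show ?thesis unfolding F20 F0 by blast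
qed

end
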